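(* Let $\mathcal L$ be a Cameron–Liebler line class in $PG(3,4)$ with parameter $x=7$. Then there exist a point $P$, a plane $\pi$ not containing $P$, and a hyperoval $O$ in $\pi$ such that, with $C$ the set of the six lines joining $P$ to the points of $O$, $\mathcal L$ consists exactly of: the lines of $C$; the lines not through $P$ and containing no point of $O$ that meet two lines of $C$ (the $2$-secants of $C$); and the lines contained in $\pi$ that contain no point of $O$. In other words, a Cameron–Liebler line class with parameter $7$ in $PG(3,4)$ is unique, namely the one arising from this construction.
   Context: A set $\mathcal L$ of lines of $PG(3,q)$ is a Cameron–Liebler line class with parameter $x$ (an integer) if for every line $l$, $|\{m\in\mathcal L\setminus\{l\}: m \text{ meets } l\}| = (q+1)x+(q^2-1)\chi_{\mathcal L}(l)$, where $\chi_{\mathcal L}$ is the characteristic function of $\mathcal L$. A hyperoval in a projective plane of order $q$ is a set of $q+2$ points no three of which are collinear. *)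

theory Defs
  imports "HOL-Analysis.Analysis" "HOL-Library.Numeral_Type"
begin

text \<open>
  The projective space \<open>PG(3,q)\<close> is the lattice of subspaces of the vector space \<open>'a ^ 4\<close>,
  where \<open>'a\<close> is a finite field with \<open>q = CARD('a)\<close> elements. Points, lines and planes are the
  vector subspaces of dimension 1, 2 and 3, and incidence is inclusion.
\<close>

definition pg_points :: "('a::{field,finite} ^ 4) set set" where
  "pg_points = {S. vec.subspace S \<and> vec.dim S = 1}"

definition pg_lines :: "('a::{field,finite} ^ 4) set set" where
  "pg_lines = {S. vec.subspace S \<and> vec.dim S = 2}"

definition pg_planes :: "('a::{field,finite} ^ 4) set set" where
  "pg_planes = {S. vec.subspace S \<and> vec.dim S = 3}"

definition meets :: "('a::{field,finite} ^ 4) set \<Rightarrow> ('a ^ 4) set \<Rightarrow> bool" where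
  "meets l m \<longleftrightarrow> (\<exists>p\<in>pg_points. p \<subseteq> l \<and> p \<subseteq> m)"

definition join :: "('a::{field,finite} ^ 4) set \<Rightarrow> ('a ^ 4) set \<Rightarrow> ('a ^ 4) set" where
  "join S T = vec.span (S \<union> T)"

definition collinear_points ::
    "('a::{field,finite} ^ 4) set \<Rightarrow> ('a ^ 4) set \<Rightarrow> ('a ^ 4) set \<Rightarrow> bool" where
  "collinear_points p r s \<longleftrightarrow> (\<exists>l\<in>pg_lines. p \<subseteq> l \<and> r \<subseteq> l \<and> s \<subseteq> l)"

definition cameron_liebler :: "('a::{field,finite} ^ 4) set set \<Rightarrow> int \<Rightarrow> bool" where
  "cameron_liebler L x \<longleftrightarrow>
     L \<subseteq> pg_lines \<and>
     (\<forall>l\<in>pg_lines.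
        int (card {m \<in> L - {l}. meets m l}) =
          (int CARD('a) + 1) * x + ((int CARD('a))\<^sup>2 - 1) * indicator L l)"

definition hyperoval_in :: "('a::{field,finite} ^ 4) set set \<Rightarrow> ('a ^ 4) set \<Rightarrow> bool" where
  "hyperoval_in H \<pi> \<longleftrightarrow>
     H \<subseteq> {p \<in> pg_points. p \<subseteq> \<pi>} \<and>
     card H = CARD('a) + 2 \<and>
     (\<forall>p\<in>H. \<forall>r\<in>H. \<forall>s\<in>H.
        p \<noteq> r \<and> p \<noteq> s \<and> r \<noteq> s \<longrightarrow> \<not> collinear_points p r s)"

definition cone :: "('a::{field,finite} ^ 4) set \<Rightarrow> ('a ^ 4) set set \<Rightarrow> ('a ^ 4) set set" where
  "cone P H = join P ` H"

definition hyperoval_line_class ::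
    "('a::{field,finite} ^ 4) set \<Rightarrow> ('a ^ 4) set \<Rightarrow> ('a ^ 4) set set \<Rightarrow> ('a ^ 4) set set" where
  "hyperoval_line_class P \<pi> H =
     cone P H \<union>
     {m \<in> pg_lines. \<not> P \<subseteq> m \<and> (\<forall>R\<in>H. \<not> R \<subseteq> m) \<and> card {c \<in> cone P H. meets m c} = 2} \<union>
     {m \<in> pg_lines. m \<subseteq> \<pi> \<and> (\<forall>R\<in>H. \<not> R \<subseteq> m)}"

text \<open>
  A collineation is taken as an automorphism of the whole subspace lattice, so that its action on
  a set \<open>L\<close> of lines is simply the image \<open>f ` L\<close>.
\<close>

definition collineation :: "(('a::{field,finite} ^ 4) set \<Rightarrow> ('a ^ 4) set) \<Rightarrow> bool" where
  "collineation f \<longleftrightarrow>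
     bij_betw f {S. vec.subspace S} {S. vec.subspace S} \<and>
     (\<forall>S T. vec.subspace S \<longrightarrow> vec.subspace T \<longrightarrow> (f S \<subseteq> f T \<longleftrightarrow> S \<subseteq> T))"

end

theory Submission imports Defs begin

text \<open>
  Let \<open>s(p)\<close> and \<open>t(m)\<close> count the lines of the class \<open>L\<close> on a point \<open>p\<close> and in a plane \<open>m\<close>. For
  incident \<open>p\<close>, \<open>m\<close> one has \<open>s(p) + t(m) = 7 + 5c\<close>, where \<open>c\<close> counts the lines of \<open>L\<close> in the pencil,
  and second moments force \<open>s = 1 + 5a\<close>, \<open>t = 1 + 5b\<close> with \<open>0 \<le> a, b \<le> 4\<close>. The class is determined by
  \<open>a\<close>: the points of a line have total weight 10 if the line is in \<open>L\<close> and 6 otherwise. The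
  moments of \<open>a\<close> and \<open>b\<close> exclude the value 4. A point of weight 0 is on a unique line of \<open>L\<close>, its axis,
  and the planes on it have weight 2 or 1 according to whether they contain the axis. Counting pairs
  of points of weight 0 in the planes of weight 1 and of weight 2, applying Cauchy--Schwarz, and
  doing the same for the dual class, leaves exactly six points and six planes of weight 0, with
  exactly two points of weight 0 in every plane of weight 2. Hence the six axes are pairwise coplanar
  and concurrent in a point \<open>P\<close>; dually the points of weight 0 lie in a plane \<open>\<pi>\<close>, where they form
  a hyperoval.

  Conversely, the weight \<open>1 + [x \<in> \<pi>] + 2 [x \<noteq> P on the cone] - 4 [x \<in> H]\<close> has line sums 6 and 10
  for any hyperoval \<open>H\<close>, which gives existence. All hyperovals of PG(2,4) are equivalent because four of
  the six points form a frame that determines the other two.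
\<close>

section \<open>The incidence structure of PG(3,4)\<close>

text \<open>The geometry is axiomatized as a self-dual incidence structure, so every fact about
  points yields its counterpart about planes by instantiating the same locale with the converse
  relation. The three moments of \<open>a\<close> leave the numbers of points of weight 0 and of
  weight 4 undetermined, which is why the value 4 needs an argument of its own. Its exclusion bounds
  the weights by 3, and then a line of the class, with total 10, cannot carry two points of weight
  0. This makes the points of weight 0 behave like a design in the planes of weight 2 and in those
  of weight 1: the number of such planes on a point and on a pair is constant, so second moments can
  be computed. The bounds from the two kinds of planes and their duals meet only at six and six,
  where the one from the planes of weight 2 is an equality; hence the constant number two of points
  of weight 0 in them. The class is finally recognized by a squeeze rather than by a case analysis
  of its lines: the weight of the cone is at most \<open>a\<close> at every point, and both have
  total 130.\<close>

lemma sum_swap_incidence: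
  fixes f :: "'b \<Rightarrow> int"
  assumes "finite A" "finite B"
  shows "(\<Sum>x\<in>A. \<Sum>y | y \<in> B \<and> R x y. f y) = (\<Sum>y\<in>B. int (card {x\<in>A. R x y}) * f y)"
  using sum.swap_restrict[OF assms, of "\<lambda>_. f" R] by simp

text \<open>The incidence counts below equal \<open>k + 1\<close> on a special set and 1 elsewhere;
  the excess \<open>k\<close> is split off.\<close>

lemma sum_weight_split:
  fixes f :: "'b \<Rightarrow> int"
  assumes "finite A"
  shows "(\<Sum>y\<in>A. (if P y then k + 1 else 1) * f y) = sum f A + k * sum f {y\<in>A. P y}"
proof -
  have "(\<Sum>y\<in>A. (if P y then k + 1 else 1) * f y) = (\<Sum>y\<in>A. f y + (if P y then k * f y else 0))"
    by (rule sum.cong) (auto simp: algebra_simps)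
  also have "\<dots> = sum f A + (\<Sum>y\<in>A. if P y then k * f y else 0)"
    by (rule sum.distrib)
  also have "(\<Sum>y\<in>A. if P y then k * f y else 0) = k * sum f {y\<in>A. P y}"
    using assms by (simp add: sum.If_cases sum_distrib_left Int_def)
  finally show ?thesis .
qed

lemma card_eq_1_ex1: "\<exists>!x. P x \<Longrightarrow> card {x. P x} = 1"
  by (auto simp: card_1_singleton_iff)

lemma sum_of_bool_card:
  assumes "finite A"
  shows "(\<Sum>x\<in>A. of_bool (P x)) = int (card {x\<in>A. P x})"
  using assms by (simp add: of_bool_def sum.If_cases Int_def)

text \<open>Points, lines and planes share one type and one relation, and the assumptions come in
  dual pairs, so that exchanging \<open>Pt\<close> with \<open>Pl\<close> and reversing the relation
  gives another instance.\<close>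

locale pg34 =
  fixes Pt Ln Pl :: "'b set" and I :: "'b \<Rightarrow> 'b \<Rightarrow> bool" (infix "\<lhd>" 50)
  assumes finite_Pt: "finite Pt" and finite_Ln: "finite Ln" and finite_Pl: "finite Pl"
    and card_Pt: "card Pt = 85" and card_Pl: "card Pl = 85"
    and inc_trans: "\<lbrakk>p \<in> Pt; l \<in> Ln; m \<in> Pl; p \<lhd> l; l \<lhd> m\<rbrakk> \<Longrightarrow> p \<lhd> m"
    and join_ex1: "\<lbrakk>p \<in> Pt; q \<in> Pt; p \<noteq> q\<rbrakk> \<Longrightarrow> \<exists>!l. l \<in> Ln \<and> p \<lhd> l \<and> q \<lhd> l"
    and meet_ex1: "\<lbrakk>m \<in> Pl; n \<in> Pl; m \<noteq> n\<rbrakk> \<Longrightarrow> \<exists>!l. l \<in> Ln \<and> l \<lhd> m \<and> l \<lhd> n"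
    and line_in_plane: "\<lbrakk>p \<in> Pt; q \<in> Pt; p \<noteq> q; l \<in> Ln; m \<in> Pl; p \<lhd> l; q \<lhd> l; p \<lhd> m; q \<lhd> m\<rbrakk> \<Longrightarrow> l \<lhd> m"
    and point_on_line: "\<lbrakk>m \<in> Pl; n \<in> Pl; m \<noteq> n; l \<in> Ln; p \<in> Pt; l \<lhd> m; l \<lhd> n; p \<lhd> m; p \<lhd> n\<rbrakk> \<Longrightarrow> p \<lhd> l"
    and span_ex1: "\<lbrakk>p \<in> Pt; l \<in> Ln; \<not> p \<lhd> l\<rbrakk> \<Longrightarrow> \<exists>!m. m \<in> Pl \<and> p \<lhd> m \<and> l \<lhd> m"
    and trace_ex1: "\<lbrakk>m \<in> Pl; l \<in> Ln; \<not> l \<lhd> m\<rbrakk> \<Longrightarrow> \<exists>!p. p \<in> Pt \<and> p \<lhd> m \<and> p \<lhd> l"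
    and card_points_line: "l \<in> Ln \<Longrightarrow> card {p\<in>Pt. p \<lhd> l} = 5"
    and card_planes_line: "l \<in> Ln \<Longrightarrow> card {m\<in>Pl. l \<lhd> m} = 5"
    and card_pencil: "\<lbrakk>p \<in> Pt; m \<in> Pl; p \<lhd> m\<rbrakk> \<Longrightarrow> card {l\<in>Ln. p \<lhd> l \<and> l \<lhd> m} = 5"
    and card_lines_point: "p \<in> Pt \<Longrightarrow> card {l\<in>Ln. p \<lhd> l} = 21"
    and card_lines_plane: "m \<in> Pl \<Longrightarrow> card {l\<in>Ln. l \<lhd> m} = 21"
    and card_planes_point: "p \<in> Pt \<Longrightarrow> card {m\<in>Pl. p \<lhd> m} = 21"
    and card_points_plane: "m \<in> Pl \<Longrightarrow> card {p\<in>Pt. p \<lhd> m} = 21"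
begin

lemma dual_pg34: "pg34 Pl Ln Pt (\<lambda>x y. y \<lhd> x)"
proof unfold_locales
  show "card {l \<in> Ln. l \<lhd> m \<and> p \<lhd> l} = 5" if "m \<in> Pl" "p \<in> Pt" "p \<lhd> m" for m p
    using card_pencil[OF that(2,1,3)] by (simp add: conj_commute)
  show "p \<lhd> m" if "m \<in> Pl" "l \<in> Ln" "p \<in> Pt" "l \<lhd> m" "p \<lhd> l" for m l p
    using inc_trans that by blast
  show "p \<lhd> l" if "m \<in> Pl" "n \<in> Pl" "m \<noteq> n" "l \<in> Ln" "p \<in> Pt" "l \<lhd> m" "l \<lhd> n" "p \<lhd> m" "p \<lhd> n" for m n l p
    using point_on_line that by blast
  show "l \<lhd> m" if "p \<in> Pt" "q \<in> Pt" "p \<noteq> q" "l \<in> Ln" "m \<in> Pl" "p \<lhd> l" "q \<lhd> l" "p \<lhd> m" "q \<lhd> m" for p q l m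
    using line_in_plane that by blast
qed (fact finite_Pt finite_Ln finite_Pl card_Pt card_Pl join_ex1 meet_ex1 span_ex1 trace_ex1
      card_points_line card_planes_line card_lines_point card_lines_plane
      card_planes_point card_points_plane)+

lemma line_unique:
  "\<lbrakk>p \<in> Pt; q \<in> Pt; p \<noteq> q; l \<in> Ln; k \<in> Ln; p \<lhd> l; q \<lhd> l; p \<lhd> k; q \<lhd> k\<rbrakk> \<Longrightarrow> l = k"
  using join_ex1 by blast

lemma obtain_join:
  assumes "p \<in> Pt" "q \<in> Pt" "p \<noteq> q"
  obtains l where "l \<in> Ln" "p \<lhd> l" "q \<lhd> l"
  using join_ex1[OF assms] by blast

lemma obtain_span:
  assumes "p \<in> Pt" "l \<in> Ln" "\<not> p \<lhd> l"
  obtains m where "m \<in> Pl" "p \<lhd> m" "l \<lhd> m"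
  using span_ex1[OF assms] by blast

lemma obtain_meet:
  assumes "m \<in> Pl" "n \<in> Pl" "m \<noteq> n"
  obtains l where "l \<in> Ln" "l \<lhd> m" "l \<lhd> n"
  using meet_ex1[OF assms] by blast

lemma obtain_trace:
  assumes "m \<in> Pl" "l \<in> Ln"
  obtains p where "p \<in> Pt" "p \<lhd> m" "p \<lhd> l"
proof (cases "l \<lhd> m")
  case True
  have "{p\<in>Pt. p \<lhd> l} \<noteq> {}"
    using card_points_line[OF assms(2)] by (metis card.empty zero_neq_numeral)
  with True that inc_trans assms show ?thesis by blast
next
  case False
  with trace_ex1[OF assms] that show ?thesis by blast
qed

lemma obtain_point_on_line:
  assumes "l \<in> Ln"
  obtains p where "p \<in> Pt" "p \<lhd> l"
proof -
  have "{p\<in>Pt. p \<lhd> l} \<noteq> {}"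
    using card_points_line[OF assms] by (metis card.empty zero_neq_numeral)
  with that show ?thesis by blast
qed

lemma obtain_plane_on_line:
  assumes "l \<in> Ln"
  obtains m where "m \<in> Pl" "l \<lhd> m"
  using pg34.obtain_point_on_line[OF dual_pg34 assms] by blast

text \<open>A second plane \<open>n\<close> on \<open>k\<close> cuts \<open>l\<close> in a point
  that lies in both \<open>m\<close> and \<open>n\<close>, hence on their common line
  \<open>k\<close>.\<close>

lemma lines_meet_in_plane:
  assumes "l \<in> Ln" "k \<in> Ln" "l \<noteq> k" "m \<in> Pl" "l \<lhd> m" "k \<lhd> m"
  obtains p where "p \<in> Pt" "p \<lhd> l" "p \<lhd> k"
proof -
  have "card ({n\<in>Pl. k \<lhd> n} - {m}) = 4"
    using assms card_planes_line[OF assms(2)] by (simp add: card_Diff_singleton_if)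
  then have "{n\<in>Pl. k \<lhd> n} - {m} \<noteq> {}"
    by (metis card.empty zero_neq_numeral)
  then obtain n where n: "n \<in> Pl" "k \<lhd> n" "n \<noteq> m" by blast
  obtain p where p: "p \<in> Pt" "p \<lhd> n" "p \<lhd> l"
    using obtain_trace n assms by blast
  have "p \<lhd> m" using p assms inc_trans by blast
  then have "p \<lhd> k" using point_on_line[of m n k p] n p assms by blast
  then show ?thesis using that p by blast
qed

lemma lines_common_point_le:
  assumes "l \<in> Ln" "k \<in> Ln" "l \<noteq> k"
  shows "p \<in> Pt \<Longrightarrow> q \<in> Pt \<Longrightarrow> p \<lhd> l \<Longrightarrow> p \<lhd> k \<Longrightarrow> q \<lhd> l \<Longrightarrow> q \<lhd> k \<Longrightarrow> p = q"
  using line_unique assms by blast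

section \<open>Double counts over stars, pencils and the planes on a line\<close>

lemma card_join: "\<lbrakk>p \<in> Pt; q \<in> Pt; p \<noteq> q\<rbrakk> \<Longrightarrow> card {l\<in>Ln. p \<lhd> l \<and> q \<lhd> l} = 1"
  using card_eq_1_ex1[OF join_ex1] by simp

lemma card_span: "\<lbrakk>p \<in> Pt; l \<in> Ln; \<not> p \<lhd> l\<rbrakk> \<Longrightarrow> card {m\<in>Pl. p \<lhd> m \<and> l \<lhd> m} = 1"
  using card_eq_1_ex1[OF span_ex1] by simp

text \<open>Each other point is on one line through \<open>p\<close>, while \<open>p\<close> is on
  all 21; the excess is 20. In a pencil, with five lines, the same count has excess 4.\<close>

lemma sum_star:
  fixes f :: "'b \<Rightarrow> int"
  assumes "p \<in> Pt"
  shows "(\<Sum>l | l \<in> Ln \<and> p \<lhd> l. \<Sum>q | q \<in> Pt \<and> q \<lhd> l. f q) = sum f Pt + 20 * f p"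
proof -
  let ?A = "{l\<in>Ln. p \<lhd> l}"
  have c: "int (card {l \<in> ?A. q \<lhd> l}) = (if q = p then 20 + 1 else 1)" if "q \<in> Pt" for q
    using card_join[of p q] card_lines_point[OF assms] that assms by auto
  have "(\<Sum>l\<in>?A. \<Sum>q | q \<in> Pt \<and> q \<lhd> l. f q) = (\<Sum>q\<in>Pt. int (card {l \<in> ?A. q \<lhd> l}) * f q)"
    by (rule sum_swap_incidence) (use finite_Ln finite_Pt in auto)
  also have "\<dots> = (\<Sum>q\<in>Pt. (if q = p then 20 + 1 else 1) * f q)"
    by (rule sum.cong[OF refl]) (simp only: c)
  also have "\<dots> = sum f Pt + 20 * sum f {q\<in>Pt. q = p}"
    by (rule sum_weight_split) (simp add: finite_Pt)
  also have "{q\<in>Pt. q = p} = {p}" using assms by auto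
  finally show ?thesis by simp
qed

lemma sum_pencil:
  fixes f :: "'b \<Rightarrow> int"
  assumes "p \<in> Pt" "m \<in> Pl" "p \<lhd> m"
  shows "(\<Sum>l | l \<in> Ln \<and> p \<lhd> l \<and> l \<lhd> m. \<Sum>q | q \<in> Pt \<and> q \<lhd> l. f q)
    = (\<Sum>q | q \<in> Pt \<and> q \<lhd> m. f q) + 4 * f p"
proof -
  let ?A = "{l\<in>Ln. p \<lhd> l \<and> l \<lhd> m}" and ?B = "{q\<in>Pt. q \<lhd> m}"
  have c: "int (card {l \<in> ?A. q \<lhd> l}) = (if q = p then 4 + 1 else 1)" if "q \<in> ?B" for q
  proof (cases "q = p")
    case True
    then have "{l \<in> ?A. q \<lhd> l} = ?A" by auto
    then show ?thesis using True card_pencil[OF assms] by simp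
  next
    case False
    have "{l \<in> ?A. q \<lhd> l} = {l\<in>Ln. p \<lhd> l \<and> q \<lhd> l}"
      using line_in_plane[of p q _ m] False that assms by blast
    then show ?thesis using False card_join[of p q] that assms by simp
  qed
  have "(\<Sum>l\<in>?A. \<Sum>q | q \<in> Pt \<and> q \<lhd> l. f q) = (\<Sum>l\<in>?A. \<Sum>q | q \<in> ?B \<and> q \<lhd> l. f q)"
    by (rule sum.cong[OF refl], rule sum.cong) (use inc_trans assms in auto)
  also have "\<dots> = (\<Sum>q\<in>?B. int (card {l \<in> ?A. q \<lhd> l}) * f q)"
    by (rule sum_swap_incidence) (use finite_Ln finite_Pt in auto)
  also have "\<dots> = (\<Sum>q\<in>?B. (if q = p then 4 + 1 else 1) * f q)"
    by (rule sum.cong[OF refl]) (simp only: c)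
  also have "\<dots> = sum f ?B + 4 * sum f {q\<in>?B. q = p}"
    by (rule sum_weight_split) (simp add: finite_Pt)
  also have "{q\<in>?B. q = p} = {p}" using assms by auto
  finally show ?thesis by simp
qed

text \<open>A point off \<open>l\<close> is in one of the five planes on \<open>l\<close>, a point
  of \<open>l\<close> in all of them. This is the bridge from sums along a line to sums over the
  planes on it.\<close>

lemma sum_axis:
  fixes f :: "'b \<Rightarrow> int"
  assumes "l \<in> Ln"
  shows "(\<Sum>m | m \<in> Pl \<and> l \<lhd> m. \<Sum>q | q \<in> Pt \<and> q \<lhd> m. f q)
    = sum f Pt + 4 * (\<Sum>q | q \<in> Pt \<and> q \<lhd> l. f q)"
proof -
  let ?A = "{m\<in>Pl. l \<lhd> m}"
  have c: "int (card {m \<in> ?A. q \<lhd> m}) = (if q \<lhd> l then 4 + 1 else 1)" if "q \<in> Pt" for q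
  proof (cases "q \<lhd> l")
    case True
    then have "{m \<in> ?A. q \<lhd> m} = ?A" using inc_trans that assms by auto
    then show ?thesis using True card_planes_line[OF assms] by simp
  next
    case False
    have "{m \<in> ?A. q \<lhd> m} = {m\<in>Pl. q \<lhd> m \<and> l \<lhd> m}" by auto
    then show ?thesis using False card_span[of q l] that assms by simp
  qed
  have "(\<Sum>m\<in>?A. \<Sum>q | q \<in> Pt \<and> q \<lhd> m. f q) = (\<Sum>q\<in>Pt. int (card {m \<in> ?A. q \<lhd> m}) * f q)"
    by (rule sum_swap_incidence) (use finite_Pl finite_Pt in auto)
  also have "\<dots> = (\<Sum>q\<in>Pt. (if q \<lhd> l then 4 + 1 else 1) * f q)"
    by (rule sum.cong[OF refl]) (simp only: c)
  also have "\<dots> = sum f Pt + 4 * sum f {q\<in>Pt. q \<lhd> l}"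
    by (rule sum_weight_split) (simp add: finite_Pt)
  finally show ?thesis by simp
qed

lemma sum_planes:
  fixes f :: "'b \<Rightarrow> int"
  shows "(\<Sum>m\<in>Pl. \<Sum>q | q \<in> Pt \<and> q \<lhd> m. f q) = 21 * sum f Pt"
proof -
  have "(\<Sum>m\<in>Pl. \<Sum>q | q \<in> Pt \<and> q \<lhd> m. f q) = (\<Sum>q\<in>Pt. int (card {m \<in> Pl. q \<lhd> m}) * f q)"
    by (rule sum_swap_incidence) (use finite_Pl finite_Pt in auto)
  also have "\<dots> = (\<Sum>q\<in>Pt. 21 * f q)"
    using card_planes_point by (intro sum.cong) auto
  finally show ?thesis by (simp add: sum_distrib_left)
qed

lemma exists_common_plane:
  assumes "p \<in> Pt" "q \<in> Pt"
  obtains m where "m \<in> Pl" "p \<lhd> m" "q \<lhd> m"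
proof (cases "p = q")
  case True
  have "{m\<in>Pl. p \<lhd> m} \<noteq> {}"
    using card_planes_point[OF assms(1)] by (metis card.empty zero_neq_numeral)
  then show ?thesis using True that by blast
next
  case False
  then obtain l where l: "l \<in> Ln" "p \<lhd> l" "q \<lhd> l" using obtain_join assms by blast
  then obtain m where "m \<in> Pl" "l \<lhd> m" using obtain_plane_on_line by blast
  then show ?thesis using that inc_trans l assms by blast
qed

end

section \<open>Point and plane degrees\<close>

text \<open>The incidence relation is a parameter: with the converse relation the same constant
  gives plane degrees.\<close>

definition deg :: "('b \<Rightarrow> 'b \<Rightarrow> bool) \<Rightarrow> 'b set \<Rightarrow> 'b \<Rightarrow> int" where
  "deg R L x = int (card {l\<in>L. R x l})"

text \<open>The division is exact for the classes considered here, see \<open>s_eq\<close> below.\<close>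

definition wt :: "('b \<Rightarrow> 'b \<Rightarrow> bool) \<Rightarrow> 'b set \<Rightarrow> 'b \<Rightarrow> int" where
  "wt R L x = (deg R L x - 1) div 5"

lemma double_count:
  assumes "finite A" "finite B"
  shows "(\<Sum>x\<in>A. int (card {y\<in>B. R x y})) = (\<Sum>y\<in>B. int (card {x\<in>A. R x y}))"
  using sum_swap_incidence[OF assms, of "\<lambda>_. 1" R] by simp

text \<open>The degree sum along \<open>l\<close> counts every other line of \<open>L\<close> that
  meets \<open>l\<close> once, and \<open>l\<close> itself five times if it is in \<open>L\<close>.
  For \<open>x = 7\<close> and \<open>q = 4\<close> the Cameron--Liebler condition thus becomes 35
  plus 15 + 5 = 20 on lines of the class.\<close>

locale cl34 = pg34 +
  fixes L
  assumes L_subset: "L \<subseteq> Ln"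
    and line_sum_deg: "l \<in> Ln \<Longrightarrow>
      (\<Sum>p | p \<in> Pt \<and> p \<lhd> l. deg (\<lhd>) L p) = 35 + 20 * of_bool (l \<in> L)"
begin

abbreviation "s \<equiv> deg (\<lhd>) L"
abbreviation "t \<equiv> deg (\<lambda>x y. y \<lhd> x) L"
abbreviation "a \<equiv> wt (\<lhd>) L"
abbreviation "b \<equiv> wt (\<lambda>x y. y \<lhd> x) L"
abbreviation "c p m \<equiv> int (card {l\<in>L. p \<lhd> l \<and> l \<lhd> m})"

section \<open>First moments and the dual class\<close>

lemma finite_L: "finite L"
  using L_subset finite_Ln finite_subset by blast

lemma sum_line_value:
  assumes "A \<subseteq> Ln"
  shows "(\<Sum>l\<in>A. \<Sum>p | p \<in> Pt \<and> p \<lhd> l. s p) = 35 * int (card A) + 20 * int (card {l\<in>A. l \<in> L})"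
proof -
  have fin: "finite A" using assms finite_Ln finite_subset by blast
  have "(\<Sum>l\<in>A. \<Sum>p | p \<in> Pt \<and> p \<lhd> l. s p) = (\<Sum>l\<in>A. 35 + 20 * of_bool (l \<in> L))"
    using assms by (intro sum.cong line_sum_deg) auto
  also have "\<dots> = 35 * int (card A) + 20 * (\<Sum>l\<in>A. of_bool (l \<in> L))"
    by (simp add: sum.distrib flip: sum_distrib_left)
  finally show ?thesis
    using sum_of_bool_card[OF fin] by simp
qed

text \<open>The star count at any point \<open>p\<close> has the term \<open>20 * s p\<close> on
  both sides; what remains is 21 times 35.\<close>

lemma sum_s: "sum s Pt = 735"
proof -
  obtain p where p: "p \<in> Pt" using card_Pt by (metis card.empty equals0I zero_neq_numeral)
  have "{l \<in> {l \<in> Ln. p \<lhd> l}. l \<in> L} = {l \<in> L. p \<lhd> l}" using L_subset by auto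
  then show ?thesis
    using sum_star[OF p, of s] sum_line_value[of "{l\<in>Ln. p \<lhd> l}"] card_lines_point[OF p]
    by (simp add: deg_def)
qed

lemma card_L: "int (card L) = 147"
proof -
  have "sum s Pt = (\<Sum>l\<in>L. int (card {p\<in>Pt. p \<lhd> l}))"
    unfolding deg_def by (rule double_count[OF finite_Pt finite_L])
  also have "\<dots> = (\<Sum>l\<in>L. 5)"
    using card_points_line L_subset by (intro sum.cong) auto
  finally show ?thesis using sum_s by simp
qed

lemma sum_s_plane:
  assumes "m \<in> Pl"
  shows "(\<Sum>q | q \<in> Pt \<and> q \<lhd> m. s q) = 147 + 4 * t m"
proof -
  let ?B = "{q\<in>Pt. q \<lhd> m}"
  have c: "int (card {q \<in> ?B. q \<lhd> l}) = (if l \<lhd> m then 4 + 1 else 1) * 1" if "l \<in> L" for l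
  proof (cases "l \<lhd> m")
    case True
    then have "{q \<in> ?B. q \<lhd> l} = {q\<in>Pt. q \<lhd> l}" using inc_trans that L_subset assms by auto
    then show ?thesis using True card_points_line that L_subset by auto
  next
    case False
    then have "card {q. q \<in> Pt \<and> q \<lhd> m \<and> q \<lhd> l} = 1"
      using that L_subset assms by (intro card_eq_1_ex1 trace_ex1) auto
    then show ?thesis using False by simp
  qed
  have "(\<Sum>q\<in>?B. s q) = (\<Sum>l\<in>L. int (card {q \<in> ?B. q \<lhd> l}))"
    unfolding deg_def by (rule double_count) (use finite_Pt finite_L in auto)
  also have "\<dots> = (\<Sum>l\<in>L. (if l \<lhd> m then 4 + 1 else 1) * 1)"
    by (rule sum.cong[OF refl]) (rule c)
  also have "\<dots> = sum (\<lambda>_. 1) L + 4 * sum (\<lambda>_. 1) {l\<in>L. l \<lhd> m}"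
    by (rule sum_weight_split) (rule finite_L)
  finally show ?thesis using card_L by (simp add: deg_def)
qed

text \<open>The line sums over the pencil of \<open>p\<close> and \<open>m\<close> are 175 + 20
  \<open>c p m\<close> by the class condition and 147 + 4 \<open>t m\<close> + 4 \<open>s p\<close>
  by counting points.\<close>

lemma flag:
  assumes "p \<in> Pt" "m \<in> Pl" "p \<lhd> m"
  shows "s p + t m = 7 + 5 * c p m"
proof -
  have "{l \<in> {l \<in> Ln. p \<lhd> l \<and> l \<lhd> m}. l \<in> L} = {l \<in> L. p \<lhd> l \<and> l \<lhd> m}" using L_subset by auto
  then have "(\<Sum>l | l \<in> Ln \<and> p \<lhd> l \<and> l \<lhd> m. \<Sum>q | q \<in> Pt \<and> q \<lhd> l. s q) = 175 + 20 * c p m"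
    using sum_line_value[of "{l\<in>Ln. p \<lhd> l \<and> l \<lhd> m}"] card_pencil[OF assms] by simp
  then show ?thesis
    using sum_pencil[OF assms, of s] sum_s_plane[OF assms(2)] by simp
qed

text \<open>Five planes contribute 5 times 147 = 735 plus four times their degrees, and
  \<open>sum_axis\<close> gives 735 plus four times the line sum of \<open>s\<close>. So plane
  degrees satisfy the same condition as point degrees, and the class is self-dual in this
  sense.\<close>

lemma axis_sum_deg:
  assumes "l \<in> Ln"
  shows "(\<Sum>m | m \<in> Pl \<and> l \<lhd> m. t m) = 35 + 20 * of_bool (l \<in> L)"
proof -
  have "(\<Sum>m | m \<in> Pl \<and> l \<lhd> m. \<Sum>q | q \<in> Pt \<and> q \<lhd> m. s q) = (\<Sum>m | m \<in> Pl \<and> l \<lhd> m. 147 + 4 * t m)"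
    by (rule sum.cong) (auto simp: sum_s_plane)
  also have "\<dots> = 735 + 4 * (\<Sum>m | m \<in> Pl \<and> l \<lhd> m. t m)"
    using card_planes_line[OF assms] by (simp add: sum.distrib flip: sum_distrib_left)
  finally show ?thesis
    using sum_axis[OF assms, of s] sum_s line_sum_deg[OF assms] by simp
qed

lemma dual: "cl34 Pl Ln Pt (\<lambda>x y. y \<lhd> x) L"
  by (rule cl34.intro[OF dual_pg34], unfold_locales) (use L_subset axis_sum_deg in auto)

text \<open>Along a line of \<open>L\<close> in \<open>m\<close> the values of \<open>c\<close> sum
  to \<open>t m + 4\<close>, by \<open>flag\<close> and the line sum 55. Since \<open>c q m\<close>
  is itself the number of such lines on \<open>q\<close>, summing this over the \<open>t m\<close>
  lines produces the second moment.\<close>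

lemma sum_c_plane:
  assumes "m \<in> Pl"
  shows "(\<Sum>q | q \<in> Pt \<and> q \<lhd> m. c q m) = 5 * t m"
    and "(\<Sum>q | q \<in> Pt \<and> q \<lhd> m. (c q m)\<^sup>2) = (t m)\<^sup>2 + 4 * t m"
proof -
  let ?B = "{q\<in>Pt. q \<lhd> m}" and ?L = "{l\<in>L. l \<lhd> m}"
  have "(\<Sum>q\<in>?B. s q) + (\<Sum>q\<in>?B. t m) = (\<Sum>q\<in>?B. s q + t m)" by (simp add: sum.distrib)
  also have "\<dots> = (\<Sum>q\<in>?B. 7 + 5 * c q m)"
    by (rule sum.cong) (auto simp: flag assms)
  also have "\<dots> = 147 + 5 * (\<Sum>q\<in>?B. c q m)"
    using card_points_plane[OF assms] by (simp add: sum.distrib flip: sum_distrib_left)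
  finally show "(\<Sum>q\<in>?B. c q m) = 5 * t m"
    using sum_s_plane[OF assms] card_points_plane[OF assms] by simp
  have line: "(\<Sum>q | q \<in> ?B \<and> q \<lhd> l. c q m) = t m + 4" if "l \<in> ?L" for l
  proof -
    have eq: "{q. q \<in> ?B \<and> q \<lhd> l} = {q\<in>Pt. q \<lhd> l}"
      using inc_trans that L_subset assms by auto
    have l: "l \<in> Ln" "l \<in> L" "l \<lhd> m" using that L_subset by auto
    have "(\<Sum>q | q \<in> Pt \<and> q \<lhd> l. s q + t m) = (\<Sum>q | q \<in> Pt \<and> q \<lhd> l. 7 + 5 * c q m)"
      by (rule sum.cong) (use flag assms inc_trans l in auto)
    then have "(\<Sum>q | q \<in> Pt \<and> q \<lhd> l. s q) + 5 * t m = 35 + 5 * (\<Sum>q | q \<in> Pt \<and> q \<lhd> l. c q m)"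
      using card_points_line[OF l(1)] by (simp add: sum.distrib flip: sum_distrib_left)
    then show ?thesis using line_sum_deg[OF l(1)] l eq by simp
  qed
  have "(\<Sum>q\<in>?B. int (card {l\<in>?L. q \<lhd> l}) * c q m) = (\<Sum>l\<in>?L. \<Sum>q | q \<in> ?B \<and> q \<lhd> l. c q m)"
    by (rule sum_swap_incidence[symmetric]) (use finite_Pt finite_L in auto)
  also have "\<dots> = (\<Sum>l\<in>?L. t m + 4)"
    by (rule sum.cong[OF refl]) (rule line)
  also have "\<dots> = (t m)\<^sup>2 + 4 * t m"
    by (simp add: deg_def power2_eq_square algebra_simps)
  also have "(\<Sum>q\<in>?B. int (card {l\<in>?L. q \<lhd> l}) * c q m) = (\<Sum>q\<in>?B. (c q m)\<^sup>2)"
  proof (rule sum.cong[OF refl])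
    fix q
    have "{l\<in>?L. q \<lhd> l} = {l\<in>L. q \<lhd> l \<and> l \<lhd> m}" by auto
    then show "int (card {l\<in>?L. q \<lhd> l}) * c q m = (c q m)\<^sup>2"
      by (simp add: power2_eq_square)
  qed
  finally show "(\<Sum>q\<in>?B. (c q m)\<^sup>2) = (t m)\<^sup>2 + 4 * t m" .
qed

lemma sum_s_sq_plane:
  assumes "m \<in> Pl"
  shows "(\<Sum>q | q \<in> Pt \<and> q \<lhd> m. (s q)\<^sup>2) = 1029 + 156 * t m - 4 * (t m)\<^sup>2"
proof -
  let ?B = "{q\<in>Pt. q \<lhd> m}" and ?k = "7 - t m"
  have "(\<Sum>q\<in>?B. (s q)\<^sup>2) = (\<Sum>q\<in>?B. ?k\<^sup>2 + 10 * ?k * c q m + 25 * (c q m)\<^sup>2)"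
  proof (rule sum.cong[OF refl])
    fix q assume "q \<in> ?B"
    then have eq: "s q = ?k + 5 * c q m" using flag[of q m] assms by auto
    show "(s q)\<^sup>2 = ?k\<^sup>2 + 10 * ?k * c q m + 25 * (c q m)\<^sup>2"
      unfolding eq by (simp add: power2_eq_square algebra_simps)
  qed
  also have "\<dots> = 21 * ?k\<^sup>2 + 10 * ?k * (\<Sum>q\<in>?B. c q m) + 25 * (\<Sum>q\<in>?B. (c q m)\<^sup>2)"
    using card_points_plane[OF assms] by (simp add: sum.distrib flip: sum_distrib_left)
  also have "\<dots> = 1029 + 156 * t m - 4 * (t m)\<^sup>2"
    unfolding sum_c_plane[OF assms] by (simp add: power2_eq_square algebra_simps)
  finally show ?thesis .
qed

text \<open>The plane sums of squares involve the squares of \<open>t\<close>, so this is one linear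
  equation in two unknown second moments. Its dual is the other equation, and together they
  determine both moments.\<close>

lemma sum_s_sq_t_sq: "21 * (\<Sum>p\<in>Pt. (s p)\<^sup>2) + 4 * (\<Sum>m\<in>Pl. (t m)\<^sup>2) = 202125"
proof -
  have "21 * (\<Sum>p\<in>Pt. (s p)\<^sup>2) = (\<Sum>m\<in>Pl. \<Sum>q | q \<in> Pt \<and> q \<lhd> m. (s q)\<^sup>2)"
    by (rule sum_planes[symmetric])
  also have "\<dots> = (\<Sum>m\<in>Pl. 1029 + 156 * t m - 4 * (t m)\<^sup>2)"
    by (rule sum.cong[OF refl]) (rule sum_s_sq_plane)
  also have "\<dots> = 1029 * 85 + 156 * sum t Pl - 4 * (\<Sum>m\<in>Pl. (t m)\<^sup>2)"
    using card_Pl by (simp add: sum.distrib sum_subtractf sum_distrib_left)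
  finally show ?thesis using cl34.sum_s[OF dual] by simp
qed

lemma sum_s_sq: "(\<Sum>p\<in>Pt. (s p)\<^sup>2) = 8085"
  using sum_s_sq_t_sq cl34.sum_s_sq_t_sq[OF dual] by simp

text \<open>In a common plane \<open>m\<close>, \<open>flag\<close> makes both degrees congruent to
  \<open>7 - t m\<close> modulo 5.\<close>

lemma s_cong:
  assumes "p \<in> Pt" "q \<in> Pt"
  shows "s p mod 5 = s q mod 5"
proof -
  obtain m where m: "m \<in> Pl" "p \<lhd> m" "q \<lhd> m" using exists_common_plane assms by blast
  have "s p = s q + 5 * (c p m - c q m)"
    using flag[of p m] flag[of q m] assms m by (simp add: algebra_simps)
  then show ?thesis
    by (simp only: mod_mult_self2)
qed

text \<open>This is the case \<open>x = 7\<close>, \<open>q = 4\<close> of the modular equality of Gavrilyuk and Metsch: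
  the second moment of \<open>s\<close> leaves only one residue modulo 5.\<close>

lemma s_mod_5:
  assumes "p \<in> Pt"
  shows "s p mod 5 = 1"
proof -
  define r where "r = s p mod 5"
  have r: "r \<in> {0,1,2,3,4}" unfolding r_def by auto
  define d where "d q = s q div 5" for q
  have sd: "s q = r + 5 * d q" if "q \<in> Pt" for q
    using s_cong[OF assms that] unfolding r_def d_def by simp
  have "sum s Pt = (\<Sum>q\<in>Pt. r + 5 * d q)"
    using sd by (intro sum.cong) auto
  then have 1: "735 = 85 * r + 5 * sum d Pt"
    using card_Pt sum_s by (simp add: sum.distrib flip: sum_distrib_left)
  have "(\<Sum>q\<in>Pt. (s q)\<^sup>2) = (\<Sum>q\<in>Pt. r\<^sup>2 + 10 * r * d q + 25 * (d q)\<^sup>2)"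
    using sd by (intro sum.cong) (auto simp: power2_eq_square algebra_simps)
  then have 2: "8085 = 85 * r\<^sup>2 + 10 * r * sum d Pt + 25 * (\<Sum>q\<in>Pt. (d q)\<^sup>2)"
    using card_Pt sum_s_sq by (simp add: sum.distrib flip: sum_distrib_left)
  have D: "sum d Pt = 147 - 17 * r" using 1 by simp
  \<comment> \<open>Dividing the second moment equation by 5 and reducing modulo 5 leaves 3 r^2 + 4
    r congruent to 2, whose only solution among the five residues is 1.\<close>
  show ?thesis unfolding r_def[symmetric] using r 2 unfolding D by auto presburger+
qed

section \<open>The reduced weights \<open>a\<close> and \<open>b\<close> and their moments\<close>

lemma s_eq:
  assumes "p \<in> Pt"
  shows "s p = 1 + 5 * a p"
  using s_mod_5[OF assms] unfolding wt_def by presburger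

lemma t_eq: "m \<in> Pl \<Longrightarrow> t m = 1 + 5 * b m"
  using cl34.s_eq[OF dual] .

lemma a_range:
  assumes "p \<in> Pt"
  shows "0 \<le> a p" "a p \<le> 4"
proof -
  have "{l\<in>L. p \<lhd> l} \<subseteq> {l\<in>Ln. p \<lhd> l}" using L_subset by auto
  then have "card {l\<in>L. p \<lhd> l} \<le> 21"
    using card_mono[of "{l\<in>Ln. p \<lhd> l}" "{l\<in>L. p \<lhd> l}"] card_lines_point[OF assms] finite_Ln
    by simp
  then have "0 \<le> s p" "s p \<le> 21" unfolding deg_def by auto
  then show "0 \<le> a p" "a p \<le> 4" using s_eq[OF assms] by auto
qed

lemma c_eq:
  assumes "p \<in> Pt" "m \<in> Pl" "p \<lhd> m"
  shows "c p m = a p + b m - 1"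
  using flag[OF assms] s_eq t_eq assms by simp

lemma line_sum_a:
  assumes "l \<in> Ln"
  shows "(\<Sum>p | p \<in> Pt \<and> p \<lhd> l. a p) = 6 + 4 * of_bool (l \<in> L)"
proof -
  have "(\<Sum>p | p \<in> Pt \<and> p \<lhd> l. s p) = (\<Sum>p | p \<in> Pt \<and> p \<lhd> l. 1 + 5 * a p)"
    by (rule sum.cong) (auto simp: s_eq)
  then show ?thesis
    using line_sum_deg[OF assms] card_points_line[OF assms]
    by (simp add: sum.distrib flip: sum_distrib_left)
qed

lemma sum_a: "sum a Pt = 130"
proof -
  have "sum s Pt = (\<Sum>p\<in>Pt. 1 + 5 * a p)" by (rule sum.cong) (auto simp: s_eq)
  then show ?thesis using sum_s card_Pt by (simp add: sum.distrib flip: sum_distrib_left)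
qed

lemma sum_a_sq: "(\<Sum>p\<in>Pt. (a p)\<^sup>2) = 268"
proof -
  have "(\<Sum>p\<in>Pt. (s p)\<^sup>2) = (\<Sum>p\<in>Pt. 1 + 10 * a p + 25 * (a p)\<^sup>2)"
    by (rule sum.cong) (auto simp: s_eq power2_eq_square algebra_simps)
  then show ?thesis using sum_s_sq sum_a card_Pt by (simp add: sum.distrib flip: sum_distrib_left)
qed

lemma sum_a_plane:
  assumes "m \<in> Pl"
  shows "(\<Sum>q | q \<in> Pt \<and> q \<lhd> m. a q) = 26 + 4 * b m"
    and "(\<Sum>q | q \<in> Pt \<and> q \<lhd> m. (a q)\<^sup>2) = 36 + 28 * b m - 4 * (b m)\<^sup>2"
proof -
  let ?B = "{q\<in>Pt. q \<lhd> m}"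
  have "(\<Sum>q\<in>?B. s q) = (\<Sum>q\<in>?B. 1 + 5 * a q)" by (rule sum.cong) (auto simp: s_eq)
  then show 1: "(\<Sum>q\<in>?B. a q) = 26 + 4 * b m"
    using sum_s_plane[OF assms] card_points_plane[OF assms] t_eq[OF assms]
    by (simp add: sum.distrib flip: sum_distrib_left)
  have "(\<Sum>q\<in>?B. (s q)\<^sup>2) = (\<Sum>q\<in>?B. 1 + 10 * a q + 25 * (a q)\<^sup>2)"
    by (rule sum.cong) (auto simp: s_eq power2_eq_square algebra_simps)
  then show "(\<Sum>q\<in>?B. (a q)\<^sup>2) = 36 + 28 * b m - 4 * (b m)\<^sup>2"
    using sum_s_sq_plane[OF assms] card_points_plane[OF assms]
    unfolding t_eq[OF assms]
    by (simp add: sum.distrib 1 flip: sum_distrib_left) (simp add: power2_eq_square algebra_simps)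
qed

end

section \<open>The weight of a hyperoval cone\<close>

lemma card_eq_by_relation:
  assumes "finite A" "finite B"
    and "\<And>x. x \<in> A \<Longrightarrow> \<exists>!y. y \<in> B \<and> R x y" and "\<And>y. y \<in> B \<Longrightarrow> \<exists>!x. x \<in> A \<and> R x y"
  shows "card A = card B"
proof -
  have "(\<Sum>x\<in>A. int (card {y\<in>B. R x y})) = (\<Sum>x\<in>A. 1)"
    by (rule sum.cong[OF refl]) (simp add: card_eq_1_ex1 assms(3))
  moreover have "(\<Sum>y\<in>B. int (card {x\<in>A. R x y})) = (\<Sum>y\<in>B. 1)"
    by (rule sum.cong[OF refl]) (simp add: card_eq_1_ex1 assms(4))
  ultimately show ?thesis
    using double_count[OF assms(1,2), of R] by simp
qed

locale oval34 = pg34 +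
  fixes P \<pi> :: 'a and H :: "'a set"
  assumes P: "P \<in> Pt" and \<pi>: "\<pi> \<in> Pl" and P_notin: "\<not> P \<lhd> \<pi>"
    and H_sub: "\<And>R. R \<in> H \<Longrightarrow> R \<in> Pt \<and> R \<lhd> \<pi>" and card_H: "card H = 6"
    and H_arc: "\<And>l. l \<in> Ln \<Longrightarrow> card {R\<in>H. R \<lhd> l} \<le> 2"
begin

definition C where "C = {l\<in>Ln. P \<lhd> l \<and> (\<exists>R\<in>H. R \<lhd> l)}"

text \<open>The incidence form of \<open>hyperoval_line_class\<close>, stated without joins of
  subspaces.\<close>

definition cls where
  "cls = C
    \<union> {l\<in>Ln. \<not> P \<lhd> l \<and> (\<forall>R\<in>H. \<not> R \<lhd> l) \<and> card {k\<in>C. \<exists>x\<in>Pt. x \<lhd> k \<and> x \<lhd> l} = 2}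
    \<union> {l\<in>Ln. l \<lhd> \<pi> \<and> (\<forall>R\<in>H. \<not> R \<lhd> l)}"

text \<open>The values are 0 on \<open>H\<close>, 2 on the rest of \<open>\<pi>\<close>, 3 on the
  rest of the cone except its vertex, and 1 at \<open>P\<close> and at all other points. By
  \<open>deg_cls\<close> this is the reduced weight of \<open>cls\<close>.\<close>

definition w :: "'a \<Rightarrow> int" where
  "w x = 1 + of_bool (x \<lhd> \<pi>) + 2 * of_bool (x \<noteq> P \<and> (\<exists>k\<in>C. x \<lhd> k)) - 4 * of_bool (x \<in> H)"

lemma finite_H: "finite H" using card_H by (metis card.infinite zero_neq_numeral)

lemma P_notin_H: "P \<notin> H" using H_sub P_notin by blast

lemma C_subset: "C \<subseteq> Ln" unfolding C_def by blast

lemma finite_C: "finite C" using C_subset finite_Ln finite_subset by blast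

lemma not_in_plane: "l \<in> Ln \<Longrightarrow> P \<lhd> l \<Longrightarrow> \<not> l \<lhd> \<pi>"
  using inc_trans P \<pi> P_notin by blast

lemma H_unique: "\<lbrakk>l \<in> Ln; \<not> l \<lhd> \<pi>; R \<in> H; S \<in> H; R \<lhd> l; S \<lhd> l\<rbrakk> \<Longrightarrow> R = S"
  using line_in_plane H_sub \<pi> by blast

lemma C_ex1: "R \<in> H \<Longrightarrow> \<exists>!l. l \<in> C \<and> R \<lhd> l"
  using join_ex1[of P R] H_sub P P_notin unfolding C_def by blast

lemma H_ex1: "l \<in> C \<Longrightarrow> \<exists>!R. R \<in> H \<and> R \<lhd> l"
  using H_unique[of l] not_in_plane unfolding C_def by blast

lemma card_C: "card C = 6"
proof -
  have "card C = card H"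
    by (rule card_eq_by_relation[where R = "\<lambda>l R. R \<lhd> l"]) (use finite_C finite_H H_ex1 C_ex1 in auto)
  then show ?thesis using card_H by simp
qed

text \<open>No line is tangent to a hyperoval: the five lines of \<open>\<pi>\<close> on a point
  \<open>R\<close> of \<open>H\<close> carry the other five points of \<open>H\<close>, each at most
  one. The four lines other than \<open>n\<close> account for at most four of them, so
  \<open>n\<close> carries one.\<close>

lemma secant:
  assumes "n \<in> Ln" "n \<lhd> \<pi>" "card {R\<in>H. R \<lhd> n} \<noteq> 0"
  shows "card {R\<in>H. R \<lhd> n} = 2"
proof -
  have "{R\<in>H. R \<lhd> n} \<noteq> {}" using assms(3) by force
  then obtain R where R: "R \<in> H" "R \<lhd> n" by blast
  have R': "R \<in> Pt" "R \<lhd> \<pi>" using H_sub R by auto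
  let ?A = "{l\<in>Ln. R \<lhd> l \<and> l \<lhd> \<pi>}" and ?B = "H - {R}"
  have finA: "finite ?A" using finite_Ln by simp
  have "card {l\<in>?A. S \<lhd> l} = 1" if "S \<in> ?B" for S
  proof -
    have S: "S \<in> Pt" "S \<lhd> \<pi>" "S \<noteq> R" using H_sub that by auto
    have "{l\<in>?A. S \<lhd> l} = {l\<in>Ln. R \<lhd> l \<and> S \<lhd> l}"
      using line_in_plane[of R S _ \<pi>] R' S \<pi> by blast
    then show ?thesis using card_join[of R S] R' S by simp
  qed
  then have "(\<Sum>S\<in>?B. int (card {l\<in>?A. S \<lhd> l})) = (\<Sum>S\<in>?B. 1)"
    by (intro sum.cong) auto
  also have "\<dots> = 5" using card_H R finite_H by simp
  also have "(\<Sum>S\<in>?B. int (card {l\<in>?A. S \<lhd> l})) = (\<Sum>l\<in>?A. int (card {S\<in>?B. S \<lhd> l}))"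
    by (rule double_count[symmetric]) (use finA finite_H in auto)
  also have "\<dots> = int (card {S\<in>?B. S \<lhd> n}) + (\<Sum>l\<in>?A - {n}. int (card {S\<in>?B. S \<lhd> l}))"
    by (rule sum.remove) (use finA assms R in auto)
  finally have total: "int (card {S\<in>?B. S \<lhd> n}) + (\<Sum>l\<in>?A - {n}. int (card {S\<in>?B. S \<lhd> l})) = 5" .
  have "(\<Sum>l\<in>?A - {n}. int (card {S\<in>?B. S \<lhd> l})) \<le> of_nat (card (?A - {n})) * 1"
  proof (rule sum_bounded_above)
    fix l assume "l \<in> ?A - {n}"
    then have l: "l \<in> Ln" "R \<lhd> l" by auto
    have "{S\<in>H. S \<lhd> l} = insert R {S\<in>?B. S \<lhd> l}" using R l by auto
    then have "card {S\<in>H. S \<lhd> l} = Suc (card {S\<in>?B. S \<lhd> l})" using finite_H by simp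
    then show "int (card {S\<in>?B. S \<lhd> l}) \<le> 1" using H_arc[OF l(1)] by simp
  qed
  moreover have "card (?A - {n}) = 4"
    using card_pencil[OF R'(1) \<pi> R'(2)] assms R by simp
  ultimately have "card {S\<in>?B. S \<lhd> n} \<ge> 1" using total by simp
  moreover have "{S\<in>H. S \<lhd> n} = insert R {S\<in>?B. S \<lhd> n}" using R by auto
  then have "card {S\<in>H. S \<lhd> n} = Suc (card {S\<in>?B. S \<lhd> n})" using finite_H by simp
  ultimately show ?thesis using H_arc[OF assms(1)] by simp
qed

lemma sum_w_line:
  assumes "l \<in> Ln"
  shows "(\<Sum>x | x \<in> Pt \<and> x \<lhd> l. w x) = 5 + int (card {x\<in>Pt. x \<lhd> l \<and> x \<lhd> \<pi>})
    + 2 * int (card {x\<in>Pt. x \<lhd> l \<and> x \<noteq> P \<and> (\<exists>k\<in>C. x \<lhd> k)}) - 4 * int (card {R\<in>H. R \<lhd> l})"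
proof -
  let ?A = "{x\<in>Pt. x \<lhd> l}"
  have fin: "finite ?A" using finite_Pt by simp
  have "{x\<in>?A. x \<in> H} = {R\<in>H. R \<lhd> l}" using H_sub by auto
  moreover have "{x\<in>?A. x \<lhd> \<pi>} = {x\<in>Pt. x \<lhd> l \<and> x \<lhd> \<pi>}" by auto
  moreover have "{x\<in>?A. x \<noteq> P \<and> (\<exists>k\<in>C. x \<lhd> k)} = {x\<in>Pt. x \<lhd> l \<and> x \<noteq> P \<and> (\<exists>k\<in>C. x \<lhd> k)}" by auto
  moreover have "(\<Sum>x\<in>?A. w x) = 5 + (\<Sum>x\<in>?A. of_bool (x \<lhd> \<pi>))
      + 2 * (\<Sum>x\<in>?A. of_bool (x \<noteq> P \<and> (\<exists>k\<in>C. x \<lhd> k))) - 4 * (\<Sum>x\<in>?A. of_bool (x \<in> H))"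
    unfolding w_def sum_subtractf sum.distrib sum_distrib_left[symmetric]
    using card_points_line[OF assms] by simp
  ultimately show ?thesis
    unfolding sum_of_bool_card[OF fin] by simp
qed

text \<open>A line of the cone has sum 1 + 0 + 3 + 3 + 3; any other line on \<open>P\<close> meets
  \<open>\<pi>\<close> in a point of weight 2 and has sum 1 + 2 + 1 + 1 + 1.\<close>

lemma line_sum_through_P:
  assumes "l \<in> Ln" "P \<lhd> l"
  shows "(\<Sum>x | x \<in> Pt \<and> x \<lhd> l. w x) = 6 + 4 * of_bool (l \<in> C)"
proof -
  have "card {x. x \<in> Pt \<and> x \<lhd> \<pi> \<and> x \<lhd> l} = 1"
    by (rule card_eq_1_ex1, rule trace_ex1) (use assms \<pi> not_in_plane in auto)
  then have 1: "card {x\<in>Pt. x \<lhd> l \<and> x \<lhd> \<pi>} = 1" by (simp add: conj_commute)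
  have iff: "(\<exists>k\<in>C. x \<lhd> k) \<longleftrightarrow> l \<in> C" if "x \<in> Pt" "x \<lhd> l" "x \<noteq> P" for x
    using line_unique[of P x l] that assms P unfolding C_def by blast
  show ?thesis
  proof (cases "l \<in> C")
    case True
    have "{x\<in>Pt. x \<lhd> l \<and> x \<noteq> P \<and> (\<exists>k\<in>C. x \<lhd> k)} = {x\<in>Pt. x \<lhd> l} - {P}"
      using iff True by auto
    then have "card {x\<in>Pt. x \<lhd> l \<and> x \<noteq> P \<and> (\<exists>k\<in>C. x \<lhd> k)} = 4"
      using card_points_line[OF assms(1)] P assms by simp
    moreover have "card {R\<in>H. R \<lhd> l} = 1" using card_eq_1_ex1[OF H_ex1[OF True]] .
    ultimately show ?thesis using sum_w_line[OF assms(1)] 1 True by simp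
  next
    case False
    have "{x\<in>Pt. x \<lhd> l \<and> x \<noteq> P \<and> (\<exists>k\<in>C. x \<lhd> k)} = {}" using iff False by auto
    moreover have "{R\<in>H. R \<lhd> l} = {}" using False assms unfolding C_def by auto
    ultimately show ?thesis using sum_w_line[OF assms(1)] 1 False by (simp only: card.empty) simp
  qed
qed

text \<open>Here \<open>m\<close> is the plane spanned by \<open>P\<close> and \<open>l\<close>, and
  \<open>n\<close> is its trace on \<open>\<pi>\<close>. The lines of the cone that meet
  \<open>l\<close> are those in \<open>m\<close>, so projection from \<open>P\<close> matches them
  with the points of \<open>H\<close> on \<open>n\<close>, and intersection with \<open>l\<close>
  matches them with the points of \<open>l\<close> on the cone.\<close>

lemma transversal:
  assumes l: "l \<in> Ln" "\<not> P \<lhd> l" and m: "m \<in> Pl" "P \<lhd> m" "l \<lhd> m" and n: "n \<in> Ln" "n \<lhd> m" "n \<lhd> \<pi>"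
  defines "D \<equiv> {k\<in>C. \<exists>x\<in>Pt. x \<lhd> k \<and> x \<lhd> l}"
  shows "card D = card {R\<in>H. R \<lhd> n}"
    and "card {x\<in>Pt. x \<lhd> l \<and> x \<noteq> P \<and> (\<exists>k\<in>C. x \<lhd> k)} = card D"
    and "\<And>R. R \<in> H \<Longrightarrow> R \<lhd> l \<Longrightarrow> R \<lhd> n"
proof -
  have m\<pi>: "m \<noteq> \<pi>" using m P_notin by blast
  have finD: "finite D" unfolding D_def using finite_C by simp
  have in_n: "R \<lhd> n" if "R \<in> H" "R \<lhd> m" for R
    using point_on_line[of m \<pi> n R] m \<pi> n m\<pi> H_sub that by blast
  show "R \<lhd> n" if "R \<in> H" "R \<lhd> l" for R
    using in_n inc_trans[of R l m] that H_sub l m by blast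
  show "card D = card {R\<in>H. R \<lhd> n}"
  proof (rule card_eq_by_relation[where R = "\<lambda>k R. R \<lhd> k"])
    fix k assume k: "k \<in> D"
    then obtain x where x: "x \<in> Pt" "x \<lhd> k" "x \<lhd> l" unfolding D_def by blast
    have kC: "k \<in> C" "k \<in> Ln" "P \<lhd> k" using k unfolding D_def C_def by auto
    have "x \<lhd> m" "x \<noteq> P" using inc_trans[of x l m] x l m by auto
    then have "k \<lhd> m" using line_in_plane[of P x k m] P x kC m by blast
    then show "\<exists>!R. R \<in> {R\<in>H. R \<lhd> n} \<and> R \<lhd> k"
      using H_ex1[OF kC(1)] in_n inc_trans[of _ k m] H_sub kC m by blast
  next
    fix R assume R: "R \<in> {R\<in>H. R \<lhd> n}"
    then obtain k where k: "k \<in> C" "R \<lhd> k" using C_ex1 by blast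
    have R': "R \<in> Pt" "R \<lhd> m" "R \<noteq> P" using R H_sub n m P_notin inc_trans[of R n m] by auto
    have k': "k \<in> Ln" "P \<lhd> k" using k unfolding C_def by auto
    then have "k \<lhd> m" using line_in_plane[of P R k m] P R' k m by blast
    moreover have "k \<noteq> l" using k' l by blast
    ultimately obtain x where "x \<in> Pt" "x \<lhd> k" "x \<lhd> l"
      using lines_meet_in_plane[of k l m] k' l m by blast
    then have "k \<in> D" unfolding D_def using k by blast
    then show "\<exists>!k. k \<in> D \<and> R \<lhd> k"
      using C_ex1[of R] R k unfolding D_def by blast
  qed (use finD finite_H in auto)
  show "card {x\<in>Pt. x \<lhd> l \<and> x \<noteq> P \<and> (\<exists>k\<in>C. x \<lhd> k)} = card D"
  proof (rule card_eq_by_relation[where R = "\<lambda>x k. x \<lhd> k"])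
    fix x assume x: "x \<in> {x\<in>Pt. x \<lhd> l \<and> x \<noteq> P \<and> (\<exists>k\<in>C. x \<lhd> k)}"
    then obtain k where k: "k \<in> C" "x \<lhd> k" by blast
    then have "k \<in> D" unfolding D_def using x by blast
    moreover have "k' = k" if "k' \<in> D" "x \<lhd> k'" for k'
      using line_unique[of P x k' k] that k x P unfolding D_def C_def by blast
    ultimately show "\<exists>!k. k \<in> D \<and> x \<lhd> k" using k by blast
  next
    fix k assume k: "k \<in> D"
    then obtain x where x: "x \<in> Pt" "x \<lhd> k" "x \<lhd> l" unfolding D_def by blast
    have kC: "k \<in> C" "k \<in> Ln" "P \<lhd> k" using k unfolding D_def C_def by auto
    have "y = x" if "y \<in> Pt" "y \<lhd> l" "y \<lhd> k" for y
      using lines_common_point_le[of k l y x] x that kC l by blast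
    then show "\<exists>!x. x \<in> {x\<in>Pt. x \<lhd> l \<and> x \<noteq> P \<and> (\<exists>k\<in>C. x \<lhd> k)} \<and> x \<lhd> k"
      using x kC l by blast
  qed (use finD finite_Pt in auto)
qed

text \<open>Off \<open>P\<close>, let \<open>k\<close> be the number of cone lines meeting
  \<open>l\<close> and h the number of points of \<open>H\<close> on \<open>l\<close>;
  \<open>secant\<close> gives \<open>k\<close> = 0 or 2. If \<open>l\<close> is in
  \<open>\<pi>\<close>, then h = \<open>k\<close> and the sum is 10 - 2\<open>k\<close>. Otherwise
  it is 6 + 2\<open>k\<close> - 4h with h at most 1, and h = 1 forces \<open>k\<close> = 2.\<close>

lemma line_sum_w:
  assumes l: "l \<in> Ln"
  shows "(\<Sum>x | x \<in> Pt \<and> x \<lhd> l. w x) = 6 + 4 * of_bool (l \<in> cls)"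
proof (cases "P \<lhd> l")
  case True
  then have "l \<in> cls \<longleftrightarrow> l \<in> C" unfolding cls_def using not_in_plane[OF l] by blast
  then show ?thesis using line_sum_through_P[OF l True] by simp
next
  case False
  define k where "k = card {k\<in>C. \<exists>x\<in>Pt. x \<lhd> k \<and> x \<lhd> l}"
  obtain m where m: "m \<in> Pl" "P \<lhd> m" "l \<lhd> m" using obtain_span[OF P l False] by blast
  have m\<pi>: "m \<noteq> \<pi>" using m P_notin by blast
  obtain n where n: "n \<in> Ln" "n \<lhd> m" "n \<lhd> \<pi>" using obtain_meet[OF m(1) \<pi> m\<pi>] by blast
  note tr = transversal[OF l False m n, folded k_def]
  have k: "k = 0 \<or> k = 2" using secant[OF n(1,3)] tr(1) by auto
  have k0: "k = 0 \<longleftrightarrow> (\<forall>R\<in>H. \<not> R \<lhd> n)" using tr(1) finite_H by (auto simp: card_eq_0_iff)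
  have lC: "l \<notin> C" unfolding C_def using False by blast
  note sum = sum_w_line[OF l, unfolded tr(2)]
  show ?thesis
  proof (cases "l \<lhd> \<pi>")
    case True
    have "l = n" using meet_ex1[OF m(1) \<pi> m\<pi>] True l m n by blast
    moreover have "{x\<in>Pt. x \<lhd> l \<and> x \<lhd> \<pi>} = {x\<in>Pt. x \<lhd> l}" using inc_trans True l \<pi> by blast
    moreover have "l \<in> cls \<longleftrightarrow> k = 0"
      unfolding cls_def k_def using True lC l k0 \<open>l = n\<close> by (auto simp: k_def)
    ultimately show ?thesis using sum card_points_line[OF l] k tr(1) by auto
  next
    case nin: False
    have "card {x. x \<in> Pt \<and> x \<lhd> \<pi> \<and> x \<lhd> l} = 1"
      by (rule card_eq_1_ex1, rule trace_ex1) (use l nin \<pi> in auto)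
    then have 1: "card {x\<in>Pt. x \<lhd> l \<and> x \<lhd> \<pi>} = 1" by (simp add: conj_commute)
    have cls: "l \<in> cls \<longleftrightarrow> (\<forall>R\<in>H. \<not> R \<lhd> l) \<and> k = 2"
      unfolding cls_def k_def using lC l nin False by auto
    show ?thesis
    proof (cases "\<exists>R\<in>H. R \<lhd> l")
      case True
      then have "card {R\<in>H. R \<lhd> l} = 1"
        by (intro card_eq_1_ex1) (use H_unique[OF l nin] in blast)
      moreover have "k = 2" using True k k0 tr(3) by blast
      ultimately show ?thesis using sum 1 cls True by simp
    next
      case False
      then have "card {R\<in>H. R \<lhd> l} = 0" by (simp add: card_eq_0_iff)
      then show ?thesis using sum 1 cls False k by (elim disjE) simp_all
    qed
  qed
qed

lemma w_P: "w P = 1"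
  unfolding w_def using P_notin P_notin_H by simp

lemma cls_subset: "cls \<subseteq> Ln"
  unfolding cls_def C_def by blast

lemma sum_line_w:
  assumes "A \<subseteq> Ln"
  shows "(\<Sum>l\<in>A. \<Sum>x | x \<in> Pt \<and> x \<lhd> l. w x) = 6 * int (card A) + 4 * int (card {l\<in>A. l \<in> cls})"
proof -
  have fin: "finite A" using assms finite_Ln finite_subset by blast
  have "(\<Sum>l\<in>A. \<Sum>x | x \<in> Pt \<and> x \<lhd> l. w x) = (\<Sum>l\<in>A. 6 + 4 * of_bool (l \<in> cls))"
    using assms by (intro sum.cong line_sum_w) auto
  also have "\<dots> = 6 * int (card A) + 4 * (\<Sum>l\<in>A. of_bool (l \<in> cls))"
    by (simp add: sum.distrib flip: sum_distrib_left)
  finally show ?thesis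
    using sum_of_bool_card[OF fin] by simp
qed

text \<open>The star at \<open>P\<close> contains exactly the six lines of \<open>C\<close> from the
  class, so 21 * 6 + 6 * 4 is the total plus 20.\<close>

lemma sum_w: "sum w Pt = 130"
proof -
  have "{l \<in> {l\<in>Ln. P \<lhd> l}. l \<in> cls} = C"
    unfolding cls_def using not_in_plane unfolding C_def by blast
  then show ?thesis
    using sum_line_w[of "{l\<in>Ln. P \<lhd> l}"] sum_star[OF P, of w] card_lines_point[OF P] w_P card_C
    by simp
qed

text \<open>The star count at \<open>p\<close> reads 126 + 4 deg = 130 + 20
  \<open>w p\<close>.\<close>

lemma deg_cls:
  assumes "p \<in> Pt"
  shows "deg (\<lhd>) cls p = 1 + 5 * w p"
proof -
  have "{l \<in> {l\<in>Ln. p \<lhd> l}. l \<in> cls} = {l\<in>cls. p \<lhd> l}"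
    using cls_subset by blast
  then show ?thesis
    using sum_line_w[of "{l\<in>Ln. p \<lhd> l}"] sum_star[OF assms, of w] card_lines_point[OF assms] sum_w
    by (simp add: deg_def)
qed

lemma cl34_cls: "cl34 Pt Ln Pl (\<lhd>) cls"
proof unfold_locales
  fix l assume l: "l \<in> Ln"
  have "(\<Sum>p | p \<in> Pt \<and> p \<lhd> l. deg (\<lhd>) cls p) = (\<Sum>p | p \<in> Pt \<and> p \<lhd> l. 1 + 5 * w p)"
    by (rule sum.cong) (auto simp: deg_cls)
  also have "\<dots> = 35 + 20 * of_bool (l \<in> cls)"
    using line_sum_w[OF l] card_points_line[OF l] by (simp add: sum.distrib flip: sum_distrib_left)
  finally show "(\<Sum>p | p \<in> Pt \<and> p \<lhd> l. deg (\<lhd>) cls p) = 35 + 20 * of_bool (l \<in> cls)" .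
qed (rule cls_subset)

end

section \<open>Points and planes of extremal weight\<close>

lemma level_counts:
  fixes f :: "'b \<Rightarrow> int"
  assumes fin: "finite X" and range: "\<And>x. x \<in> X \<Longrightarrow> 0 \<le> f x \<and> f x \<le> 4"
  defines "k \<equiv> \<lambda>i. int (card {x\<in>X. f x = i})"
  shows "int (card X) = k 0 + k 1 + k 2 + k 3 + k 4"
    and "sum f X = k 1 + 2 * k 2 + 3 * k 3 + 4 * k 4"
    and "(\<Sum>x\<in>X. (f x)\<^sup>2) = k 1 + 4 * k 2 + 9 * k 3 + 16 * k 4"
proof -
  have img: "f ` X \<subseteq> {0, 1, 2, 3, 4}"
  proof
    fix y assume "y \<in> f ` X"
    then have "0 \<le> y \<and> y \<le> 4" using range by blast
    then show "y \<in> {0, 1, 2, 3, 4}" by auto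
  qed
  have *: "(\<Sum>x\<in>X. g (f x)) = k 0 * g 0 + k 1 * g 1 + k 2 * g 2 + k 3 * g 3 + k 4 * g 4"
    for g :: "int \<Rightarrow> int"
  proof -
    have "(\<Sum>x\<in>X. g (f x)) = (\<Sum>i\<in>{0, 1, 2, 3, 4}. \<Sum>x | x \<in> X \<and> f x = i. g (f x))"
      by (rule sum.group[symmetric]) (use fin img in auto)
    also have "\<dots> = (\<Sum>i\<in>{0, 1, 2, 3, 4}. k i * g i)"
      by (rule sum.cong[OF refl]) (simp add: k_def)
    finally show ?thesis by simp
  qed
  show "int (card X) = k 0 + k 1 + k 2 + k 3 + k 4" using *[of "\<lambda>_. 1"] by simp
  show "sum f X = k 1 + 2 * k 2 + 3 * k 3 + 4 * k 4" using *[of "\<lambda>x. x"] by simp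
  show "(\<Sum>x\<in>X. (f x)\<^sup>2) = k 1 + 4 * k 2 + 9 * k 3 + 16 * k 4"
    using *[of "\<lambda>x. x\<^sup>2"] by simp
qed

lemma sum_square_count:
  assumes "finite A" "finite Z"
  shows "(\<Sum>m\<in>A. (int (card {q\<in>Z. R q m}))\<^sup>2)
    = (\<Sum>p\<in>Z. \<Sum>q\<in>Z. int (card {m\<in>A. R p m \<and> R q m}))"
proof -
  have "(\<Sum>m\<in>A. (int (card {q\<in>Z. R q m}))\<^sup>2)
      = (\<Sum>m\<in>A. int (card {p\<in>Z. R p m}) * int (card {q\<in>Z. R q m}))"
    by (simp add: power2_eq_square)
  also have "\<dots> = (\<Sum>p\<in>Z. \<Sum>m | m \<in> A \<and> R p m. int (card {q\<in>Z. R q m}))"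
    by (rule sum_swap_incidence[symmetric]) (use assms in auto)
  also have "\<dots> = (\<Sum>p\<in>Z. \<Sum>q\<in>Z. int (card {m\<in>A. R p m \<and> R q m}))"
  proof (rule sum.cong[OF refl])
    fix p
    have "(\<Sum>m\<in>{m\<in>A. R p m}. int (card {q\<in>Z. R q m})) = (\<Sum>q\<in>Z. int (card {m\<in>{m\<in>A. R p m}. R q m}))"
      by (rule double_count) (use assms in auto)
    then show "(\<Sum>m | m \<in> A \<and> R p m. int (card {q\<in>Z. R q m})) = (\<Sum>q\<in>Z. int (card {m\<in>A. R p m \<and> R q m}))"
      by simp
  qed
  finally show ?thesis .
qed

lemma cauchy_schwarz_int:
  fixes f :: "'b \<Rightarrow> int"
  shows "(sum f A)\<^sup>2 \<le> (\<Sum>x\<in>A. (f x)\<^sup>2) * int (card A)"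
proof -
  have "(\<Sum>x\<in>A. real_of_int (f x))\<^sup>2 \<le> (\<Sum>x\<in>A. (real_of_int (f x))\<^sup>2) * card A"
    by (rule sum_squared_le_sum_of_squares)
  then have "real_of_int ((sum f A)\<^sup>2) \<le> real_of_int ((\<Sum>x\<in>A. (f x)\<^sup>2) * int (card A))"
    by simp
  then show ?thesis by (simp only: of_int_le_iff)
qed

text \<open>For positive \<open>n\<close> the first inequality is 25n \<le> 3(n + 4)(m - 1), a lower
  bound for \<open>m\<close>, and the second is m(n + 3) \<le> 64, an upper bound; the last two are
  their mirror images. At (6, 6) the bounds of the first kind hold with equality. The range is small
  enough for evaluation.\<close>

lemma zero_count_unique:
  fixes n m :: int
  assumes "1 \<le> n" "n \<le> 24" "1 \<le> m" "m \<le> 24"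
    and "(5 * n)\<^sup>2 \<le> (n\<^sup>2 + 4 * n) * (3 * m - 3)" "(16 * n)\<^sup>2 \<le> (4 * n\<^sup>2 + 12 * n) * (64 - 3 * m)"
    and "(5 * m)\<^sup>2 \<le> (m\<^sup>2 + 4 * m) * (3 * n - 3)" "(16 * m)\<^sup>2 \<le> (4 * m\<^sup>2 + 12 * m) * (64 - 3 * n)"
  shows "n = 6" "m = 6"
proof -
  have "\<forall>n\<in>set [1..24]. \<forall>m\<in>set [1..24::int].
      (5 * n)\<^sup>2 \<le> (n\<^sup>2 + 4 * n) * (3 * m - 3) \<and> (16 * n)\<^sup>2 \<le> (4 * n\<^sup>2 + 12 * n) * (64 - 3 * m) \<and>
      (5 * m)\<^sup>2 \<le> (m\<^sup>2 + 4 * m) * (3 * n - 3) \<and> (16 * m)\<^sup>2 \<le> (4 * m\<^sup>2 + 12 * m) * (64 - 3 * n)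
      \<longrightarrow> n = 6 \<and> m = 6"
    by code_simp
  then have "n \<in> set [1..24] \<longrightarrow> m \<in> set [1..24] \<longrightarrow> n = 6 \<and> m = 6" using assms(5-8) by blast
  then show "n = 6" "m = 6" using assms(1-4) by auto
qed

context cl34
begin

abbreviation "N i \<equiv> int (card {p\<in>Pt. a p = i})"
abbreviation "M i \<equiv> int (card {m\<in>Pl. b m = i})"

lemma b_range:
  assumes "m \<in> Pl"
  shows "0 \<le> b m" "b m \<le> 4"
  using cl34.a_range[OF dual assms] by auto

text \<open>These come from summing (a - 1)(a - 2), (a - 1)(a - 3) and (a - 2)(a - 3) over all
  points, each of which annihilates two levels. Two of the five counts stay free.\<close>

lemma N_eqs:
  shows "N 0 + N 3 + 3 * N 4 = 24" "N 2 = 3 * (N 0 + N 4) - 3" "N 1 = 64 - 3 * N 0 - N 4"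
proof -
  have r: "0 \<le> a q \<and> a q \<le> 4" if "q \<in> Pt" for q using a_range that by auto
  note lc = level_counts[where f = a, OF finite_Pt r, unfolded sum_a sum_a_sq card_Pt]
  show "N 0 + N 3 + 3 * N 4 = 24" "N 2 = 3 * (N 0 + N 4) - 3" "N 1 = 64 - 3 * N 0 - N 4"
    using lc by simp_all
qed

lemma M_eqs:
  shows "M 0 + M 3 + 3 * M 4 = 24" "M 2 = 3 * (M 0 + M 4) - 3" "M 1 = 64 - 3 * M 0 - M 4"
  by (rule cl34.N_eqs[OF dual])+

text \<open>This is the sum of (a - 1)(a - 3) over the plane: the polynomial is -1 at 2, vanishes at
  1 and 3, and is 3 at 0 and 4. Its dual later determines the weight of the apex.\<close>

lemma plane_two_count:
  assumes m: "m \<in> Pl"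
  shows "int (card {q\<in>Pt. q \<lhd> m \<and> a q = 2}) = 4 * (b m)\<^sup>2 - 12 * b m + 5
    + 3 * (int (card {q\<in>Pt. q \<lhd> m \<and> a q = 0}) + int (card {q\<in>Pt. q \<lhd> m \<and> a q = 4}))"
proof -
  have fin: "finite {q\<in>Pt. q \<lhd> m}" using finite_Pt by simp
  have r: "0 \<le> a q \<and> a q \<le> 4" if "q \<in> {q\<in>Pt. q \<lhd> m}" for q
    using a_range that by auto
  have *: "{x \<in> {q\<in>Pt. q \<lhd> m}. a x = i} = {q\<in>Pt. q \<lhd> m \<and> a q = i}" for i by auto
  note lc = level_counts[where f = a, OF fin r, unfolded * sum_a_plane[OF m] card_points_plane[OF m]]
  show ?thesis using lc by simp
qed

text \<open>At weight 0 the degree is 1, and \<open>c_eq\<close> becomes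
  \<open>c p m = b m - 1\<close>, where the left side only records whether the single line of
  \<open>L\<close> on \<open>p\<close> lies in \<open>m\<close>.\<close>

lemma zero_axis:
  assumes p: "p \<in> Pt" "a p = 0"
  shows "\<exists>!l. l \<in> L \<and> p \<lhd> l"
    and "\<lbrakk>l \<in> L; p \<lhd> l; m \<in> Pl; p \<lhd> m\<rbrakk> \<Longrightarrow> b m = 1 + of_bool (l \<lhd> m)"
proof -
  have "card {l\<in>L. p \<lhd> l} = 1" using s_eq[OF p(1)] p(2) by (simp add: deg_def)
  then obtain k where k: "{l\<in>L. p \<lhd> l} = {k}" by (auto simp: card_1_singleton_iff)
  then have k1: "k \<in> L \<and> p \<lhd> k" and k2: "\<And>l. l \<in> L \<and> p \<lhd> l \<Longrightarrow> l = k" by blast+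
  then show "\<exists>!l. l \<in> L \<and> p \<lhd> l" by (rule ex1I)
  assume l: "l \<in> L" "p \<lhd> l" "m \<in> Pl" "p \<lhd> m"
  have u: "x \<in> L \<and> p \<lhd> x \<longleftrightarrow> x = l" for x using k2 l by blast
  have "{k\<in>L. p \<lhd> k \<and> k \<lhd> m} = {k. (k \<in> L \<and> p \<lhd> k) \<and> k \<lhd> m}" by blast
  also have "\<dots> = (if l \<lhd> m then {l} else {})" unfolding u by auto
  finally have "{k\<in>L. p \<lhd> k \<and> k \<lhd> m} = (if l \<lhd> m then {l} else {})" .
  then have "c p m = of_bool (l \<lhd> m)" by simp
  then show "b m = 1 + of_bool (l \<lhd> m)" using c_eq[OF p(1) l(3,4)] p(2) by simp
qed

text \<open>Weight 4 means degree 21, so every pencil at \<open>p\<close> is full and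
  \<open>c_eq\<close> reads 5 = 4 + \<open>b m\<close> - 1.\<close>

lemma full_point:
  assumes p: "p \<in> Pt" "a p = 4"
  shows "l \<in> Ln \<Longrightarrow> p \<lhd> l \<Longrightarrow> l \<in> L"
    and "m \<in> Pl \<Longrightarrow> p \<lhd> m \<Longrightarrow> b m = 2"
proof -
  have "card {l\<in>L. p \<lhd> l} = card {l\<in>Ln. p \<lhd> l}"
    using s_eq[OF p(1)] p(2) card_lines_point[OF p(1)] by (simp add: deg_def)
  then have eq: "{l\<in>L. p \<lhd> l} = {l\<in>Ln. p \<lhd> l}"
    by (intro card_subset_eq) (use finite_Ln L_subset in auto)
  then show "l \<in> Ln \<Longrightarrow> p \<lhd> l \<Longrightarrow> l \<in> L" by blast
  assume m: "m \<in> Pl" "p \<lhd> m"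
  have "{l\<in>L. p \<lhd> l \<and> l \<lhd> m} = {l\<in>Ln. p \<lhd> l \<and> l \<lhd> m}" using eq by blast
  then have "c p m = 5" using card_pencil[OF p(1) m] by simp
  then show "b m = 2" using c_eq[OF p(1) m] p(2) by simp
qed

text \<open>Over a plane the sum of (a - 1)(a - 2) is 4 b (4 - b), and over all points it is 48.
  Summing over the planes on \<open>l\<close> transfers quadratic information from the points of a
  line to the planes on it. Both quadratic expressions are nonnegative on the admissible weights,
  which makes the identity restrictive.\<close>

lemma axis_moment:
  assumes l: "l \<in> Ln"
  shows "(\<Sum>m | m \<in> Pl \<and> l \<lhd> m. b m * (4 - b m)) = 12 + (\<Sum>q | q \<in> Pt \<and> q \<lhd> l. (a q - 1) * (a q - 2))"
proof -
  let ?g = "\<lambda>q. (a q - 1) * (a q - 2)"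
  have g: "?g q = (a q)\<^sup>2 - 3 * a q + 2" for q by (simp add: power2_eq_square algebra_simps)
  have "(\<Sum>q | q \<in> Pt \<and> q \<lhd> m. ?g q) = 4 * (b m * (4 - b m))" if "m \<in> Pl" for m
    unfolding g sum_subtractf sum.distrib sum_distrib_left[symmetric] sum_a_plane[OF that]
    using card_points_plane[OF that] by (simp add: power2_eq_square algebra_simps)
  then have "(\<Sum>m | m \<in> Pl \<and> l \<lhd> m. \<Sum>q | q \<in> Pt \<and> q \<lhd> m. ?g q)
      = (\<Sum>m | m \<in> Pl \<and> l \<lhd> m. 4 * (b m * (4 - b m)))"
    by (intro sum.cong) auto
  also have "\<dots> = 4 * (\<Sum>m | m \<in> Pl \<and> l \<lhd> m. b m * (4 - b m))"
    by (rule sum_distrib_left[symmetric])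
  also have "(\<Sum>m | m \<in> Pl \<and> l \<lhd> m. \<Sum>q | q \<in> Pt \<and> q \<lhd> m. ?g q)
      = 48 + 4 * (\<Sum>q | q \<in> Pt \<and> q \<lhd> l. ?g q)"
  proof -
    have "sum ?g Pt = 48"
      unfolding g sum_subtractf sum.distrib sum_distrib_left[symmetric] sum_a sum_a_sq
      using card_Pt by simp
    then show ?thesis using sum_axis[OF l, of ?g] by simp
  qed
  finally show ?thesis by simp
qed

section \<open>Exclusion of the weight 4\<close>

lemma line_sum_b: "l \<in> Ln \<Longrightarrow> (\<Sum>m | m \<in> Pl \<and> l \<lhd> m. b m) = 6 + 4 * of_bool (l \<in> L)"
  using cl34.line_sum_a[OF dual] .

text \<open>All points of the unique line \<open>l\<close> of \<open>L\<close> in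
  \<open>\<sigma>\<close> have weight 2, which fixes the first two moments of \<open>b\<close> over
  the planes on \<open>l\<close>. One of these planes contains the full point and has weight 2; the
  other four cannot realize what is left.\<close>

lemma no_full_point_no_full_plane:
  assumes p: "p \<in> Pt" "a p = 4" and \<sigma>: "\<sigma> \<in> Pl" "b \<sigma> = 0" and no: "\<And>m. m \<in> Pl \<Longrightarrow> b m \<noteq> 4"
  shows False
proof -
  obtain l where l: "l \<in> L" "l \<lhd> \<sigma>" using cl34.zero_axis(1)[OF dual \<sigma>] by blast
  have lLn: "l \<in> Ln" using l L_subset by blast
  have two: "a q = 2" if "q \<in> Pt" "q \<lhd> l" for q
    using cl34.zero_axis(2)[OF dual \<sigma> l(1,2), of q] that inc_trans[of q l \<sigma>] lLn l \<sigma> by simp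
  then have npl: "\<not> p \<lhd> l" using p by auto
  obtain \<rho> where \<rho>: "\<rho> \<in> Pl" "p \<lhd> \<rho>" "l \<lhd> \<rho>" using obtain_span[OF p(1) lLn npl] by blast
  have b\<rho>: "b \<rho> = 2" using full_point(2)[OF p] \<rho> by blast
  let ?A = "{m\<in>Pl. l \<lhd> m}" and ?h = "\<lambda>m. (b m - 1) * (b m - 2)"
  have fin: "finite ?A" using finite_Pl by simp
  have "(\<Sum>q | q \<in> Pt \<and> q \<lhd> l. a q * (4 - a q)) = (\<Sum>q | q \<in> Pt \<and> q \<lhd> l. 4)"
    by (rule sum.cong) (auto simp: two)
  \<comment> \<open>Five points of weight 2 give 5 * 4 = 20 = 12 + 8 in the dual of
    \<open>axis_moment\<close>.\<close>
  then have h: "(\<Sum>m\<in>?A. ?h m) = 8"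
    using cl34.axis_moment[OF dual lLn] card_points_line[OF lLn] by simp
  have "(\<Sum>m\<in>?A - {\<rho>}. ?h m) = 8" "(\<Sum>m\<in>?A - {\<rho>}. b m) = 8"
    using h line_sum_b[OF lLn] l b\<rho> sum.remove[OF fin, of \<rho> ?h] sum.remove[OF fin, of \<rho> b] \<rho> by auto
  moreover have "card (?A - {\<rho>}) = 4" using card_planes_line[OF lLn] \<rho> fin by simp
  \<comment> \<open>Over the four remaining planes this sums to 4 * 2 - 8 = 0. As no plane has
    weight 4, all terms are nonnegative and hence vanish.\<close>
  moreover have "b m * (3 - b m) = 2 - ?h m" for m by (simp add: algebra_simps)
  ultimately have "(\<Sum>m\<in>?A - {\<rho>}. b m * (3 - b m)) = 0" by (simp add: sum_subtractf)
  moreover have "0 \<le> b m * (3 - b m)" if "m \<in> ?A - {\<rho>}" for m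
    using b_range[of m] no[of m] that by (intro mult_nonneg_nonneg) auto
  ultimately have "\<forall>m\<in>?A - {\<rho>}. b m * (3 - b m) = 0"
    using sum_nonneg_eq_0_iff[of "?A - {\<rho>}" "\<lambda>m. b m * (3 - b m)"] fin by blast
  \<comment> \<open>Weights 0 and 3 only give multiples of 3, but the four planes have total 10 - 2
    = 8.\<close>
  then have "b m = 0 \<or> b m = 3" if "m \<in> ?A - {\<rho>}" for m using bspec that by fastforce
  then have "3 dvd b m" if "m \<in> ?A - {\<rho>}" for m using that by force
  then have "3 dvd (\<Sum>m\<in>?A - {\<rho>}. b m)" by (rule dvd_sum)
  then show False using \<open>(\<Sum>m\<in>?A - {\<rho>}. b m) = 8\<close> by simp
qed

text \<open>A full point together with a full plane excludes points of weight 1, hence planes of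
  weight 0. The count of planes of weight 2 then provides a second full plane, and on the common
  line of two full planes too little weight is left for the other planes.\<close>

lemma no_full_point_full_plane:
  assumes p: "p \<in> Pt" "a p = 4" and \<tau>: "\<tau> \<in> Pl" "b \<tau> = 4" and two: "21 \<le> M 2"
  shows False
proof -
  have np\<tau>: "\<not> p \<lhd> \<tau>" using full_point(2)[OF p \<tau>(1)] \<tau> by auto
  have ne1: "a q \<noteq> 1" if q: "q \<in> Pt" for q
  proof
    assume aq: "a q = 1"
    then have "q \<noteq> p" using p by auto
    then obtain l where l: "l \<in> Ln" "p \<lhd> l" "q \<lhd> l" using obtain_join p q by metis
    obtain r where r: "r \<in> Pt" "r \<lhd> \<tau>" "r \<lhd> l" using obtain_trace[OF \<tau>(1) l(1)] by blast
    have ar: "a r = 2" using cl34.full_point(2)[OF dual \<tau> r(1,2)] .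
    let ?X = "{x\<in>Pt. x \<lhd> l}" and ?g = "\<lambda>q. (a q - 1) * (a q - 2)"
    have fin: "finite ?X" using finite_Pt by simp
    have sub: "{p, q, r} \<subseteq> ?X" and d: "p \<noteq> q" "p \<noteq> r" "q \<noteq> r" using p q r l aq ar by auto
    have "card (?X - {p, q, r}) = 2"
      using card_points_line[OF l(1)] card_Diff_subset[OF _ sub] d by simp
    then obtain x y where xy: "?X - {p, q, r} = {x, y}" "x \<noteq> y" by (auto simp: card_2_iff)
    then have X: "?X = {p, q, r, x, y}" using sub by auto
    have "x \<notin> {p, q, r}" "y \<notin> {p, q, r}" using xy by blast+
    then have "p \<notin> {q, r, x, y}" "q \<notin> {r, x, y}" "r \<notin> {x, y}" "x \<notin> {y}" using d xy(2) by auto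
    then have sumX: "sum f ?X = f p + f q + f r + f x + f y" for f :: "'a \<Rightarrow> int"
      unfolding X by simp
    have "(\<Sum>m | m \<in> Pl \<and> l \<lhd> m. b m * (4 - b m)) = (\<Sum>m | m \<in> Pl \<and> l \<lhd> m. 4)"
    proof (rule sum.cong[OF refl])
      fix m assume "m \<in> {m\<in>Pl. l \<lhd> m}"
      then have "b m = 2" using full_point(2)[OF p, of m] inc_trans p l by blast
      then show "b m * (4 - b m) = 4" by simp
    qed
    \<comment> \<open>All planes on \<open>l\<close> contain the full point and have weight 2, so 5
      * 4 = 12 + 8.\<close>
    then have "sum ?g ?X = 8" using axis_moment[OF l(1)] card_planes_line[OF l(1)] by simp
    moreover have "sum a ?X = 10" using line_sum_a[OF l(1)] full_point(1)[OF p l(1,2)] by simp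
    ultimately have e: "a x + a y = 3" "?g x + ?g y = 2"
      unfolding sumX using p aq ar by auto
    have "x \<in> Pt" using X by blast
    then have "a x \<in> {0,1,2,3,4}" using a_range[of x] by auto
    moreover have "a y = 3 - a x" using e by simp
    \<comment> \<open>The weights of \<open>x\<close> and \<open>y\<close> add up to 3: the split 0
      + 3 gives the quadratic sum 4 and the split 1 + 2 gives 0, never 2.\<close>
    ultimately show False using e(2) by auto
  qed
  have no0: "b m \<noteq> 0" if m: "m \<in> Pl" for m
  proof
    assume bm: "b m = 0"
    obtain l where l: "l \<in> L" "l \<lhd> m" using cl34.zero_axis(1)[OF dual m bm] by blast
    \<comment> \<open>A plane of weight 0 has points off its only line of \<open>L\<close>, and by
      the dual of \<open>zero_axis\<close> those have weight 1.\<close>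
    have "card {q\<in>Pt. q \<lhd> l} < card {q\<in>Pt. q \<lhd> m}"
      using card_points_line card_points_plane[OF m] l L_subset by fastforce
    then have "\<not> {q\<in>Pt. q \<lhd> m} \<subseteq> {q\<in>Pt. q \<lhd> l}"
      using card_mono[of "{q\<in>Pt. q \<lhd> l}" "{q\<in>Pt. q \<lhd> m}"] finite_Pt by auto
    then obtain q where q: "q \<in> Pt" "q \<lhd> m" "\<not> q \<lhd> l" by blast
    then have "a q = 1" using cl34.zero_axis(2)[OF dual m bm l(1,2) q(1,2)] by simp
    then show False using ne1 q by blast
  qed
  then have "M 0 = 0" by (simp add: card_eq_0_iff)
  then have "M 4 \<ge> 8" using two M_eqs(2) by simp
  then have "\<not> {m\<in>Pl. b m = 4} \<subseteq> {\<tau>}"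
    using card_mono[of "{\<tau>}" "{m\<in>Pl. b m = 4}"] by auto
  then obtain \<tau>' where \<tau>': "\<tau>' \<in> Pl" "b \<tau>' = 4" "\<tau>' \<noteq> \<tau>" by blast
  obtain l where l: "l \<in> Ln" "l \<lhd> \<tau>" "l \<lhd> \<tau>'" using obtain_meet[of \<tau> \<tau>'] \<tau> \<tau>' by blast
  have lL: "l \<in> L" using cl34.full_point(1)[OF dual \<tau> l(1,2)] .
  have "\<not> p \<lhd> l" using inc_trans p l \<tau> np\<tau> by blast
  then obtain \<rho> where \<rho>: "\<rho> \<in> Pl" "p \<lhd> \<rho>" "l \<lhd> \<rho>" using obtain_span[OF p(1) l(1)] by blast
  have b\<rho>: "b \<rho> = 2" using full_point(2)[OF p] \<rho> by blast
  let ?A = "{m\<in>Pl. l \<lhd> m}"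
  have fin: "finite ?A" using finite_Pl by simp
  have sub: "{\<tau>, \<tau>', \<rho>} \<subseteq> ?A" and d: "\<tau> \<noteq> \<tau>'" "\<tau> \<noteq> \<rho>" "\<tau>' \<noteq> \<rho>" using \<tau> \<tau>' \<rho> l b\<rho> by auto
  have "card (?A - {\<tau>, \<tau>', \<rho>}) = 2"
    using card_planes_line[OF l(1)] card_Diff_subset[OF _ sub] d by simp
  then obtain x y where xy: "?A - {\<tau>, \<tau>', \<rho>} = {x, y}" "x \<noteq> y" by (auto simp: card_2_iff)
  then have A: "?A = {\<tau>, \<tau>', \<rho>, x, y}" using sub by auto
  have "x \<notin> {\<tau>, \<tau>', \<rho>}" "y \<notin> {\<tau>, \<tau>', \<rho>}" using xy by blast+
  then have "\<tau> \<notin> {\<tau>', \<rho>, x, y}" "\<tau>' \<notin> {\<rho>, x, y}" "\<rho> \<notin> {x, y}" "x \<notin> {y}" using d xy(2) by auto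
  then have "sum b ?A = b \<tau> + b \<tau>' + b \<rho> + b x + b y"
    unfolding A by simp
  moreover have "sum b ?A = 10" using line_sum_b[OF l(1)] lL by simp
  moreover have "x \<in> Pl" "y \<in> Pl" using A by blast+
  \<comment> \<open>The total 10 is already used up by 4 + 4 + 2, which would leave weight 0 for the
    planes \<open>x\<close> and \<open>y\<close>.\<close>
  ultimately show False using \<tau> \<tau>' b\<rho> no0[of x] b_range(1)[of x] b_range(1)[of y] by simp
qed

lemma not_full:
  assumes p: "p \<in> Pt"
  shows "a p \<noteq> 4"
proof
  assume ap: "a p = 4"
  have "{m\<in>Pl. p \<lhd> m} \<subseteq> {m\<in>Pl. b m = 2}" using full_point(2)[OF p ap] by blast
  then have two: "21 \<le> M 2"
    using card_mono[of "{m\<in>Pl. b m = 2}" "{m\<in>Pl. p \<lhd> m}"] card_planes_point[OF p] finite_Pl by simp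
  show False
  proof (cases "\<exists>m\<in>Pl. b m = 4")
    case True
    then show False using no_full_point_full_plane[OF p ap] two by blast
  next
    case False
    then have "M 4 = 0" by (auto simp: card_eq_0_iff)
    then have "M 0 \<noteq> 0" using two M_eqs(2) by simp
    then have "\<exists>m\<in>Pl. b m = 0" by (auto simp: card_eq_0_iff)
    then show False using no_full_point_no_full_plane[OF p ap] False by blast
  qed
qed

lemma not_full_plane: "m \<in> Pl \<Longrightarrow> b m \<noteq> 4"
  using cl34.not_full[OF dual] .

end

section \<open>The structure of the line class\<close>

context cl34
begin

abbreviation "Z \<equiv> {p\<in>Pt. a p = 0}"

lemma N_simps:
  shows "N 3 = 24 - N 0" "N 2 = 3 * N 0 - 3" "N 1 = 64 - 3 * N 0"
proof -
  have "N 4 = 0" using not_full by (auto simp: card_eq_0_iff)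
  then show "N 3 = 24 - N 0" "N 2 = 3 * N 0 - 3" "N 1 = 64 - 3 * N 0" using N_eqs by simp_all
qed

section \<open>Pairs of points of weight 0\<close>

lemma finite_Z: "finite Z" using finite_Pt by simp

text \<open>The other three points of \<open>l\<close> would have to supply the total 10 with
  weights at most 3.\<close>

lemma two_zeros_not_L:
  assumes "p \<in> Z" "q \<in> Z" "p \<noteq> q" "l \<in> L" "p \<lhd> l"
  shows "\<not> q \<lhd> l"
proof
  assume q: "q \<lhd> l"
  have l: "l \<in> Ln" using assms L_subset by blast
  let ?X = "{x\<in>Pt. x \<lhd> l}"
  have fin: "finite ?X" using finite_Pt by simp
  have sub: "{p, q} \<subseteq> ?X" using assms q by auto
  have "card (?X - {p, q}) = 3"
    using card_points_line[OF l] card_Diff_subset[OF _ sub] assms by simp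
  moreover have "sum a (?X - {p, q}) \<le> of_nat (card (?X - {p, q})) * 3"
  proof (rule sum_bounded_above)
    fix x assume "x \<in> ?X - {p, q}"
    then show "a x \<le> 3" using a_range(2)[of x] not_full[of x] by fastforce
  qed
  moreover have "sum a ?X = sum a (?X - {p, q}) + sum a {p, q}"
    by (rule sum.subset_diff[OF sub fin])
  ultimately show False using line_sum_a[OF l] assms by simp
qed

lemma obtain_axis:
  obtains ax where "\<And>p. p \<in> Z \<Longrightarrow> ax p \<in> L" "\<And>p. p \<in> Z \<Longrightarrow> p \<lhd> ax p"
    "\<And>p l. \<lbrakk>p \<in> Z; l \<in> L; p \<lhd> l\<rbrakk> \<Longrightarrow> l = ax p"
proof -
  have "\<forall>p\<in>Z. \<exists>l. l \<in> L \<and> p \<lhd> l \<and> (\<forall>k. k \<in> L \<and> p \<lhd> k \<longrightarrow> k = l)"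
    using zero_axis(1) by blast
  then obtain ax where "\<forall>p\<in>Z. ax p \<in> L \<and> p \<lhd> ax p \<and> (\<forall>k. k \<in> L \<and> p \<lhd> k \<longrightarrow> k = ax p)"
    by (rule bchoice[elim_format]) blast
  then show ?thesis using that by blast
qed

lemma zero_planes:
  assumes p: "p \<in> Z"
  shows "card {m \<in> {m\<in>Pl. b m = 2}. p \<lhd> m} = 5" "card {m \<in> {m\<in>Pl. b m = 1}. p \<lhd> m} = 16"
proof -
  have pp: "p \<in> Pt" "a p = 0" using p by auto
  obtain l where l: "l \<in> L" "p \<lhd> l" using zero_axis(1)[OF pp] by blast
  have lLn: "l \<in> Ln" using l L_subset by blast
  have bm: "b m = 1 + of_bool (l \<lhd> m)" if "m \<in> Pl" "p \<lhd> m" for m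
    using zero_axis(2)[OF pp l] that by blast
  have "{m \<in> {m\<in>Pl. b m = 2}. p \<lhd> m} = {m\<in>Pl. l \<lhd> m}"
    using bm inc_trans[OF pp(1) lLn _ l(2)] by auto
  then show 5: "card {m \<in> {m\<in>Pl. b m = 2}. p \<lhd> m} = 5" using card_planes_line[OF lLn] by simp
  have "{m\<in>Pl. p \<lhd> m} = {m \<in> {m\<in>Pl. b m = 2}. p \<lhd> m} \<union> {m \<in> {m\<in>Pl. b m = 1}. p \<lhd> m}"
    using bm by auto
  moreover have "card \<dots> = card {m \<in> {m\<in>Pl. b m = 2}. p \<lhd> m} + card {m \<in> {m\<in>Pl. b m = 1}. p \<lhd> m}"
    by (rule card_Un_disjoint) (use finite_Pl in auto)
  ultimately show "card {m \<in> {m\<in>Pl. b m = 1}. p \<lhd> m} = 16"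
    using 5 card_planes_point[OF pp(1)] by simp
qed

text \<open>The planes of weight 2 on \<open>p\<close> are those on its axis, and \<open>q\<close>
  is off that axis. So exactly one of the five planes on the line \<open>pq\<close> has weight 2,
  and the other four have weight 1.\<close>

lemma zero_pair_planes:
  assumes p: "p \<in> Z" and q: "q \<in> Z" and pq: "p \<noteq> q"
  shows "card {m \<in> {m\<in>Pl. b m = 2}. p \<lhd> m \<and> q \<lhd> m} = 1"
    "card {m \<in> {m\<in>Pl. b m = 1}. p \<lhd> m \<and> q \<lhd> m} = 4"
proof -
  have pp: "p \<in> Pt" "a p = 0" "q \<in> Pt" using p q by auto
  obtain l where l: "l \<in> L" "p \<lhd> l" using zero_axis(1)[OF pp(1,2)] by blast
  have lLn: "l \<in> Ln" using l L_subset by blast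
  have bm: "b m = 1 + of_bool (l \<lhd> m)" if "m \<in> Pl" "p \<lhd> m" for m
    using zero_axis(2)[OF pp(1,2) l] that by blast
  have "{m \<in> {m\<in>Pl. b m = 2}. p \<lhd> m \<and> q \<lhd> m} = {m\<in>Pl. q \<lhd> m \<and> l \<lhd> m}"
    using bm inc_trans[OF pp(1) lLn _ l(2)] by auto
  moreover have "\<not> q \<lhd> l" using two_zeros_not_L[OF p q pq l] .
  ultimately show 1: "card {m \<in> {m\<in>Pl. b m = 2}. p \<lhd> m \<and> q \<lhd> m} = 1"
    using card_span[OF pp(3) lLn] by simp
  obtain k where k: "k \<in> Ln" "p \<lhd> k" "q \<lhd> k" using obtain_join pp pq by metis
  have "{m\<in>Pl. p \<lhd> m \<and> q \<lhd> m} = {m\<in>Pl. k \<lhd> m}"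
    using line_in_plane[of p q k] inc_trans[of _ k] k pp pq by blast
  then have 5: "card {m\<in>Pl. p \<lhd> m \<and> q \<lhd> m} = 5" using card_planes_line[OF k(1)] by simp
  have "{m\<in>Pl. p \<lhd> m \<and> q \<lhd> m} = {m \<in> {m\<in>Pl. b m = 2}. p \<lhd> m \<and> q \<lhd> m}
      \<union> {m \<in> {m\<in>Pl. b m = 1}. p \<lhd> m \<and> q \<lhd> m}"
    using bm by auto
  moreover have "card \<dots> = card {m \<in> {m\<in>Pl. b m = 2}. p \<lhd> m \<and> q \<lhd> m}
      + card {m \<in> {m\<in>Pl. b m = 1}. p \<lhd> m \<and> q \<lhd> m}"
    by (rule card_Un_disjoint) (use finite_Pl in auto)
  ultimately show "card {m \<in> {m\<in>Pl. b m = 1}. p \<lhd> m \<and> q \<lhd> m} = 4"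
    using 1 5 by simp
qed

text \<open>The usual moments of block sizes for a structure in which each point is on
  \<open>u\<close> blocks and each pair of points on \<open>v\<close>; the blocks are the planes of
  weight \<open>i\<close>.\<close>

lemma zero_plane_sums:
  assumes "\<And>p. p \<in> Z \<Longrightarrow> card {m \<in> {m\<in>Pl. b m = i}. p \<lhd> m} = u"
    and "\<And>p q. p \<in> Z \<Longrightarrow> q \<in> Z \<Longrightarrow> p \<noteq> q \<Longrightarrow> card {m \<in> {m\<in>Pl. b m = i}. p \<lhd> m \<and> q \<lhd> m} = v"
  shows "(\<Sum>m | m \<in> Pl \<and> b m = i. int (card {q\<in>Z. q \<lhd> m})) = int u * N 0"
    and "(\<Sum>m | m \<in> Pl \<and> b m = i. (int (card {q\<in>Z. q \<lhd> m}))\<^sup>2) = int v * (N 0)\<^sup>2 + (int u - int v) * N 0"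
proof -
  let ?A = "{m\<in>Pl. b m = i}"
  have fin: "finite ?A" using finite_Pl by simp
  have "(\<Sum>m\<in>?A. int (card {q\<in>Z. q \<lhd> m})) = (\<Sum>q\<in>Z. int (card {m\<in>?A. q \<lhd> m}))"
    by (rule double_count[OF fin finite_Z])
  also have "\<dots> = (\<Sum>q\<in>Z. int u)"
    by (rule sum.cong[OF refl]) (simp only: assms)
  finally show "(\<Sum>m\<in>?A. int (card {q\<in>Z. q \<lhd> m})) = int u * N 0" by simp
  have "(\<Sum>m\<in>?A. (int (card {q\<in>Z. q \<lhd> m}))\<^sup>2)
      = (\<Sum>p\<in>Z. \<Sum>q\<in>Z. int (card {m\<in>?A. p \<lhd> m \<and> q \<lhd> m}))"
    by (rule sum_square_count[OF fin finite_Z])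
  also have "\<dots> = (\<Sum>p\<in>Z. int v * N 0 + (int u - int v))"
  proof (rule sum.cong[OF refl])
    fix p assume p: "p \<in> Z"
    have "(\<Sum>q\<in>Z. int (card {m\<in>?A. p \<lhd> m \<and> q \<lhd> m})) = (\<Sum>q\<in>Z. int v + (if q = p then int u - int v else 0))"
    proof (rule sum.cong[OF refl])
      fix q assume q: "q \<in> Z"
      show "int (card {m\<in>?A. p \<lhd> m \<and> q \<lhd> m}) = int v + (if q = p then int u - int v else 0)"
        using assms(1)[OF p] assms(2)[OF p q] by (cases "q = p") simp_all
    qed
    also have "\<dots> = int v * N 0 + (int u - int v)"
      using p finite_Z by (simp add: sum.distrib)
    finally show "(\<Sum>q\<in>Z. int (card {m\<in>?A. p \<lhd> m \<and> q \<lhd> m})) = int v * N 0 + (int u - int v)" .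
  qed
  also have "\<dots> = int v * (N 0)\<^sup>2 + (int u - int v) * N 0"
    by (simp add: power2_eq_square algebra_simps)
  finally show "(\<Sum>m\<in>?A. (int (card {q\<in>Z. q \<lhd> m}))\<^sup>2) = int v * (N 0)\<^sup>2 + (int u - int v) * N 0" .
qed

lemmas zero_sums_2 = zero_plane_sums[where i = 2, OF zero_planes(1) zero_pair_planes(1), simplified]
lemmas zero_sums_1 = zero_plane_sums[where i = 1, OF zero_planes(2) zero_pair_planes(2), simplified]

lemma zero_inequalities:
  shows "(5 * N 0)\<^sup>2 \<le> ((N 0)\<^sup>2 + 4 * N 0) * (3 * M 0 - 3)"
    and "(16 * N 0)\<^sup>2 \<le> (4 * (N 0)\<^sup>2 + 12 * N 0) * (64 - 3 * M 0)"
proof -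
  have cs: "(\<Sum>m\<in>A. int (card {q\<in>Z. q \<lhd> m}))\<^sup>2 \<le> (\<Sum>m\<in>A. (int (card {q\<in>Z. q \<lhd> m}))\<^sup>2) * int (card A)" for A
    by (rule cauchy_schwarz_int)
  show "(5 * N 0)\<^sup>2 \<le> ((N 0)\<^sup>2 + 4 * N 0) * (3 * M 0 - 3)"
    using cs[of "{m\<in>Pl. b m = 2}"] cl34.N_simps(2)[OF dual] zero_sums_2 by simp
  show "(16 * N 0)\<^sup>2 \<le> (4 * (N 0)\<^sup>2 + 12 * N 0) * (64 - 3 * M 0)"
    using cs[of "{m\<in>Pl. b m = 1}"] cl34.N_simps(3)[OF dual] zero_sums_1 by simp
qed

lemma N_0: "N 0 = 6" and M_0: "M 0 = 6"
proof -
  have "1 \<le> N 0" "N 0 \<le> 24" using N_simps(1,2) by simp_all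
  moreover have "1 \<le> M 0" "M 0 \<le> 24" using cl34.N_simps(1,2)[OF dual] by simp_all
  ultimately show "N 0 = 6" "M 0 = 6"
    using zero_count_unique[of "N 0" "M 0"] zero_inequalities cl34.zero_inequalities[OF dual] by blast+
qed

text \<open>The 15 planes of weight 2 have block sizes with sum 30 and sum of squares 60, so their
  squared deviations from 2 add up to 60 - 120 + 60 = 0.\<close>

lemma two_plane_zeros:
  assumes "m \<in> Pl" "b m = 2"
  shows "card {q\<in>Z. q \<lhd> m} = 2"
proof -
  let ?A = "{m\<in>Pl. b m = 2}" and ?k = "\<lambda>m. int (card {q\<in>Z. q \<lhd> m})"
  have "(\<Sum>m\<in>?A. (?k m - 2)\<^sup>2) = (\<Sum>m\<in>?A. (?k m)\<^sup>2 - 4 * ?k m + 4)"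
    by (rule sum.cong) (auto simp: power2_eq_square algebra_simps)
  also have "\<dots> = (\<Sum>m\<in>?A. (?k m)\<^sup>2) - 4 * (\<Sum>m\<in>?A. ?k m) + 4 * M 2"
    unfolding sum.distrib sum_subtractf sum_distrib_left[symmetric] by simp
  also have "\<dots> = 0"
    using zero_sums_2 N_0 M_0 cl34.N_simps(2)[OF dual] by simp
  finally have "\<forall>m\<in>?A. (?k m - 2)\<^sup>2 = 0"
    using sum_nonneg_eq_0_iff[of ?A "\<lambda>m. (?k m - 2)\<^sup>2"] finite_Pl by simp
  then have "(?k m - 2)\<^sup>2 = 0" using assms by blast
  then show ?thesis by simp
qed

text \<open>A line through a point of weight 0 is coplanar with the axis of that point. Such a plane
  has weight 2 and contains only two points of weight 0.\<close>

lemma no_three_zeros_collinear: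
  assumes l: "l \<in> Ln"
  shows "card {p\<in>Z. p \<lhd> l} \<le> 2"
proof (cases "\<exists>p\<in>Z. p \<lhd> l")
  case False
  then have "{p\<in>Z. p \<lhd> l} = {}" by blast
  then show ?thesis by (simp only: card.empty)
next
  case True
  then obtain p where p: "p \<in> Pt" "a p = 0" "p \<lhd> l" by blast
  obtain k where k: "k \<in> L" "p \<lhd> k" using zero_axis(1)[OF p(1,2)] by blast
  have kLn: "k \<in> Ln" using k L_subset by blast
  obtain m where m: "m \<in> Pl" "k \<lhd> m" "l \<lhd> m"
  proof (cases "k = l")
    case True
    then show ?thesis using obtain_plane_on_line[OF l] that by blast
  next
    case False
    have "\<not> {q\<in>Pt. q \<lhd> l} \<subseteq> {p}"
      using card_points_line[OF l] card_mono[of "{p}" "{q\<in>Pt. q \<lhd> l}"] by auto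
    then obtain q where q: "q \<in> Pt" "q \<lhd> l" "q \<noteq> p" by blast
    have "\<not> q \<lhd> k" using lines_common_point_le[OF kLn l False p(1) q(1)] k p q by blast
    then obtain m where m: "m \<in> Pl" "q \<lhd> m" "k \<lhd> m" using obtain_span[OF q(1) kLn] by blast
    have "p \<lhd> m" using inc_trans[OF p(1) kLn m(1) k(2) m(3)] .
    then have "l \<lhd> m" using line_in_plane[of p q l m] p q l m by blast
    then show ?thesis using that m by blast
  qed
  have "p \<lhd> m" using inc_trans[OF p(1) kLn m(1) k(2) m(2)] .
  then have "b m = 2" using zero_axis(2)[OF p(1,2) k m(1)] m by simp
  then have "card {q\<in>Z. q \<lhd> m} = 2" using two_plane_zeros m by blast
  moreover have "{p\<in>Z. p \<lhd> l} \<subseteq> {q\<in>Z. q \<lhd> m}" using inc_trans[OF _ l m(1) _ m(3)] by blast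
  ultimately show ?thesis using card_mono[of "{q\<in>Z. q \<lhd> m}" "{p\<in>Z. p \<lhd> l}"] finite_Pt by simp
qed

lemma obtain_apex:
  obtains P where "P \<in> Pt" "a P = 1"
    "\<And>m. m \<in> Pl \<Longrightarrow> b m = 2 \<Longrightarrow> P \<lhd> m" "\<And>m. m \<in> Pl \<Longrightarrow> b m = 0 \<Longrightarrow> P \<lhd> m"
    "\<And>p l. p \<in> Z \<Longrightarrow> l \<in> L \<Longrightarrow> p \<lhd> l \<Longrightarrow> P \<lhd> l"
proof -
  obtain ax where ax: "\<And>p. p \<in> Z \<Longrightarrow> ax p \<in> L" "\<And>p. p \<in> Z \<Longrightarrow> p \<lhd> ax p"
    "\<And>p l. \<lbrakk>p \<in> Z; l \<in> L; p \<lhd> l\<rbrakk> \<Longrightarrow> l = ax p"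
    by (rule obtain_axis) blast
  have axL: "ax p \<in> Ln" if "p \<in> Z" for p using ax(1)[OF that] L_subset by blast
  have inj: "ax p \<noteq> ax q" if "p \<in> Z" "q \<in> Z" "p \<noteq> q" for p q
    using two_zeros_not_L[OF that ax(1)[OF that(1)] ax(2)[OF that(1)]] ax(2)[OF that(2)] by metis
  have axm: "ax p \<lhd> m" if "p \<in> Z" "m \<in> Pl" "b m = 2" "p \<lhd> m" for p m
    using zero_axis(2)[of p "ax p" m] ax(1,2)[OF that(1)] that by (cases "ax p \<lhd> m") auto
  \<comment> \<open>The plane of weight 2 on \<open>p\<close> and \<open>q\<close> must contain the
    axis of each, so any two axes are coplanar and therefore meet.\<close>
  have plane: "\<exists>m\<in>Pl. b m = 2 \<and> ax p \<lhd> m \<and> ax q \<lhd> m" if pq: "p \<in> Z" "q \<in> Z" "p \<noteq> q" for p q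
  proof -
    have "card {m \<in> {m\<in>Pl. b m = 2}. p \<lhd> m \<and> q \<lhd> m} = 1" using zero_pair_planes(1)[OF pq] .
    then obtain m where "{m \<in> {m\<in>Pl. b m = 2}. p \<lhd> m \<and> q \<lhd> m} = {m}"
      by (auto simp: card_1_singleton_iff)
    then have "m \<in> Pl" "b m = 2" "p \<lhd> m" "q \<lhd> m" by blast+
    then show ?thesis using axm pq by blast
  qed
  have cZ: "card Z = 6" using N_0 by simp
  have "Z \<noteq> {}" using cZ by (metis card.empty zero_neq_numeral)
  then obtain p1 where p1: "p1 \<in> Z" by blast
  have "\<not> Z \<subseteq> {p1}" using cZ card_mono[of "{p1}" Z] by auto
  then obtain p2 where p2: "p2 \<in> Z" "p2 \<noteq> p1" by blast
  obtain m where m: "m \<in> Pl" "b m = 2" "ax p1 \<lhd> m" "ax p2 \<lhd> m" using plane[OF p1 p2(1)] p2 by blast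
  have pm: "p1 \<lhd> m" "p2 \<lhd> m"
    using inc_trans[of p1 "ax p1" m] inc_trans[of p2 "ax p2" m] p1 p2 ax(1,2) axL m by auto
  obtain P where P: "P \<in> Pt" "P \<lhd> ax p1" "P \<lhd> ax p2"
    using lines_meet_in_plane[OF axL[OF p1] axL[OF p2(1)] inj[OF p1 p2(1) p2(2)[symmetric]] m(1,3,4)] by blast
  \<comment> \<open>An axis missing \<open>P\<close> would meet the first two axes in different
    points, hence lie in their plane \<open>m\<close>, and \<open>m\<close> would contain three
    points of weight 0.\<close>
  have all: "P \<lhd> ax q" if q: "q \<in> Z" for q
  proof (rule ccontr)
    assume n: "\<not> P \<lhd> ax q"
    then have ne: "q \<noteq> p1" "q \<noteq> p2" using P by auto
    have "q \<lhd> m \<Longrightarrow> {p1, p2, q} \<subseteq> {q\<in>Z. q \<lhd> m}" using pm p1 p2 q by auto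
    then have "q \<lhd> m \<Longrightarrow> card {p1, p2, q} \<le> 2"
      using two_plane_zeros[OF m(1,2)] card_mono[of "{q\<in>Z. q \<lhd> m}" "{p1, p2, q}"] finite_Pt by simp
    then have qm: "\<not> q \<lhd> m" using ne p2 by auto
    obtain m1 where m1: "m1 \<in> Pl" "ax p1 \<lhd> m1" "ax q \<lhd> m1" using plane[OF p1 q] ne by blast
    obtain x where x: "x \<in> Pt" "x \<lhd> ax p1" "x \<lhd> ax q"
      using lines_meet_in_plane[OF axL[OF p1] axL[OF q] inj[OF p1 q ne(1)[symmetric]] m1] by blast
    obtain m2 where m2: "m2 \<in> Pl" "ax p2 \<lhd> m2" "ax q \<lhd> m2" using plane[OF p2(1) q] ne by blast
    obtain y where y: "y \<in> Pt" "y \<lhd> ax p2" "y \<lhd> ax q"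
      using lines_meet_in_plane[OF axL[OF p2(1)] axL[OF q] inj[OF p2(1) q ne(2)[symmetric]] m2] by blast
    have "x \<noteq> y"
    proof
      assume "x = y"
      then have "x = P"
        using lines_common_point_le[OF axL[OF p1] axL[OF p2(1)] inj[OF p1 p2(1) p2(2)[symmetric]] x(1) P(1)]
          x y P by simp
      then show False using n x by blast
    qed
    moreover have "x \<lhd> m" "y \<lhd> m"
      using inc_trans[of x "ax p1" m] inc_trans[of y "ax p2" m] x y axL p1 p2 m by blast+
    ultimately have "ax q \<lhd> m" using line_in_plane[of x y "ax q" m] x y axL[OF q] m by blast
    then show False using inc_trans[of q "ax q" m] ax(2)[OF q] axL[OF q] q m qm by blast
  qed
  \<comment> \<open>Otherwise \<open>P\<close> would be a second point of weight 0 on the axis of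
    another one.\<close>
  have P0: "a P \<noteq> 0"
  proof
    assume "a P = 0"
    then have PZ: "P \<in> Z" using P by blast
    obtain q where "q \<in> Z" "q \<noteq> P" using p1 p2 by metis
    then show False using two_zeros_not_L[of q P "ax q"] PZ ax all by blast
  qed
  have P2: "P \<lhd> m" if bm: "m \<in> Pl" "b m = 2" for m
  proof -
    have "{q\<in>Z. q \<lhd> m} \<noteq> {}" using two_plane_zeros[OF bm] by (metis card.empty zero_neq_numeral)
    then obtain q where "q \<in> Z" "q \<lhd> m" by blast
    then show ?thesis using axm[of q m] bm all inc_trans[of P "ax q" m] P axL by blast
  qed
  then have "{m\<in>Pl. P \<lhd> m \<and> b m = 2} = {m\<in>Pl. b m = 2}" by blast
  moreover have "M 2 = 15" using M_0 cl34.N_simps(2)[OF dual] by simp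
  moreover have "card {m\<in>Pl. P \<lhd> m \<and> b m = 4} = 0" using not_full_plane by (auto simp: card_eq_0_iff)
  \<comment> \<open>All 15 planes of weight 2 pass through \<open>P\<close>. With z planes of weight
    0 on \<open>P\<close>, weight 3 would need 3z = 10. Weight 2 would need z = 6, while the dual of
    \<open>two_plane_zeros\<close> says 2. Weight 1 needs z = 6, that is, all of them.\<close>
  ultimately have eq: "15 = 4 * (a P)\<^sup>2 - 12 * a P + 5 + 3 * int (card {m\<in>Pl. P \<lhd> m \<and> b m = 0})"
    using cl34.plane_two_count[OF dual P(1)] by simp
  have "a P \<in> {0,1,2,3,4}" using a_range[OF P(1)] by auto
  moreover have "a P \<noteq> 4" by (rule not_full[OF P(1)])
  moreover have "a P \<noteq> 3" using eq by (auto; presburger)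
  moreover have "a P \<noteq> 2"
  proof
    assume "a P = 2"
    then have "card {m \<in> {m\<in>Pl. b m = 0}. P \<lhd> m} = 2"
      using cl34.two_plane_zeros[OF dual P(1)] by blast
    moreover have "{m \<in> {m\<in>Pl. b m = 0}. P \<lhd> m} = {m\<in>Pl. P \<lhd> m \<and> b m = 0}" by blast
    ultimately show False using eq \<open>a P = 2\<close> by simp
  qed
  ultimately have P1: "a P = 1" using P0 by blast
  then have "card {m\<in>Pl. P \<lhd> m \<and> b m = 0} = card {m\<in>Pl. b m = 0}" using eq M_0 by simp
  then have "{m\<in>Pl. P \<lhd> m \<and> b m = 0} = {m\<in>Pl. b m = 0}"
    by (intro card_subset_eq) (use finite_Pl in auto)
  then have "P \<lhd> m" if "m \<in> Pl" "b m = 0" for m using that by blast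
  moreover have "P \<lhd> l" if "p \<in> Z" "l \<in> L" "p \<lhd> l" for p l using all ax(3) that by blast
  ultimately show ?thesis using that P P1 P2 by blast
qed

lemma classification:
  obtains P \<pi> H where "oval34 Pt Ln Pl (\<lhd>) P \<pi> H" "L = oval34.cls Pt Ln (\<lhd>) P \<pi> H"
proof -
  obtain P where ap: "P \<in> Pt" "a P = 1" "\<And>m. m \<in> Pl \<Longrightarrow> b m = 2 \<Longrightarrow> P \<lhd> m"
    "\<And>m. m \<in> Pl \<Longrightarrow> b m = 0 \<Longrightarrow> P \<lhd> m" "\<And>p l. p \<in> Z \<Longrightarrow> l \<in> L \<Longrightarrow> p \<lhd> l \<Longrightarrow> P \<lhd> l"
    by (rule obtain_apex) blast
  obtain \<pi> where pl: "\<pi> \<in> Pl" "b \<pi> = 1" "\<And>p. p \<in> Pt \<Longrightarrow> a p = 2 \<Longrightarrow> p \<lhd> \<pi>"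
    "\<And>p. p \<in> Pt \<Longrightarrow> a p = 0 \<Longrightarrow> p \<lhd> \<pi>"
    by (rule cl34.obtain_apex[OF dual]) blast
  have cZ: "card Z = 6" using N_0 by simp
  have PZ: "P \<notin> Z" using ap(2) by simp
  \<comment> \<open>If \<open>P\<close> were in \<open>\<pi>\<close>, the axis of a point of weight
    0 would join two points of \<open>\<pi>\<close>, so it would lie in \<open>\<pi>\<close> and
    give that plane weight 2.\<close>
  have nP: "\<not> P \<lhd> \<pi>"
  proof
    assume P\<pi>: "P \<lhd> \<pi>"
    have "Z \<noteq> {}" using cZ by (metis card.empty zero_neq_numeral)
    then obtain p where p: "p \<in> Pt" "a p = 0" by blast
    obtain l where l: "l \<in> L" "p \<lhd> l" using zero_axis(1)[OF p] by blast
    have "P \<lhd> l" using ap(5)[of p l] p l by blast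
    moreover have "p \<lhd> \<pi>" using pl p by blast
    moreover have "P \<noteq> p" using ap(2) p by auto
    moreover have "l \<in> Ln" using l L_subset by blast
    ultimately have "l \<lhd> \<pi>" using line_in_plane[of P p l \<pi>] ap(1) p l pl(1) P\<pi> by blast
    then show False using zero_axis(2)[OF p l pl(1) \<open>p \<lhd> \<pi>\<close>] pl(2) by simp
  qed
  interpret oval34 Pt Ln Pl "(\<lhd>)" P \<pi> Z
    by unfold_locales (use ap(1) pl nP cZ no_three_zeros_collinear in auto)
  have C_axis: "l \<in> L \<and> (\<exists>p\<in>Z. p \<lhd> l)" if l: "l \<in> C" for l
  proof -
    obtain p where p: "p \<in> Z" "p \<lhd> l" "P \<lhd> l" "l \<in> Ln" using l unfolding C_def by blast
    obtain k where k: "k \<in> L" "p \<lhd> k" using zero_axis(1)[of p] p by blast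
    have "P \<lhd> k" using ap(5)[OF p(1) k] .
    then have "k = l" using line_unique[of P p k l] ap(1) p k L_subset PZ by blast
    then show ?thesis using k p by blast
  qed
  \<comment> \<open>The 15 points of weight 2 and the six of weight 0 fill all 21 places of
    \<open>\<pi>\<close>.\<close>
  have in\<pi>: "a x \<in> {0, 2}" if x: "x \<in> Pt" "x \<lhd> \<pi>" for x
  proof -
    have "{p\<in>Pt. a p = 2} \<union> Z \<subseteq> {p\<in>Pt. p \<lhd> \<pi>}" using pl by blast
    moreover have "card ({p\<in>Pt. a p = 2} \<union> Z) = card {p\<in>Pt. a p = 2} + card Z"
      by (rule card_Un_disjoint) (use finite_Pt in auto)
    then have "card ({p\<in>Pt. a p = 2} \<union> Z) = card {p\<in>Pt. p \<lhd> \<pi>}"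
      using N_0 N_simps(2) card_points_plane[OF pl(1)] by simp
    ultimately have "{p\<in>Pt. a p = 2} \<union> Z = {p\<in>Pt. p \<lhd> \<pi>}"
      by (intro card_subset_eq) (use finite_Pt in auto)
    then show ?thesis using x by blast
  qed
  have out\<pi>: "a x = 1 \<or> a x = 3" if "x \<in> Pt" "\<not> x \<lhd> \<pi>" for x
  proof -
    have "a x \<noteq> 0" "a x \<noteq> 2" "a x \<noteq> 4" using pl that not_full by blast+
    then show ?thesis using a_range[OF that(1)] by auto
  qed
  \<comment> \<open>The axis has total 10, of which \<open>P\<close> supplies 1 and its point of
    weight 0 nothing; three points of weight at most 3 must supply 9.\<close>
  have cone3: "a x = 3" if l: "l \<in> C" and x: "x \<in> Pt" "x \<lhd> l" "x \<noteq> P" "x \<notin> Z" for l x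
  proof -
    obtain p where p: "p \<in> Z" "p \<lhd> l" "P \<lhd> l" "l \<in> Ln" using l unfolding C_def by blast
    let ?X = "{q\<in>Pt. q \<lhd> l}"
    have fin: "finite ?X" using finite_Pt by simp
    have sub: "{P, p} \<subseteq> ?X" and ne: "P \<noteq> p" using ap(1) p PZ by auto
    have out: "a q \<le> 3" if q: "q \<in> ?X - {P, p}" for q
      using a_range(2)[of q] not_full[of q] q by fastforce
    have "card (?X - {P, p}) = 3"
      using card_points_line[OF p(4)] card_Diff_subset[OF _ sub] ne by simp
    moreover have "sum a ?X = sum a (?X - {P, p}) + sum a {P, p}"
      by (rule sum.subset_diff[OF sub fin])
    then have "sum a (?X - {P, p}) = 9"
      using line_sum_a[OF p(4)] C_axis[OF l] ap(2) p(1) ne by simp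
    ultimately have "(\<Sum>q\<in>?X - {P, p}. 3 - a q) = 0" by (simp add: sum_subtractf)
    then have "\<forall>q\<in>?X - {P, p}. 3 - a q = 0"
      using sum_nonneg_eq_0_iff[of "?X - {P, p}" "\<lambda>q. 3 - a q"] fin out by simp
    then show ?thesis using x p by auto
  qed
  have wa: "w x = a x" if x: "x \<in> Pt" "x \<lhd> \<pi> \<or> x = P \<or> (\<exists>k\<in>C. x \<lhd> k)" for x
  proof -
    consider "x = P" | "x \<in> Z" | "x \<lhd> \<pi>" "x \<notin> Z" | k where "k \<in> C" "x \<lhd> k" "x \<noteq> P" "x \<notin> Z" "\<not> x \<lhd> \<pi>"
      using x by blast
    then show ?thesis
    proof cases
      case 1
      then show ?thesis using w_P ap(2) by simp
    next
      case 2
      then have "\<exists>k\<in>C. x \<lhd> k" "x \<noteq> P" using C_ex1[OF 2] PZ by blast+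
      then show ?thesis using 2 pl(4) unfolding w_def by simp
    next
      case 3
      have "\<not> (\<exists>k\<in>C. x \<lhd> k)"
      proof
        assume "\<exists>k\<in>C. x \<lhd> k"
        then obtain k where k: "k \<in> C" "x \<lhd> k" by blast
        then have "a x = 3" using cone3[of k x] x(1) 3 nP by blast
        then show False using in\<pi>[OF x(1) 3(1)] by simp
      qed
      then show ?thesis using 3 in\<pi>[OF x(1) 3(1)] x unfolding w_def by auto
    next
      case 4
      then have "\<exists>k\<in>C. x \<lhd> k" by blast
      then show ?thesis using 4 cone3[of k x] x(1) unfolding w_def by simp
    qed
  qed
  \<comment> \<open>Outside \<open>\<pi>\<close> and the cone \<open>w\<close> is 1, the smaller of
    the two values possible for \<open>a\<close>. As both functions have total 130, the inequality
    is an equality everywhere.\<close>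
  have w_le: "w x \<le> a x" if x: "x \<in> Pt" for x
  proof (cases "x \<lhd> \<pi> \<or> x = P \<or> (\<exists>k\<in>C. x \<lhd> k)")
    case True
    then show ?thesis using wa x by simp
  next
    case False
    then have "w x = 1" using pl(4) unfolding w_def by auto
    then show ?thesis using out\<pi>[of x] x False by auto
  qed
  have "(\<Sum>x\<in>Pt. a x - w x) = 0" using sum_a sum_w by (simp add: sum_subtractf)
  then have "\<forall>x\<in>Pt. a x - w x = 0"
    using sum_nonneg_eq_0_iff[of Pt "\<lambda>x. a x - w x"] finite_Pt w_le by simp
  then have aw: "a x = w x" if "x \<in> Pt" for x using that by simp
  \<comment> \<open>Line sums 10 and 6 separate members from non-members in both classes.\<close>
  have "l \<in> L \<longleftrightarrow> l \<in> cls" if l: "l \<in> Ln" for l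
  proof -
    have "(\<Sum>x | x \<in> Pt \<and> x \<lhd> l. a x) = (\<Sum>x | x \<in> Pt \<and> x \<lhd> l. w x)"
      by (rule sum.cong) (auto simp: aw)
    then show ?thesis using line_sum_a[OF l] line_sum_w[OF l] by (simp split: if_splits add: of_bool_def)
  qed
  then have "L = cls" using L_subset cls_subset by blast
  then show ?thesis using that oval34_axioms by blast
qed

end

section \<open>Subspaces of a four-dimensional vector space\<close>

text \<open>Of the counts required by \<open>pg34\<close>, the three for points imply all the others; unlike these,
  the full list is self-dual.\<close>

locale incidence34 =
  fixes Pt Ln Pl :: "'b set" and I :: "'b \<Rightarrow> 'b \<Rightarrow> bool" (infix "\<lhd>" 50)
  assumes finite_Pt: "finite Pt" and finite_Ln: "finite Ln" and finite_Pl: "finite Pl"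
    and inc_trans: "\<lbrakk>p \<in> Pt; l \<in> Ln; m \<in> Pl; p \<lhd> l; l \<lhd> m\<rbrakk> \<Longrightarrow> p \<lhd> m"
    and join_ex1: "\<lbrakk>p \<in> Pt; q \<in> Pt; p \<noteq> q\<rbrakk> \<Longrightarrow> \<exists>!l. l \<in> Ln \<and> p \<lhd> l \<and> q \<lhd> l"
    and meet_ex1: "\<lbrakk>m \<in> Pl; n \<in> Pl; m \<noteq> n\<rbrakk> \<Longrightarrow> \<exists>!l. l \<in> Ln \<and> l \<lhd> m \<and> l \<lhd> n"
    and line_in_plane: "\<lbrakk>p \<in> Pt; q \<in> Pt; p \<noteq> q; l \<in> Ln; m \<in> Pl; p \<lhd> l; q \<lhd> l; p \<lhd> m; q \<lhd> m\<rbrakk> \<Longrightarrow> l \<lhd> m"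
    and point_on_line: "\<lbrakk>m \<in> Pl; n \<in> Pl; m \<noteq> n; l \<in> Ln; p \<in> Pt; l \<lhd> m; l \<lhd> n; p \<lhd> m; p \<lhd> n\<rbrakk> \<Longrightarrow> p \<lhd> l"
    and span_ex1: "\<lbrakk>p \<in> Pt; l \<in> Ln; \<not> p \<lhd> l\<rbrakk> \<Longrightarrow> \<exists>!m. m \<in> Pl \<and> p \<lhd> m \<and> l \<lhd> m"
    and trace_ex1: "\<lbrakk>m \<in> Pl; l \<in> Ln; \<not> l \<lhd> m\<rbrakk> \<Longrightarrow> \<exists>!p. p \<in> Pt \<and> p \<lhd> m \<and> p \<lhd> l"
    and card_Pt: "card Pt = 85"
    and card_points_line: "l \<in> Ln \<Longrightarrow> card {p\<in>Pt. p \<lhd> l} = 5"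
    and card_points_plane: "m \<in> Pl \<Longrightarrow> card {p\<in>Pt. p \<lhd> m} = 21"
begin

lemma count_by_flags:
  assumes "finite A" "finite B" "\<And>x. x \<in> A \<Longrightarrow> card {y\<in>B. R x y} = u"
    and "\<And>y. y \<in> B \<Longrightarrow> card {x\<in>A. R x y} = v"
  shows "card A * u = card B * v"
proof -
  have "(\<Sum>x\<in>A. int (card {y\<in>B. R x y})) = (\<Sum>x\<in>A. int u)"
    by (rule sum.cong[OF refl]) (simp only: assms)
  moreover have "(\<Sum>y\<in>B. int (card {x\<in>A. R x y})) = (\<Sum>y\<in>B. int v)"
    by (rule sum.cong[OF refl]) (simp only: assms)
  ultimately have "int (card A * u) = int (card B * v)"
    using double_count[OF assms(1,2), of R] by simp
  then show ?thesis by (simp only: of_nat_eq_iff)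
qed

lemma card_points_off: "l \<in> Ln \<Longrightarrow> p \<in> Pt \<Longrightarrow> p \<lhd> l \<Longrightarrow> card {q \<in> Pt - {p}. q \<lhd> l} = 4"
proof -
  assume l: "l \<in> Ln" "p \<in> Pt" "p \<lhd> l"
  have "{q \<in> Pt - {p}. q \<lhd> l} = {q\<in>Pt. q \<lhd> l} - {p}" by blast
  then show ?thesis using card_points_line[OF l(1)] l finite_Pt by simp
qed

lemma card_lines_point:
  assumes p: "p \<in> Pt"
  shows "card {l\<in>Ln. p \<lhd> l} = 21"
proof -
  have "card (Pt - {p}) * 1 = card {l\<in>Ln. p \<lhd> l} * 4"
  proof (rule count_by_flags[where R = "(\<lhd>)"])
    fix q assume q: "q \<in> Pt - {p}"
    have "{l \<in> {l\<in>Ln. p \<lhd> l}. q \<lhd> l} = {l. l \<in> Ln \<and> p \<lhd> l \<and> q \<lhd> l}" by blast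
    then show "card {l \<in> {l\<in>Ln. p \<lhd> l}. q \<lhd> l} = 1"
      using card_eq_1_ex1[OF join_ex1[of p q]] p q by auto
  qed (use finite_Pt finite_Ln card_points_off p in auto)
  then show ?thesis using card_Pt p by simp
qed

lemma card_pencil:
  assumes p: "p \<in> Pt" and m: "m \<in> Pl" and pm: "p \<lhd> m"
  shows "card {l\<in>Ln. p \<lhd> l \<and> l \<lhd> m} = 5"
proof -
  let ?A = "{q\<in>Pt. q \<lhd> m} - {p}" and ?B = "{l\<in>Ln. p \<lhd> l \<and> l \<lhd> m}"
  have "card ?A * 1 = card ?B * 4"
  proof (rule count_by_flags[where R = "(\<lhd>)"])
    fix q assume q: "q \<in> ?A"
    then have "{l \<in> ?B. q \<lhd> l} = {l. l \<in> Ln \<and> p \<lhd> l \<and> q \<lhd> l}"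
      using line_in_plane[of p q _ m] p m pm by blast
    then show "card {l \<in> ?B. q \<lhd> l} = 1"
      using card_eq_1_ex1[OF join_ex1[of p q]] p q by auto
  next
    fix l assume l: "l \<in> ?B"
    then have "{q \<in> ?A. q \<lhd> l} = {q \<in> Pt - {p}. q \<lhd> l}" using inc_trans m by blast
    then show "card {q \<in> ?A. q \<lhd> l} = 4" using card_points_off l p by simp
  qed (use finite_Pt finite_Ln in auto)
  moreover have "card ?A = 20" using card_points_plane[OF m] finite_Pt p pm by simp
  ultimately show ?thesis by simp
qed

text \<open>The planes on \<open>l\<close> partition the 80 points off \<open>l\<close> into parts
  of 21 - 5 = 16.\<close>

lemma card_planes_line:
  assumes l: "l \<in> Ln"
  shows "card {m\<in>Pl. l \<lhd> m} = 5"
proof -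
  let ?X = "{q\<in>Pt. q \<lhd> l}" and ?B = "{m\<in>Pl. l \<lhd> m}"
  have "card (Pt - ?X) * 1 = card ?B * 16"
  proof (rule count_by_flags[where R = "(\<lhd>)"])
    fix q assume q: "q \<in> Pt - ?X"
    have "{m \<in> ?B. q \<lhd> m} = {m. m \<in> Pl \<and> q \<lhd> m \<and> l \<lhd> m}" by blast
    then show "card {m \<in> ?B. q \<lhd> m} = 1"
      using card_eq_1_ex1[OF span_ex1[of q l]] l q by auto
  next
    fix m assume m: "m \<in> ?B"
    then have sub: "?X \<subseteq> {q\<in>Pt. q \<lhd> m}" using inc_trans l by blast
    have "{q \<in> Pt - ?X. q \<lhd> m} = {q\<in>Pt. q \<lhd> m} - ?X" by blast
    then show "card {q \<in> Pt - ?X. q \<lhd> m} = 16"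
      using card_Diff_subset[OF _ sub] card_points_line[OF l] card_points_plane m finite_Pt by simp
  qed (use finite_Pt finite_Pl in auto)
  moreover have "card (Pt - ?X) = 80"
    using card_Diff_subset[of ?X Pt] card_points_line[OF l] card_Pt finite_Pt by auto
  ultimately show ?thesis by simp
qed

lemma card_planes_point:
  assumes p: "p \<in> Pt"
  shows "card {m\<in>Pl. p \<lhd> m} = 21"
proof -
  let ?A = "{l\<in>Ln. p \<lhd> l}" and ?B = "{m\<in>Pl. p \<lhd> m}"
  have "card ?A * 5 = card ?B * 5"
  proof (rule count_by_flags[where R = "(\<lhd>)"])
    fix l assume l: "l \<in> ?A"
    then have "{m \<in> ?B. l \<lhd> m} = {m\<in>Pl. l \<lhd> m}" using inc_trans p by blast
    then show "card {m \<in> ?B. l \<lhd> m} = 5" using card_planes_line l by simp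
  next
    fix m assume m: "m \<in> ?B"
    have "{l \<in> ?A. l \<lhd> m} = {l\<in>Ln. p \<lhd> l \<and> l \<lhd> m}" by blast
    then show "card {l \<in> ?A. l \<lhd> m} = 5" using card_pencil p m by simp
  qed (use finite_Ln finite_Pl in auto)
  then show ?thesis using card_lines_point[OF p] by simp
qed

lemma card_lines_plane:
  assumes m: "m \<in> Pl"
  shows "card {l\<in>Ln. l \<lhd> m} = 21"
proof -
  let ?A = "{p\<in>Pt. p \<lhd> m}" and ?B = "{l\<in>Ln. l \<lhd> m}"
  have "card ?A * 5 = card ?B * 5"
  proof (rule count_by_flags[where R = "(\<lhd>)"])
    fix p assume p: "p \<in> ?A"
    have "{l \<in> ?B. p \<lhd> l} = {l\<in>Ln. p \<lhd> l \<and> l \<lhd> m}" by blast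
    then show "card {l \<in> ?B. p \<lhd> l} = 5" using card_pencil p m by simp
  next
    fix l assume l: "l \<in> ?B"
    then have "{p \<in> ?A. p \<lhd> l} = {p\<in>Pt. p \<lhd> l}" using inc_trans m by blast
    then show "card {p \<in> ?A. p \<lhd> l} = 5" using card_points_line l by simp
  qed (use finite_Pt finite_Ln in auto)
  then show ?thesis using card_points_plane[OF m] by simp
qed

lemma card_Pl: "card Pl = 85"
proof -
  have "card Pt * 21 = card Pl * 21"
    by (rule count_by_flags[where R = "(\<lhd>)"])
      (use finite_Pt finite_Pl card_planes_point card_points_plane in auto)
  then show ?thesis using card_Pt by simp
qed

lemma pg34: "pg34 Pt Ln Pl (\<lhd>)"
  by (rule pg34.intro) (fact finite_Pt finite_Ln finite_Pl card_Pt card_Pl inc_trans join_ex1 meet_ex1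
      line_in_plane point_on_line span_ex1 trace_ex1 card_points_line card_planes_line
      card_pencil card_lines_point card_lines_plane card_planes_point card_points_plane)+

end

section \<open>Cardinalities, dimensions and incidence of subspaces\<close>

lemma card_span_independent:
  fixes B :: "('a::{field,finite} ^ 'n) set"
  assumes "vec.independent B"
  shows "card (vec.span B) = CARD('a) ^ card B"
proof -
  have "finite B" by simp
  then show ?thesis using assms
  proof (induction B)
    case empty
    then show ?case by simp
  next
    case (insert x B)
    have x: "x \<notin> vec.span B" and B: "vec.independent B"
      using insert.prems insert.hyps by (auto simp: vec.independent_insert)
    \<comment> \<open>Every vector of the larger span is uniquely a multiple of \<open>x\<close>
      plus a vector of the smaller one, so each new basis vector multiplies the cardinality by the
      field size.\<close>
    let ?f = "\<lambda>(k, y). k *s x + y"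
    have "inj_on ?f (UNIV \<times> vec.span B)"
    proof (rule inj_onI, clarify)
      fix k y k' y'
      assume y: "y \<in> vec.span B" "y' \<in> vec.span B" and eq: "k *s x + y = k' *s x + y'"
      have "(k - k') *s x = y' - y" using eq by (simp add: algebra_simps)
      then have d: "(k - k') *s x \<in> vec.span B" using vec.span_diff y by simp
      have "k = k'"
      proof (rule ccontr)
        assume "k \<noteq> k'"
        then have e: "inverse (k - k') * (k - k') = 1" by simp
        then have "inverse (k - k') *s ((k - k') *s x) = x"
          by (simp only: vec.scale_scale e vec.scale_one)
        then show False using vec.span_scale[OF d, of "inverse (k - k')"] x by simp
      qed
      then show "k = k' \<and> y = y'" using eq by simp
    qed
    moreover have "?f ` (UNIV \<times> vec.span B) = vec.span (insert x B)"
    proof (intro equalityI subsetI)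
      fix z assume "z \<in> ?f ` (UNIV \<times> vec.span B)"
      then obtain k y where "z = k *s x + y" "y \<in> vec.span B" by auto
      then have "z - k *s x \<in> vec.span B" by simp
      then show "z \<in> vec.span (insert x B)" by (auto simp: vec.span_breakdown_eq)
    next
      fix z assume "z \<in> vec.span (insert x B)"
      then obtain k where "z - k *s x \<in> vec.span B" by (auto simp: vec.span_breakdown_eq)
      then show "z \<in> ?f ` (UNIV \<times> vec.span B)"
        by (intro image_eqI[where x = "(k, z - k *s x)"]) auto
    qed
    ultimately have "card (vec.span (insert x B)) = card ((UNIV :: 'a set) \<times> vec.span B)"
      by (metis card_image)
    then show ?case using insert.IH[OF B] insert.hyps by simp
  qed
qed

lemma card_subspace:
  fixes S :: "('a::{field,finite} ^ 'n) set"
  assumes "vec.subspace S"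
  shows "card S = CARD('a) ^ vec.dim S"
proof -
  obtain B where B: "B \<subseteq> S" "vec.independent B" "S \<subseteq> vec.span B" "card B = vec.dim S"
    using vec.basis_exists by blast
  then have "vec.span B = S" using vec.span_subspace assms by blast
  then show ?thesis using card_span_independent[OF B(2)] B(4) by simp
qed

lemma dim_join:
  fixes S T :: "('a::{field,finite} ^ 4) set"
  assumes "vec.subspace S" "vec.subspace T"
  shows "vec.dim (join S T) + vec.dim (S \<inter> T) = vec.dim S + vec.dim T"
proof -
  have "join S T = {x + y |x y. x \<in> S \<and> y \<in> T}"
    using assms by (auto simp: join_def vec.span_Un vec.span_eq_iff[THEN iffD2])
  then show ?thesis using vec.dim_sums_Int[OF assms] by simp
qed

lemma subspace_join: "vec.subspace (join S T)"
  unfolding join_def by simp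

lemma join_superset: "S \<subseteq> join S T" "T \<subseteq> join S T"
  unfolding join_def by (meson Un_upper1 Un_upper2 order_trans vec.span_superset)+

lemma join_least: "vec.subspace U \<Longrightarrow> S \<subseteq> U \<Longrightarrow> T \<subseteq> U \<Longrightarrow> join S T \<subseteq> U"
  unfolding join_def by (simp add: vec.span_minimal)

lemma subspace_eq_of_dim:
  fixes S T :: "('a::{field,finite} ^ 4) set"
  shows "vec.subspace S \<Longrightarrow> vec.subspace T \<Longrightarrow> S \<subseteq> T \<Longrightarrow> vec.dim T \<le> vec.dim S \<Longrightarrow> S = T"
  using vec.subspace_dim_equal by blast

lemma dim_le_4:
  fixes S :: "('a::{field,finite} ^ 4) set"
  shows "vec.dim S \<le> 4"
  using vec.dim_subset_UNIV[of S] by (simp add: vec.dimension_def card_cart_basis)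

lemmas pg_defs = pg_points_def pg_lines_def pg_planes_def

lemma zero_Int_of_dim_1:
  fixes S T :: "('a::{field,finite} ^ 4) set"
  assumes "vec.subspace S" "vec.dim S = 1" "vec.subspace T" "\<not> S \<subseteq> T"
  shows "S \<inter> T = {0}"
proof -
  have sub: "vec.subspace (S \<inter> T)" using assms vec.subspace_inter by blast
  have "\<not> 1 \<le> vec.dim (S \<inter> T)"
    using subspace_eq_of_dim[OF sub assms(1)] assms by auto
  then have "vec.dim (S \<inter> T) = 0" by linarith
  then have "S \<inter> T \<subseteq> {0}" by simp
  then show ?thesis using vec.subspace_0[OF sub] by blast
qed

lemma dim_join_point:
  fixes p S :: "('a::{field,finite} ^ 4) set"
  assumes "p \<in> pg_points" "vec.subspace S" "\<not> p \<subseteq> S"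
  shows "vec.dim (join p S) = Suc (vec.dim S)"
  using dim_join[of p S] zero_Int_of_dim_1[of p S] assms by (simp add: pg_points_def)

lemma point_not_subset:
  "p \<in> pg_points \<Longrightarrow> q \<in> pg_points \<Longrightarrow> p \<noteq> q \<Longrightarrow> \<not> p \<subseteq> q"
  using subspace_eq_of_dim[of p q] by (auto simp: pg_points_def)

lemma join_points_line:
  fixes p q :: "('a::{field,finite} ^ 4) set"
  assumes "p \<in> pg_points" "q \<in> pg_points" "p \<noteq> q"
  shows "join p q \<in> pg_lines" "l \<in> pg_lines \<Longrightarrow> p \<subseteq> l \<Longrightarrow> q \<subseteq> l \<Longrightarrow> l = join p q"
proof -
  have d: "vec.dim (join p q) = 2"
    using dim_join_point[OF assms(1), of q] point_not_subset[OF assms] assms by (simp add: pg_points_def)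
  then show "join p q \<in> pg_lines" by (simp add: pg_lines_def subspace_join)
  assume "l \<in> pg_lines" "p \<subseteq> l" "q \<subseteq> l"
  then show "l = join p q"
    using subspace_eq_of_dim[OF subspace_join, of l p q] join_least[of l p q] d
    by (simp add: pg_lines_def)
qed

text \<open>The points in \<open>S\<close> partition its nonzero vectors, each carrying one less
  than the field size of them.\<close>

lemma card_points_in_subspace:
  fixes S :: "('a::{field,finite} ^ 4) set"
  assumes "vec.subspace S"
  shows "card {p\<in>pg_points. p \<subseteq> S} * (CARD('a) - 1) = CARD('a) ^ vec.dim S - 1"
proof -
  let ?A = "{p\<in>pg_points. p \<subseteq> S}"
  have "card (S - {0}) = card (\<Union>p\<in>?A. p - {0})"
  proof (rule arg_cong[where f = card], intro equalityI subsetI)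
    fix v assume v: "v \<in> S - {0}"
    then have "vec.span {v} \<in> pg_points" "vec.span {v} \<subseteq> S" "v \<in> vec.span {v}"
      using vec.span_minimal[of "{v}" S] assms by (auto simp: pg_points_def vec.span_base)
    then show "v \<in> (\<Union>p\<in>?A. p - {0})" using v by blast
  qed auto
  also have "\<dots> = (\<Sum>p\<in>?A. card (p - {0}))"
  proof (rule card_UN_disjoint)
    show "\<forall>p\<in>?A. \<forall>q\<in>?A. p \<noteq> q \<longrightarrow> (p - {0}) \<inter> (q - {0}) = {}"
    proof (intro ballI impI)
      fix p q assume pq: "p \<in> ?A" "q \<in> ?A" "p \<noteq> q"
      then have "p \<inter> q = {0}"
        using zero_Int_of_dim_1[of p q] point_not_subset[of p q] by (auto simp: pg_points_def)
      then show "(p - {0}) \<inter> (q - {0}) = {}" by auto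
    qed
  qed auto
  also have "\<dots> = (\<Sum>p\<in>?A. CARD('a) - 1)"
  proof (rule sum.cong[OF refl])
    fix p assume "p \<in> ?A"
    then show "card (p - {0}) = CARD('a) - 1"
      using card_subspace[of p] vec.subspace_0[of p] by (simp add: pg_points_def)
  qed
  finally show ?thesis
    using card_subspace[OF assms] vec.subspace_0[OF assms] by simp
qed

text \<open>A subspace not inside \<open>m\<close> spans the whole space together with it, and the
  dimension formula gives the rest.\<close>

lemma dim_Int_plane:
  fixes m S :: "('a::{field,finite} ^ 4) set"
  assumes "m \<in> pg_planes" "vec.subspace S" "\<not> S \<subseteq> m"
  shows "Suc (vec.dim (S \<inter> m)) = vec.dim S"
proof -
  have m: "vec.subspace m" "vec.dim m = 3" using assms by (auto simp: pg_planes_def)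
  have "\<not> vec.dim (join S m) \<le> 3"
    using subspace_eq_of_dim[OF m(1) subspace_join, of S m] join_superset[where S = S and T = m] m(2) assms(3)
    by auto
  then have "vec.dim (join S m) = 4" using dim_le_4[of "join S m"] by simp
  then show ?thesis using dim_join[OF assms(2) m(1)] m by simp
qed

lemma planes_meet_line:
  fixes m n :: "('a::{field,finite} ^ 4) set"
  assumes "m \<in> pg_planes" "n \<in> pg_planes" "m \<noteq> n"
  shows "m \<inter> n \<in> pg_lines" "l \<in> pg_lines \<Longrightarrow> l \<subseteq> m \<Longrightarrow> l \<subseteq> n \<Longrightarrow> l = m \<inter> n"
proof -
  have "\<not> m \<subseteq> n" using assms subspace_eq_of_dim[of m n] by (auto simp: pg_planes_def)
  then have d: "vec.dim (m \<inter> n) = 2" "vec.subspace (m \<inter> n)"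
    using dim_Int_plane[of n m] assms by (auto simp: pg_planes_def vec.subspace_inter)
  then show "m \<inter> n \<in> pg_lines" by (simp add: pg_lines_def)
  show "l \<in> pg_lines \<Longrightarrow> l \<subseteq> m \<Longrightarrow> l \<subseteq> n \<Longrightarrow> l = m \<inter> n"
    using subspace_eq_of_dim[of l "m \<inter> n"] d by (simp add: pg_lines_def)
qed

lemma join_point_line_plane:
  fixes p l :: "('a::{field,finite} ^ 4) set"
  assumes "p \<in> pg_points" "l \<in> pg_lines" "\<not> p \<subseteq> l"
  shows "join p l \<in> pg_planes" "m \<in> pg_planes \<Longrightarrow> p \<subseteq> m \<Longrightarrow> l \<subseteq> m \<Longrightarrow> m = join p l"
proof -
  have d: "vec.dim (join p l) = 3"
    using dim_join_point[of p l] assms by (simp add: pg_lines_def)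
  then show "join p l \<in> pg_planes" by (simp add: pg_planes_def subspace_join)
  assume "m \<in> pg_planes" "p \<subseteq> m" "l \<subseteq> m"
  then show "m = join p l"
    using subspace_eq_of_dim[OF subspace_join, of m p l] join_least[of m p l] d
    by (simp add: pg_planes_def)
qed

lemma line_meets_plane:
  fixes l m :: "('a::{field,finite} ^ 4) set"
  assumes "m \<in> pg_planes" "l \<in> pg_lines" "\<not> l \<subseteq> m"
  shows "l \<inter> m \<in> pg_points" "p \<in> pg_points \<Longrightarrow> p \<subseteq> m \<Longrightarrow> p \<subseteq> l \<Longrightarrow> p = l \<inter> m"
proof -
  have d: "vec.dim (l \<inter> m) = 1" "vec.subspace (l \<inter> m)"
    using dim_Int_plane[of m l] assms by (auto simp: pg_defs vec.subspace_inter)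
  then show "l \<inter> m \<in> pg_points" by (simp add: pg_points_def)
  show "p \<in> pg_points \<Longrightarrow> p \<subseteq> m \<Longrightarrow> p \<subseteq> l \<Longrightarrow> p = l \<inter> m"
    using subspace_eq_of_dim[of p "l \<inter> m"] d by (simp add: pg_points_def)
qed

lemma pg34_pg:
  assumes q: "CARD('a::{field,finite}) = 4"
  shows "pg34 (pg_points :: ('a ^ 4) set set) pg_lines pg_planes (\<subseteq>)"
proof (rule incidence34.pg34, unfold_locales)
  have points: "card {p\<in>pg_points. p \<subseteq> S} * 3 = 4 ^ vec.dim S - 1" if "vec.subspace S" for S :: "('a ^ 4) set"
    using card_points_in_subspace[OF that] q by simp
  show "card (pg_points :: ('a ^ 4) set set) = 85"
    using points[of UNIV] by (simp add: vec.dimension_def card_cart_basis)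
  show "card {p\<in>pg_points. p \<subseteq> l} = 5" if "l \<in> pg_lines" for l :: "('a ^ 4) set"
    using points[of l] that by (simp add: pg_lines_def)
  show "card {p\<in>pg_points. p \<subseteq> m} = 21" if "m \<in> pg_planes" for m :: "('a ^ 4) set"
    using points[of m] that by (simp add: pg_planes_def)
  fix p r :: "('a ^ 4) set" assume pr: "p \<in> pg_points" "r \<in> pg_points" "p \<noteq> r"
  show "\<exists>!l. l \<in> pg_lines \<and> p \<subseteq> l \<and> r \<subseteq> l"
    by (rule ex1I[of _ "join p r"])
      (simp add: join_points_line(1)[OF pr] join_superset, simp add: join_points_line(2)[OF pr])
  show "l \<subseteq> m" if "l \<in> pg_lines" "m \<in> pg_planes" "p \<subseteq> l" "r \<subseteq> l" "p \<subseteq> m" "r \<subseteq> m" for l m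
    using join_points_line(2)[OF pr that(1)] join_least[of m p r] that by (simp add: pg_planes_def)
next
  fix m n :: "('a ^ 4) set" assume mn: "m \<in> pg_planes" "n \<in> pg_planes" "m \<noteq> n"
  show "\<exists>!l. l \<in> pg_lines \<and> l \<subseteq> m \<and> l \<subseteq> n"
    by (rule ex1I[of _ "m \<inter> n"])
      (simp add: planes_meet_line(1)[OF mn], simp add: planes_meet_line(2)[OF mn])
  show "p \<subseteq> l" if "l \<in> pg_lines" "p \<in> pg_points" "l \<subseteq> m" "l \<subseteq> n" "p \<subseteq> m" "p \<subseteq> n" for l p
    using planes_meet_line(2)[OF mn that(1)] that by simp
next
  fix p l :: "('a ^ 4) set" assume pl: "p \<in> pg_points" "l \<in> pg_lines" "\<not> p \<subseteq> l"
  show "\<exists>!m. m \<in> pg_planes \<and> p \<subseteq> m \<and> l \<subseteq> m"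
    by (rule ex1I[of _ "join p l"])
      (simp add: join_point_line_plane(1)[OF pl] join_superset, simp add: join_point_line_plane(2)[OF pl])
next
  fix m l :: "('a ^ 4) set" assume ml: "m \<in> pg_planes" "l \<in> pg_lines" "\<not> l \<subseteq> m"
  show "\<exists>!p. p \<in> pg_points \<and> p \<subseteq> m \<and> p \<subseteq> l"
    by (rule ex1I[of _ "l \<inter> m"])
      (simp add: line_meets_plane(1)[OF ml], simp add: line_meets_plane(2)[OF ml])
qed auto

section \<open>Translation to subspaces\<close>

text \<open>A line different from \<open>l\<close> meets it in at most one point, so it is counted
  at most once; \<open>l\<close> is counted at each of its five points.\<close>

lemma (in pg34) sum_deg_line:
  assumes L: "L \<subseteq> Ln" and l: "l \<in> Ln"
  shows "(\<Sum>p | p \<in> Pt \<and> p \<lhd> l. deg (\<lhd>) L p)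
    = int (card {m \<in> L - {l}. \<exists>p\<in>Pt. p \<lhd> m \<and> p \<lhd> l}) + 5 * of_bool (l \<in> L)"
proof -
  let ?X = "{p\<in>Pt. p \<lhd> l}" and ?M = "L - {l}"
  have finX: "finite ?X" and finM: "finite ?M" using finite_Pt finite_Ln L finite_subset by auto
  have "(\<Sum>p\<in>?X. deg (\<lhd>) L p) = (\<Sum>p\<in>?X. int (card {m\<in>?M. p \<lhd> m}) + of_bool (l \<in> L))"
  proof (rule sum.cong[OF refl])
    fix p assume p: "p \<in> ?X"
    show "deg (\<lhd>) L p = int (card {m\<in>?M. p \<lhd> m}) + of_bool (l \<in> L)"
    proof (cases "l \<in> L")
      case True
      then have "{m\<in>L. p \<lhd> m} = insert l {m\<in>?M. p \<lhd> m}" using p by auto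
      moreover have "card (insert l {m\<in>?M. p \<lhd> m}) = Suc (card {m\<in>?M. p \<lhd> m})"
        by (rule card_insert_disjoint) (use finM in auto)
      ultimately show ?thesis using True unfolding deg_def by simp
    next
      case False
      then have "{m\<in>L. p \<lhd> m} = {m\<in>?M. p \<lhd> m}" by blast
      then show ?thesis using False unfolding deg_def by simp
    qed
  qed
  also have "\<dots> = (\<Sum>p\<in>?X. int (card {m\<in>?M. p \<lhd> m})) + 5 * of_bool (l \<in> L)"
    using card_points_line[OF l] by (simp add: sum.distrib)
  also have "(\<Sum>p\<in>?X. int (card {m\<in>?M. p \<lhd> m})) = (\<Sum>m\<in>?M. int (card {p\<in>?X. p \<lhd> m}))"
    by (rule double_count[OF finX finM])
  also have "\<dots> = (\<Sum>m\<in>?M. of_bool (\<exists>p\<in>Pt. p \<lhd> m \<and> p \<lhd> l))"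
  proof (rule sum.cong[OF refl])
    fix m assume m: "m \<in> ?M"
    show "int (card {p\<in>?X. p \<lhd> m}) = of_bool (\<exists>p\<in>Pt. p \<lhd> m \<and> p \<lhd> l)"
    proof (cases "\<exists>p\<in>Pt. p \<lhd> m \<and> p \<lhd> l")
      case True
      then obtain p where p: "p \<in> Pt" "p \<lhd> m" "p \<lhd> l" by blast
      have "{q\<in>?X. q \<lhd> m} = {p}"
        using lines_common_point_le[of l m _ p] p l m L by blast
      then show ?thesis using True by simp
    next
      case False
      then have "{p\<in>?X. p \<lhd> m} = {}" by blast
      then show ?thesis using False by (simp only: card.empty) simp
    qed
  qed
  also have "\<dots> = int (card {m\<in>?M. \<exists>p\<in>Pt. p \<lhd> m \<and> p \<lhd> l})"
    by (rule sum_of_bool_card[OF finM])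
  finally show ?thesis .
qed

lemma cameron_liebler_iff:
  fixes L :: "('a::{field,finite} ^ 4) set set"
  assumes q: "CARD('a) = 4"
  shows "cameron_liebler L 7 \<longleftrightarrow> cl34 pg_points pg_lines pg_planes (\<subseteq>) L"
proof -
  interpret pg34 "pg_points :: ('a ^ 4) set set" pg_lines pg_planes "(\<subseteq>)"
    by (rule pg34_pg[OF q])
  have deg_sum: "(\<Sum>p | p \<in> pg_points \<and> p \<subseteq> l. deg (\<subseteq>) L p)
      = int (card {m \<in> L - {l}. meets m l}) + 5 * of_bool (l \<in> L)" if "L \<subseteq> pg_lines" "l \<in> pg_lines" for l
    using sum_deg_line[OF that] by (simp add: meets_def)
  have eq: "(int CARD('a) + 1) * 7 + ((int CARD('a))\<^sup>2 - 1) * indicator L l = 35 + 15 * of_bool (l \<in> L)" for l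
    unfolding q by (simp add: indicator_def)
  show ?thesis
  proof
    assume "cameron_liebler L 7"
    then have sub: "L \<subseteq> pg_lines"
      and cl: "\<And>l. l \<in> pg_lines \<Longrightarrow> int (card {m \<in> L - {l}. meets m l}) = 35 + 15 * of_bool (l \<in> L)"
      unfolding cameron_liebler_def eq by blast+
    show "cl34 pg_points pg_lines pg_planes (\<subseteq>) L"
    proof unfold_locales
      fix l :: "('a ^ 4) set" assume l: "l \<in> pg_lines"
      show "(\<Sum>p | p \<in> pg_points \<and> p \<subseteq> l. deg (\<subseteq>) L p) = 35 + 20 * of_bool (l \<in> L)"
        using deg_sum[OF sub l] cl[OF l] by simp
    qed (rule sub)
  next
    assume "cl34 pg_points pg_lines pg_planes (\<subseteq>) L"
    then interpret cl34 pg_points pg_lines pg_planes "(\<subseteq>)" L .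
    show "cameron_liebler L 7"
      unfolding cameron_liebler_def eq
    proof (intro conjI ballI)
      fix l :: "('a ^ 4) set" assume l: "l \<in> pg_lines"
      show "int (card {m \<in> L - {l}. meets m l}) = 35 + 15 * of_bool (l \<in> L)"
        using line_sum_deg[OF l] deg_sum[OF L_subset l] by simp
    qed (rule L_subset)
  qed
qed

lemma oval34_pg_iff:
  fixes P \<pi> :: "('a::{field,finite} ^ 4) set"
  assumes q: "CARD('a) = 4"
  shows "oval34 pg_points pg_lines pg_planes (\<subseteq>) P \<pi> H
    \<longleftrightarrow> P \<in> pg_points \<and> \<pi> \<in> pg_planes \<and> \<not> P \<subseteq> \<pi> \<and> hyperoval_in H \<pi>"
proof -
  have fin: "finite H" for H :: "('a ^ 4) set set" by simp
  have arc: "(\<forall>l\<in>pg_lines. card {R\<in>H. R \<subseteq> l} \<le> 2) \<longleftrightarrow>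
      (\<forall>p\<in>H. \<forall>r\<in>H. \<forall>s\<in>H. p \<noteq> r \<and> p \<noteq> s \<and> r \<noteq> s \<longrightarrow> \<not> collinear_points p r s)"
  proof (intro iffI ballI impI notI)
    fix p r s assume arc: "\<forall>l\<in>pg_lines. card {R\<in>H. R \<subseteq> l} \<le> 2" and "p \<in> H" "r \<in> H" "s \<in> H"
      and d: "p \<noteq> r \<and> p \<noteq> s \<and> r \<noteq> s" and "collinear_points p r s"
    then obtain l where l: "l \<in> pg_lines" "{p, r, s} \<subseteq> {R\<in>H. R \<subseteq> l}"
      unfolding collinear_points_def by blast
    have "card {p, r, s} \<le> 2"
      using card_mono[OF _ l(2)] arc l(1) fin le_trans by fastforce
    then show False using d by simp
  next
    fix l :: "('a ^ 4) set"
    assume nc: "\<forall>p\<in>H. \<forall>r\<in>H. \<forall>s\<in>H. p \<noteq> r \<and> p \<noteq> s \<and> r \<noteq> s \<longrightarrow> \<not> collinear_points p r s"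
      and l: "l \<in> pg_lines"
    show "card {R\<in>H. R \<subseteq> l} \<le> 2"
    proof (rule ccontr)
      assume "\<not> card {R\<in>H. R \<subseteq> l} \<le> 2"
      then obtain T where T: "T \<subseteq> {R\<in>H. R \<subseteq> l}" "card T = 3"
        using obtain_subset_with_card_n[of 3 "{R\<in>H. R \<subseteq> l}"] by auto
      then obtain p r s where prs: "T = {p, r, s}" "p \<noteq> r" "p \<noteq> s" "r \<noteq> s"
        by (auto simp: card_3_iff)
      have mem: "p \<in> H" "r \<in> H" "s \<in> H" "p \<subseteq> l" "r \<subseteq> l" "s \<subseteq> l"
        using T(1)[unfolded prs(1)] by simp_all
      then have "collinear_points p r s" unfolding collinear_points_def using l by blast
      then show False using nc mem(1-3) prs(2-4) by blast
    qed
  qed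
  show ?thesis
    unfolding oval34_def oval34_axioms_def hyperoval_in_def arc[symmetric] q
    using pg34_pg[OF q] by auto
qed

lemma cls_eq_hyperoval_line_class:
  fixes P \<pi> :: "('a::{field,finite} ^ 4) set"
  assumes q: "CARD('a) = 4" and ov: "oval34 pg_points pg_lines pg_planes (\<subseteq>) P \<pi> H"
  shows "oval34.cls pg_points pg_lines (\<subseteq>) P \<pi> H = hyperoval_line_class P \<pi> H"
proof -
  interpret oval34 pg_points pg_lines pg_planes "(\<subseteq>)" P \<pi> H by (rule ov)
  have C: "cone P H = C"
  proof (intro equalityI subsetI)
    fix l assume "l \<in> cone P H"
    then obtain R where R: "R \<in> H" "l = join P R" unfolding cone_def by blast
    then have "P \<noteq> R" using P_notin_H by blast
    then show "l \<in> C"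
      unfolding C_def using join_points_line(1)[OF P _ \<open>P \<noteq> R\<close>] join_superset[where S = P and T = R] R H_sub
      by blast
  next
    fix l assume "l \<in> C"
    then obtain R where R: "R \<in> H" "R \<subseteq> l" "P \<subseteq> l" "l \<in> pg_lines" unfolding C_def by blast
    then have "P \<noteq> R" using P_notin_H by blast
    then have "l = join P R" using join_points_line(2)[OF P _ \<open>P \<noteq> R\<close> R(4)] R H_sub by blast
    then show "l \<in> cone P H" unfolding cone_def using R by blast
  qed
  have "{k\<in>C. \<exists>x\<in>pg_points. x \<subseteq> k \<and> x \<subseteq> l} = {k\<in>C. meets l k}" for l
    unfolding meets_def by blast
  then show ?thesis
    unfolding cls_def hyperoval_line_class_def C by simp
qed

section \<open>Hyperovals and frames\<close>

lemma field4_elements: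
  assumes "CARD('a::{field,finite}) = 4"
  obtains \<omega> \<omega>' :: "'a::{field,finite}" where "UNIV = {0, 1, \<omega>, \<omega>'}" "\<omega> \<noteq> 0" "\<omega> \<noteq> 1" "\<omega>' \<noteq> 0" "\<omega>' \<noteq> 1" "\<omega> \<noteq> \<omega>'"
proof -
  have "card (UNIV - {0, 1 :: 'a}) = 2"
    using assms card_Diff_subset[of "{0, 1 :: 'a}" UNIV] by simp
  then obtain \<omega> \<omega>' where w: "UNIV - {0, 1 :: 'a} = {\<omega>, \<omega>'}" "\<omega> \<noteq> \<omega>'"
    unfolding card_2_iff by blast
  then have "UNIV = {0, 1, \<omega>, \<omega>'}" by blast
  moreover have "\<omega> \<noteq> 0" "\<omega> \<noteq> 1" "\<omega>' \<noteq> 0" "\<omega>' \<noteq> 1" using w by blast+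
  ultimately show ?thesis using that w(2) by blast
qed

text \<open>Translation by 1 permutes the field, so comparing the sums of all elements shows that 4
  = (1 + 1)^2 is zero in it.\<close>

lemma field4_two_eq_0:
  assumes "CARD('a::{field,finite}) = 4"
  shows "(1 :: 'a::{field,finite}) + 1 = 0"
proof -
  have 0: "(\<Sum>x\<in>UNIV. x + 1) = (\<Sum>x\<in>UNIV. x :: 'a)"
  proof (rule sum.reindex_bij_betw[where g = "\<lambda>x. x" and h = "\<lambda>x. x + 1"])
    show "bij_betw (\<lambda>x :: 'a. x + 1) UNIV UNIV"
      by (rule bij_betw_byWitness[where f' = "\<lambda>x. x - 1"]) auto
  qed
  then have "of_nat (CARD('a)) = (0 :: 'a)" by (simp add: sum.distrib)
  moreover have "((1 :: 'a) + 1) * (1 + 1) = of_nat (CARD('a))" unfolding assms by simp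
  ultimately show ?thesis by (simp only: mult_eq_0_iff) blast
qed

lemma span_singleton_scale:
  fixes x :: "'a::{field,finite} ^ 4"
  assumes "c \<noteq> 0"
  shows "vec.span {c *s x} = vec.span {x}"
  using assms vec.span_image_scale[of "{x}" "\<lambda>_. c"] by simp

lemma comb_in_span:
  fixes x y :: "'a::{field,finite} ^ 4"
  shows "k *s x + j *s y \<in> vec.span {x, y}"
  by (intro vec.span_add vec.span_scale vec.span_base) auto

lemma span_singleton_subset:
  fixes x :: "'a::{field,finite} ^ 4"
  assumes "vec.subspace S"
  shows "vec.span {x} \<subseteq> S \<longleftrightarrow> x \<in> S"
  using vec.span_minimal[of "{x}" S] vec.span_base[of x "{x}"] assms by blast

lemma pg_points_span:
  fixes x :: "'a::{field,finite} ^ 4"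
  shows "vec.span {x} \<in> pg_points \<longleftrightarrow> x \<noteq> 0"
  by (simp add: pg_points_def)

lemma obtain_representative:
  fixes p :: "('a::{field,finite} ^ 4) set"
  assumes "p \<in> pg_points"
  obtains x where "p = vec.span {x}" "x \<noteq> 0"
proof -
  have p: "vec.subspace p" "vec.dim p = 1" using assms by (auto simp: pg_points_def)
  obtain B where B: "B \<subseteq> p" "vec.independent B" "p \<subseteq> vec.span B" "card B = vec.dim p"
    using vec.basis_exists by blast
  then obtain x where "B = {x}" using p by (auto simp: card_1_singleton_iff)
  then show ?thesis using that[of x] B vec.span_subspace[OF B(1,3) p(1)] by auto
qed

text \<open>For independent vectors and \<open>\<omega>\<close>, \<open>\<omega>'\<close> the field
  elements other than 0 and 1, this is the only hyperoval containing the frame \<open>u\<close>,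
  \<open>v\<close>, \<open>w\<close>, \<open>u + v + w\<close>: the six lines joining frame points
  cover 19 of the 21 points of the plane, and the last two listed are the uncovered ones.\<close>

definition frame_oval ::
    "'a::{field,finite} \<Rightarrow> 'a \<Rightarrow> 'a ^ 4 \<Rightarrow> 'a ^ 4 \<Rightarrow> 'a ^ 4 \<Rightarrow> ('a ^ 4) set set" where
  "frame_oval \<omega> \<omega>' u v w = (\<lambda>x. vec.span {x}) `
    {u, v, w, u + v + w, u + \<omega> *s v + \<omega>' *s w, u + \<omega>' *s v + \<omega> *s w}"

lemma hyperoval_span_triple:
  fixes \<pi> :: "('a::{field,finite} ^ 4) set"
  assumes H: "hyperoval_in H \<pi>" and mem: "vec.span {x} \<in> H" "vec.span {y} \<in> H" "vec.span {z} \<in> H"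
    and d: "vec.span {x} \<noteq> vec.span {y}" "vec.span {x} \<noteq> vec.span {z}" "vec.span {y} \<noteq> vec.span {z}"
  shows "z \<notin> vec.span {x, y}"
proof
  assume z: "z \<in> vec.span {x, y}"
  have pt: "vec.span {x} \<in> pg_points" "vec.span {y} \<in> pg_points"
    using H mem unfolding hyperoval_in_def by blast+
  have "join (vec.span {x}) (vec.span {y}) = vec.span {x, y}"
    unfolding join_def
  proof (intro equalityI vec.span_minimal vec.subspace_span)
    show "vec.span {x} \<union> vec.span {y} \<subseteq> vec.span {x, y}"
      by (intro Un_least vec.span_mono) auto
    show "{x, y} \<subseteq> vec.span (vec.span {x} \<union> vec.span {y})"
      by (simp add: vec.span_base)
  qed
  then have l: "vec.span {x, y} \<in> pg_lines" using join_points_line(1)[OF pt d(1)] by simp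
  have "collinear_points (vec.span {x}) (vec.span {y}) (vec.span {z})"
    unfolding collinear_points_def
    by (rule bexI[OF _ l]) (simp add: span_singleton_subset z vec.span_base)
  then show False using H mem d unfolding hyperoval_in_def by blast
qed

lemma hyperoval_independent:
  fixes \<pi> :: "('a::{field,finite} ^ 4) set"
  assumes H: "hyperoval_in H \<pi>" and mem: "vec.span {x} \<in> H" "vec.span {y} \<in> H" "vec.span {z} \<in> H"
    and d: "vec.span {x} \<noteq> vec.span {y}" "vec.span {x} \<noteq> vec.span {z}" "vec.span {y} \<noteq> vec.span {z}"
    and \<pi>: "\<pi> \<in> pg_planes"
  shows "vec.independent {x, y, z}" "vec.span {x, y, z} = \<pi>"
proof -
  have "vec.span {z} \<in> pg_points" using H mem(3) unfolding hyperoval_in_def by blast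
  then have "z \<noteq> 0" by (simp add: pg_points_span)
  moreover have x: "x \<notin> vec.span {y, z}" using hyperoval_span_triple[OF H mem(2,3,1)] d by metis
  moreover have "y \<notin> vec.span {z, x}" using hyperoval_span_triple[OF H mem(3,1,2)] d by metis
  then have "y \<notin> vec.span {z}" using vec.span_mono[of "{z}" "{z, x}"] by blast
  moreover have d': "x \<noteq> y" "x \<noteq> z" "y \<noteq> z" using d by auto
  ultimately show ind: "vec.independent {x, y, z}" by (simp add: vec.independent_insert)
  have "vec.subspace \<pi>" using \<pi> by (simp add: pg_planes_def)
  moreover have "vec.span {x} \<subseteq> \<pi>" "vec.span {y} \<subseteq> \<pi>" "vec.span {z} \<subseteq> \<pi>"
    using mem H unfolding hyperoval_in_def by blast+
  ultimately have "x \<in> \<pi>" "y \<in> \<pi>" "z \<in> \<pi>" by (simp_all only: span_singleton_subset)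
  then have "vec.span {x, y, z} \<subseteq> \<pi>"
    using \<pi> by (intro vec.span_minimal) (auto simp: pg_planes_def)
  moreover have "vec.dim (vec.span {x, y, z}) = 3"
    using vec.dim_span_eq_card_independent[OF ind] d' by simp
  ultimately show "vec.span {x, y, z} = \<pi>"
    using \<pi> by (intro subspace_eq_of_dim) (auto simp: pg_planes_def)
qed

lemma span3_explicit:
  fixes x y z t :: "'a::{field,finite} ^ 4"
  assumes "t \<in> vec.span {x, y, z}"
  obtains a b c where "t = a *s x + b *s y + c *s z"
proof -
  obtain a where "t - a *s x \<in> vec.span {y, z}" using assms vec.span_breakdown_eq by blast
  then obtain b where "t - a *s x - b *s y \<in> vec.span {z}" using vec.span_breakdown_eq by blast
  then obtain c where "t - a *s x - b *s y - c *s z \<in> vec.span {}" using vec.span_breakdown_eq by blast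
  then have "t - a *s x - b *s y - c *s z = 0" by simp
  then have "t = a *s x + b *s y + c *s z" by (simp add: algebra_simps)
  then show ?thesis by (rule that)
qed

lemma hyperoval_frame:
  fixes \<pi> :: "('a::{field,finite} ^ 4) set"
  assumes q: "CARD('a) = 4" and H: "hyperoval_in H \<pi>" and \<pi>: "\<pi> \<in> pg_planes"
    and \<omega>: "UNIV = {0, 1, \<omega>, \<omega>' :: 'a}"
  obtains u v w where "vec.independent {u, v, w}" "u \<noteq> v" "u \<noteq> w" "v \<noteq> w" "vec.span {u, v, w} = \<pi>"
    "H = frame_oval \<omega> \<omega>' u v w"
proof -
  have card_H: "card H = 6" using H q unfolding hyperoval_in_def by simp
  have H_pt: "p \<in> pg_points" "p \<subseteq> \<pi>" if "p \<in> H" for p using H that unfolding hyperoval_in_def by blast+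
  obtain T where T: "T \<subseteq> H" "card T = 4" using obtain_subset_with_card_n[of 4 H] card_H by auto
  then obtain p4 T3 where T3: "T = insert p4 T3" "p4 \<notin> T3" "card T3 = 3"
    by (metis card_Suc_eq eval_nat_numeral(2) semiring_norm(26,27) numeral_3_eq_3)
  then obtain p1 p2 p3 where p: "T3 = {p1, p2, p3}" "p1 \<noteq> p2" "p1 \<noteq> p3" "p2 \<noteq> p3"
    by (auto simp: card_3_iff)
  have pH: "p1 \<in> H" "p2 \<in> H" "p3 \<in> H" "p4 \<in> H" and p4: "p4 \<noteq> p1" "p4 \<noteq> p2" "p4 \<noteq> p3"
    using T T3 p by auto
  obtain u0 where u0: "p1 = vec.span {u0}" using obtain_representative H_pt pH by metis
  obtain v0 where v0: "p2 = vec.span {v0}" using obtain_representative H_pt pH by metis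
  obtain w0 where w0: "p3 = vec.span {w0}" using obtain_representative H_pt pH by metis
  obtain e where e: "p4 = vec.span {e}" using obtain_representative H_pt pH by metis
  note triple = hyperoval_span_triple[OF H]
  have "vec.span {u0, v0, w0} = \<pi>"
    using hyperoval_independent(2)[OF H _ _ _ _ _ _ \<pi>, of u0 v0 w0] pH p u0 v0 w0 by simp
  moreover have "e \<in> \<pi>" using H_pt(2)[OF pH(4)] e vec.span_base by blast
  ultimately obtain a b c where abc: "e = a *s u0 + b *s v0 + c *s w0"
    using span3_explicit by metis
  have a: "a \<noteq> 0"
  proof
    assume "a = 0"
    then have "e \<in> vec.span {v0, w0}" using abc comb_in_span[of b v0 c w0] by simp
    then show False using triple[of v0 w0 e] pH p p4 u0 v0 w0 e by simp
  qed
  have b: "b \<noteq> 0"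
  proof
    assume "b = 0"
    then have "e \<in> vec.span {u0, w0}" using abc comb_in_span[of a u0 c w0] by simp
    then show False using triple[of u0 w0 e] pH p p4 u0 v0 w0 e by simp
  qed
  have c: "c \<noteq> 0"
  proof
    assume "c = 0"
    then have "e \<in> vec.span {u0, v0}" using abc comb_in_span[of a u0 b v0] by simp
    then show False using triple[of u0 v0 e] pH p p4 u0 v0 w0 e by simp
  qed
  \<comment> \<open>Rescaling the representatives turns the fourth point into the unit point of the
    frame.\<close>
  define u v w where "u = a *s u0" and "v = b *s v0" and "w = c *s w0"
  have P: "p1 = vec.span {u}" "p2 = vec.span {v}" "p3 = vec.span {w}" "p4 = vec.span {u + v + w}"
    using u0 v0 w0 e abc span_singleton_scale a b c unfolding u_def v_def w_def by auto
  have ind: "vec.independent {u, v, w}" and span: "vec.span {u, v, w} = \<pi>"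
    using hyperoval_independent[OF H _ _ _ _ _ _ \<pi>, of u v w] pH p P by simp_all
  have ne: "u \<noteq> v" "u \<noteq> w" "v \<noteq> w" using p P by auto
  have "r \<in> frame_oval \<omega> \<omega>' u v w" if r: "r \<in> H" for r
  proof (cases "r \<in> {p1, p2, p3, p4}")
    case True
    then show ?thesis using P unfolding frame_oval_def by auto
  next
    case False
    obtain t where t: "r = vec.span {t}" using obtain_representative H_pt r by metis
    have "t \<in> \<pi>" using H_pt(2)[OF r] t vec.span_base by blast
    then obtain x y z where xyz: "t = x *s u + y *s v + z *s w" using span span3_explicit by metis
    \<comment> \<open>A further point of the hyperoval lies on none of the lines joining two of the
      four frame points.\<close>
    have out: "t \<notin> vec.span {g, h}" if "vec.span {g} \<in> {p1, p2, p3, p4}" "vec.span {h} \<in> {p1, p2, p3, p4}"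
      "vec.span {g} \<noteq> vec.span {h}" for g h
    proof -
      have gh: "vec.span {g} \<in> H" "vec.span {h} \<in> H" using that(1,2) pH by (metis insertE singletonD)+
      have "vec.span {g} \<noteq> vec.span {t}" "vec.span {h} \<noteq> vec.span {t}"
        using that(1,2) False unfolding t by metis+
      then show ?thesis using triple[OF gh r[unfolded t] that(3)] by blast
    qed
    have "x \<noteq> 0" using out[of v w] comb_in_span[of y v z w] xyz P p by auto
    moreover have "y \<noteq> 0" using out[of u w] comb_in_span[of x u z w] xyz P p by auto
    moreover have "z \<noteq> 0" using out[of u v] comb_in_span[of x u y v] xyz P p by auto
    moreover have "x \<noteq> y"
    proof
      assume "x = y"
      then have "t = x *s (u + v + w) + (z - x) *s w" using xyz by (simp add: algebra_simps)
      then show False using out[of "u + v + w" w] comb_in_span[of x "u + v + w" "z - x" w] P p4 by auto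
    qed
    moreover have "x \<noteq> z"
    proof
      assume "x = z"
      then have "t = x *s (u + v + w) + (y - x) *s v" using xyz by (simp add: algebra_simps)
      then show False using out[of "u + v + w" v] comb_in_span[of x "u + v + w" "y - x" v] P p4 by auto
    qed
    moreover have "y \<noteq> z"
    proof
      assume "y = z"
      then have "t = y *s (u + v + w) + (x - y) *s u" using xyz by (simp add: algebra_simps)
      then show False using out[of "u + v + w" u] comb_in_span[of y "u + v + w" "x - y" u] P p4 by auto
    qed
    \<comment> \<open>Avoiding the sides of the triangle makes the coordinates nonzero, and avoiding
      the lines to the unit point makes them distinct. So \<open>y / x\<close> and
      \<open>z / x\<close> are the two field elements besides 0 and 1, in some order.\<close>
    ultimately have n: "y / x \<noteq> 0" "y / x \<noteq> 1" "z / x \<noteq> 0" "z / x \<noteq> 1" "y / x \<noteq> z / x" "x \<noteq> 0"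
      by auto
    then have coeffs: "(y / x = \<omega> \<and> z / x = \<omega>') \<or> (y / x = \<omega>' \<and> z / x = \<omega>)"
      using \<omega> by (metis UNIV_I insertE singletonD)
    have "t = x *s (u + (y / x) *s v + (z / x) *s w)"
      using n(6) xyz by (simp add: vec.scale_right_distrib)
    then have "r = vec.span {u + (y / x) *s v + (z / x) *s w}"
      unfolding t by (simp only: span_singleton_scale[OF n(6)])
    then show ?thesis using coeffs unfolding frame_oval_def by auto
  qed
  then have "H \<subseteq> frame_oval \<omega> \<omega>' u v w" by blast
  moreover have "card (frame_oval \<omega> \<omega>' u v w) \<le> 6"
    unfolding frame_oval_def
    by (rule order_trans[OF card_image_le]) (auto intro!: card_insert_le_m1)
  ultimately have "H = frame_oval \<omega> \<omega>' u v w"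
    using card_H by (intro card_seteq) auto
  then show ?thesis using that ind ne span by blast
qed

section \<open>Existence and uniqueness\<close>

definition coord_vec :: "'a::zero \<Rightarrow> 'a \<Rightarrow> 'a \<Rightarrow> 'a \<Rightarrow> 'a ^ 4" where
  "coord_vec a b c d = (\<chi> i. if i = 1 then a else if i = 2 then b else if i = 3 then c else d)"

lemma coord_vec_nth [simp]:
  "coord_vec a b c d $ 1 = a" "coord_vec a b c d $ 2 = b" "coord_vec a b c d $ 3 = c" "coord_vec a b c d $ 4 = d"
  by (simp_all add: coord_vec_def)

lemma coord_vec_eq_iff:
  "coord_vec a b c d = coord_vec a' b' c' d' \<longleftrightarrow> a = a' \<and> b = b' \<and> c = c' \<and> d = d'"
  by (auto simp: vec_eq_iff forall_4)

text \<open>The determinant of the first three coordinates; the hyperoval is placed in the plane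
  where the fourth coordinate is 0.\<close>

definition det3 :: "'a::comm_ring_1 ^ 4 \<Rightarrow> 'a ^ 4 \<Rightarrow> 'a ^ 4 \<Rightarrow> 'a" where
  "det3 u v w = u$1 * (v$2 * w$3 - v$3 * w$2) - u$2 * (v$1 * w$3 - v$3 * w$1) + u$3 * (v$1 * w$2 - v$2 * w$1)"

text \<open>Expansion by cofactors writes each coefficient times the determinant as a combination of
  the coordinates of the dependency, all of which vanish.\<close>

lemma det3_dependent:
  fixes u v w :: "'a::field ^ 4"
  assumes dep: "a *s u + b *s v + c *s w = 0" and nz: "a \<noteq> 0 \<or> b \<noteq> 0 \<or> c \<noteq> 0"
  shows "det3 u v w = 0"
proof -
  have e: "a * u$i + b * v$i + c * w$i = 0" for i
    using dep by (simp add: vec_eq_iff)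
  have "a * det3 u v w = (a * u$1 + b * v$1 + c * w$1) * (v$2 * w$3 - v$3 * w$2)
      - (a * u$2 + b * v$2 + c * w$2) * (v$1 * w$3 - v$3 * w$1)
      + (a * u$3 + b * v$3 + c * w$3) * (v$1 * w$2 - v$2 * w$1)"
    unfolding det3_def by (simp add: algebra_simps)
  moreover have "b * det3 u v w = (a * u$1 + b * v$1 + c * w$1) * (u$3 * w$2 - u$2 * w$3)
      + (a * u$2 + b * v$2 + c * w$2) * (u$1 * w$3 - u$3 * w$1)
      + (a * u$3 + b * v$3 + c * w$3) * (u$2 * w$1 - u$1 * w$2)"
    unfolding det3_def by (simp add: algebra_simps)
  moreover have "c * det3 u v w = (a * u$1 + b * v$1 + c * w$1) * (u$2 * v$3 - u$3 * v$2)
      + (a * u$2 + b * v$2 + c * w$2) * (u$3 * v$1 - u$1 * v$3)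
      + (a * u$3 + b * v$3 + c * w$3) * (u$1 * v$2 - u$2 * v$1)"
    unfolding det3_def by (simp add: algebra_simps)
  ultimately show ?thesis using nz unfolding e by auto
qed

lemma det3_line:
  fixes u v w :: "'a::{field,finite} ^ 4"
  assumes l: "l \<in> pg_lines" and mem: "u \<in> l" "v \<in> l" "w \<in> l"
  shows "det3 u v w = 0"
proof (cases "u = v \<or> u = w \<or> v = w")
  case True
  then show ?thesis unfolding det3_def by (auto simp: algebra_simps)
next
  case False
  have "\<not> vec.independent {u, v, w}"
    using vec.independent_card_le_dim[of "{u, v, w}" l] mem l False by (auto simp: pg_lines_def)
  then obtain c where c: "\<exists>x\<in>{u, v, w}. c x \<noteq> 0" "(\<Sum>x\<in>{u, v, w}. c x *s x) = 0"
    using vec.dependent_finite[of "{u, v, w}"] by auto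
  then show ?thesis
    using False by (intro det3_dependent[of "c u" u "c v" v "c w" w]) (auto simp: add.assoc)
qed

lemma exists_hyperoval:
  assumes q: "CARD('a::{field,finite}) = 4"
  shows "\<exists>(P :: ('a ^ 4) set) \<pi> H. P \<in> pg_points \<and> \<pi> \<in> pg_planes \<and> \<not> P \<subseteq> \<pi> \<and> hyperoval_in H \<pi>"
proof -
  \<comment> \<open>The hyperoval is a conic with its nucleus: \<open>?c t\<close> runs through the
    affine points of the conic, \<open>?m\<close> is its point at infinity and \<open>?n\<close> is
    the nucleus.\<close>
  let ?c = "\<lambda>t :: 'a. coord_vec 1 t (t * t) 0"
  let ?n = "coord_vec 0 1 0 0 :: 'a ^ 4" and ?m = "coord_vec 0 0 1 0 :: 'a ^ 4"
  define V where "V = insert ?n (insert ?m (range ?c))"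
  define \<pi> where "\<pi> = {x :: 'a ^ 4. x$4 = 0}"
  define H where "H = (\<lambda>x. vec.span {x}) ` V"
  define P where "P = vec.span {coord_vec 0 0 0 1 :: 'a ^ 4}"
  \<comment> \<open>Squaring is injective in characteristic 2, which handles the triples that
    contain the nucleus and two affine points.\<close>
  have sq: "t * t = r * r \<Longrightarrow> t = r" for t r :: 'a
  proof -
    assume "t * t = r * r"
    then have "(t - r) * (t + r) = 0" by (simp add: algebra_simps)
    moreover have "- r = r" using field4_two_eq_0[OF q] by (metis add_eq_0_iff distrib_left mult_1_right mult_zero_right)
    ultimately show "t = r" by (auto simp: eq_neg_iff_add_eq_0 add_eq_0_iff)
  qed
  have det: "det3 u v w \<noteq> 0" if uvw: "u \<in> V" "v \<in> V" "w \<in> V" "u \<noteq> v" "u \<noteq> w" "v \<noteq> w" for u v w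
  proof -
    \<comment> \<open>Three affine points of the conic give a Vandermonde determinant.\<close>
    have vdm: "det3 (?c r) (?c s) (?c t) = (s - r) * (t - r) * (t - s)" for r s t
      unfolding det3_def by (simp add: algebra_simps)
    have "u = ?n \<or> u = ?m \<or> (\<exists>r. u = ?c r)" "v = ?n \<or> v = ?m \<or> (\<exists>s. v = ?c s)"
      "w = ?n \<or> w = ?m \<or> (\<exists>t. w = ?c t)"
      using uvw(1-3) unfolding V_def by auto
    then show ?thesis
      using uvw(4-6) by (elim disjE exE) (auto simp: vdm, auto simp: det3_def dest: sq)
  qed
  have cardV: "card V = 6"
  proof -
    have "card (range ?c) = 4" using q by (subst card_image) (auto intro!: injI simp: coord_vec_eq_iff)
    then show ?thesis unfolding V_def by (auto simp: coord_vec_eq_iff card_insert_if)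
  qed
  have fin: "finite V" by simp
  have inj: "inj_on (\<lambda>x. vec.span {x}) V"
  proof (rule inj_onI, rule ccontr)
    fix u v assume uv: "u \<in> V" "v \<in> V" "vec.span {u} = vec.span {v}" "u \<noteq> v"
    \<comment> \<open>A third vector is needed to refute the proportionality of \<open>u\<close> and
      \<open>v\<close> by a determinant.\<close>
    have "\<not> V \<subseteq> {u, v}" using cardV card_mono[of "{u, v}" V] by (auto simp: card_insert_if split: if_splits)
    then obtain w where w: "w \<in> V" "u \<noteq> w" "v \<noteq> w" by blast
    have "v \<in> vec.span {u}" using uv(3) by (simp add: vec.span_base)
    then obtain k where "v = k *s u" by (auto simp: vec.span_singleton)
    then have "k *s u + (- 1) *s v + 0 *s w = 0" by (simp add: vec_eq_iff)
    then have "det3 u v w = 0" by (rule det3_dependent) simp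
    then show False using det uv w by blast
  qed
  have \<pi>: "\<pi> \<in> pg_planes"
  proof -
    have eq: "\<pi> = {x :: 'a ^ 4. \<forall>i. i \<notin> {1, 2, 3} \<longrightarrow> x$i = 0}"
      unfolding \<pi>_def by (auto simp: forall_4)
    have "vec.subspace \<pi>" unfolding \<pi>_def by (simp add: vec.subspace_def)
    moreover have "vec.dim \<pi> = 3" unfolding eq dim_substandard_cart by simp
    ultimately show ?thesis by (simp add: pg_planes_def)
  qed
  then have sub: "vec.subspace \<pi>" by (simp add: pg_planes_def)
  have V\<pi>: "x \<in> \<pi> \<and> x \<noteq> 0" if "x \<in> V" for x
    using that unfolding V_def \<pi>_def by (auto simp: vec_eq_iff forall_4)
  have "hyperoval_in H \<pi>"
    unfolding hyperoval_in_def
  proof (intro conjI ballI impI)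
    show "H \<subseteq> {p \<in> pg_points. p \<subseteq> \<pi>}"
      using V\<pi> unfolding H_def by (simp add: image_subset_iff pg_points_span span_singleton_subset[OF sub])
    show "card H = CARD('a) + 2" unfolding H_def using card_image[OF inj] cardV q by simp
    fix p r s assume "p \<in> H" "r \<in> H" "s \<in> H" and d: "p \<noteq> r \<and> p \<noteq> s \<and> r \<noteq> s"
    then obtain u v w where uvw: "u \<in> V" "v \<in> V" "w \<in> V" "p = vec.span {u}" "r = vec.span {v}" "s = vec.span {w}"
      unfolding H_def by blast
    show "\<not> collinear_points p r s"
    proof
      assume "collinear_points p r s"
      then obtain l where l: "l \<in> pg_lines" "p \<subseteq> l" "r \<subseteq> l" "s \<subseteq> l" unfolding collinear_points_def by blast
      then have "u \<in> l" "v \<in> l" "w \<in> l" using uvw(4-6) vec.span_base by blast+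
      then have "det3 u v w = 0" using det3_line[OF l(1)] by blast
      then show False using det[OF uvw(1-3)] d uvw(4-6) by blast
    qed
  qed
  moreover have "P \<in> pg_points" unfolding P_def pg_points_span by (simp add: vec_eq_iff forall_4)
  moreover have "\<not> P \<subseteq> \<pi>"
    unfolding P_def span_singleton_subset[OF sub] by (simp add: \<pi>_def)
  ultimately show ?thesis using \<pi> by blast
qed

section \<open>Collineations induced by injective linear maps\<close>

context
  fixes g :: "'a::{field,finite} ^ 4 \<Rightarrow> 'a ^ 4"
  assumes lin: "Vector_Spaces.linear (*s) (*s) g" and inj: "inj g"
begin

lemma image_span: "g ` vec.span S = vec.span (g ` S)"
  using vec.linear_span_image[OF lin] by simp

lemma image_subspace_iff: "vec.subspace (g ` S) \<longleftrightarrow> vec.subspace S"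
proof
  assume "vec.subspace (g ` S)"
  then have "g ` vec.span S = g ` S" by (simp add: image_span vec.span_eq_iff[THEN iffD2])
  then have "vec.span S = S" using inj by (simp add: inj_image_eq_iff)
  then show "vec.subspace S" by (metis vec.subspace_span)
next
  assume "vec.subspace S"
  then show "vec.subspace (g ` S)" by (rule vec.linear_subspace_image[OF lin])
qed

lemma image_dim: "vec.dim (g ` S) = vec.dim S"
  by (rule vec.dim_image_eq[OF lin]) (use inj inj_on_subset in blast)

lemma surj: "surj g"
  using inj by (simp add: finite_UNIV_inj_surj)

lemma image_pg_iff:
  "g ` S \<in> pg_points \<longleftrightarrow> S \<in> pg_points" "g ` S \<in> pg_lines \<longleftrightarrow> S \<in> pg_lines"
  "g ` S \<in> pg_planes \<longleftrightarrow> S \<in> pg_planes"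
  by (simp_all add: pg_defs image_subspace_iff image_dim)

lemma image_subset_image_iff: "g ` S \<subseteq> g ` T \<longleftrightarrow> S \<subseteq> T"
  using inj by (simp add: inj_image_subset_iff)

lemma exists_preimage: "\<exists>S. T = g ` S"
  using surj by (metis surj_image_vimage_eq)

lemma collineation_image: "collineation ((`) g)"
proof -
  have "inj_on ((`) g) {S. vec.subspace S}"
    using inj by (auto intro!: inj_onI simp: inj_image_eq_iff)
  moreover have "(`) g ` {S. vec.subspace S} = {S. vec.subspace S}"
  proof (intro equalityI subsetI)
    fix T :: "('a ^ 4) set" assume T: "T \<in> {S. vec.subspace S}"
    obtain S where S: "T = g ` S" using exists_preimage by blast
    then have "vec.subspace S" using T by (simp add: image_subspace_iff)
    then show "T \<in> (`) g ` {S. vec.subspace S}" using S by blast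
  qed (auto simp: image_subspace_iff)
  ultimately show ?thesis
    unfolding collineation_def bij_betw_def image_subset_image_iff by simp
qed

lemma meets_image_iff: "meets (g ` l) (g ` m) \<longleftrightarrow> meets l m"
proof -
  have "(\<exists>T. Q T) \<longleftrightarrow> (\<exists>S. Q (g ` S))" for Q
    using exists_preimage by metis
  then have "meets (g ` l) (g ` m) \<longleftrightarrow> (\<exists>p. g ` p \<in> pg_points \<and> g ` p \<subseteq> g ` l \<and> g ` p \<subseteq> g ` m)"
    unfolding meets_def Bex_def .
  then show ?thesis unfolding meets_def Bex_def image_pg_iff image_subset_image_iff .
qed

lemma cone_image: "cone (g ` P) ((`) g ` H) = (`) g ` cone P H"
  unfolding cone_def join_def image_image by (simp add: image_span image_Un)

text \<open>Every ingredient of the class commutes with taking images, and every set of vectors is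
  the image of some set because \<open>g\<close> is surjective.\<close>

lemma hyperoval_line_class_image:
  "hyperoval_line_class (g ` P) (g ` \<pi>) ((`) g ` H) = (`) g ` hyperoval_line_class P \<pi> H"
proof -
  have "card {c \<in> (`) g ` A. meets (g ` m) c} = card {c \<in> A. meets m c}" for A m
  proof -
    have "{c \<in> (`) g ` A. meets (g ` m) c} = (`) g ` {c \<in> A. meets m c}"
      using meets_image_iff by blast
    moreover have "inj_on ((`) g) X" for X
      using inj by (auto intro!: inj_onI simp: inj_image_eq_iff)
    ultimately show ?thesis by (simp add: card_image)
  qed
  then have "g ` m \<in> hyperoval_line_class (g ` P) (g ` \<pi>) ((`) g ` H) \<longleftrightarrow> m \<in> hyperoval_line_class P \<pi> H" for m
    unfolding hyperoval_line_class_def cone_image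
    by (simp add: image_pg_iff image_subset_image_iff inj inj_image_eq_iff image_iff)
  note mem = this
  show ?thesis
  proof (intro equalityI subsetI)
    fix k assume k: "k \<in> hyperoval_line_class (g ` P) (g ` \<pi>) ((`) g ` H)"
    obtain m where m: "k = g ` m" using exists_preimage by blast
    show "k \<in> (`) g ` hyperoval_line_class P \<pi> H"
      using k unfolding m mem by blast
  next
    fix k assume "k \<in> (`) g ` hyperoval_line_class P \<pi> H"
    then obtain m where "k = g ` m" "m \<in> hyperoval_line_class P \<pi> H" by blast
    then show "k \<in> hyperoval_line_class (g ` P) (g ` \<pi>) ((`) g ` H)" using mem by simp
  qed
qed

end

text \<open>Adding a representative of the vertex to the three frame vectors gives a basis of the
  whole space. Both hyperovals have the same coefficients in their frames, with the same
  \<open>\<omega>\<close> and \<open>\<omega>'\<close>, so the linear map between the two bases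
  carries one cone to the other.\<close>

lemma frames_collineation:
  fixes P P' \<pi> \<pi>' :: "('a::{field,finite} ^ 4) set"
  assumes q: "CARD('a) = 4"
    and P: "P \<in> pg_points" "\<pi> \<in> pg_planes" "\<not> P \<subseteq> \<pi>" "hyperoval_in H \<pi>"
    and P': "P' \<in> pg_points" "\<pi>' \<in> pg_planes" "\<not> P' \<subseteq> \<pi>'" "hyperoval_in H' \<pi>'"
  shows "\<exists>f. collineation f \<and> hyperoval_line_class P' \<pi>' H' = f ` hyperoval_line_class P \<pi> H"
proof -
  obtain \<omega> \<omega>' :: 'a where \<omega>: "UNIV = {0, 1, \<omega>, \<omega>'}" using field4_elements[OF q] by metis
  obtain u v w where F: "vec.independent {u, v, w}" "u \<noteq> v" "u \<noteq> w" "v \<noteq> w" "vec.span {u, v, w} = \<pi>"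
    "H = frame_oval \<omega> \<omega>' u v w"
    by (rule hyperoval_frame[OF q P(4,2) \<omega>])
  obtain u' v' w' where F': "vec.independent {u', v', w'}" "u' \<noteq> v'" "u' \<noteq> w'" "v' \<noteq> w'"
    "vec.span {u', v', w'} = \<pi>'" "H' = frame_oval \<omega> \<omega>' u' v' w'"
    by (rule hyperoval_frame[OF q P'(4,2) \<omega>])
  obtain x where x: "P = vec.span {x}" using obtain_representative[OF P(1)] by blast
  obtain x' where x': "P' = vec.span {x'}" using obtain_representative[OF P'(1)] by blast
  have nx: "x \<notin> vec.span {u, v, w}" "x' \<notin> vec.span {u', v', w'}"
    using P(2,3) P'(2,3) unfolding x x' F(5) F'(5) by (auto simp: pg_planes_def span_singleton_subset)
  then have d: "x \<notin> {u, v, w}" "x' \<notin> {u', v', w'}"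
    using vec.span_superset[of "{u, v, w}"] vec.span_superset[of "{u', v', w'}"] by blast+
  have ind: "vec.independent {x, u, v, w}" "vec.independent {x', u', v', w'}"
    using nx F(1) F'(1) d by (simp_all only: vec.independent_insert[of x] vec.independent_insert[of x'] if_False) simp_all
  define h where "h y = (if y = x then x' else if y = u then u' else if y = v then v' else w')" for y
  have h: "h x = x'" "h u = u'" "h v = v'" "h w = w'" using d F(2-4) unfolding h_def by auto
  have "inj_on h {x, u, v, w}" unfolding inj_on_def using h d F'(2-4) by auto
  moreover have "h ` {x, u, v, w} = {x', u', v', w'}" using h by simp
  ultimately obtain g where g: "Vector_Spaces.linear (*s) (*s) g" "inj g" "\<forall>y\<in>{x, u, v, w}. g y = h y"
    using vec.linear_independent_extend_inj[OF ind(1), of h] ind(2) by auto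
  have gv: "g x = x'" "g u = u'" "g v = v'" "g w = w'" using g(3) h by auto
  interpret g: Vector_Spaces.linear "(*s)" "(*s)" g by (rule g(1))
  have "g ` P = P'" unfolding x x' image_span[OF g(1,2)] using gv by simp
  moreover have "g ` \<pi> = \<pi>'" unfolding F(5)[symmetric] F'(5)[symmetric] image_span[OF g(1,2)] using gv by simp
  moreover have "(`) g ` H = H'"
    unfolding F(6) F'(6) frame_oval_def image_image image_span[OF g(1,2)]
    by (simp add: gv g.add g.scale)
  ultimately have "hyperoval_line_class P' \<pi>' H' = (`) g ` hyperoval_line_class P \<pi> H"
    using hyperoval_line_class_image[OF g(1,2), of P \<pi> H] by simp
  then show ?thesis using collineation_image[OF g(1,2)] by blast
qed

theorem theorem2:
  assumes "CARD('a::{field,finite}) = 4"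
  shows
    "(\<forall>L :: ('a ^ 4) set set. cameron_liebler L 7 \<longrightarrow>
        (\<exists>P \<pi> H. P \<in> pg_points \<and> \<pi> \<in> pg_planes \<and> \<not> P \<subseteq> \<pi> \<and> hyperoval_in H \<pi> \<and>
           L = hyperoval_line_class P \<pi> H)) \<and>
     (\<exists>L :: ('a ^ 4) set set. cameron_liebler L 7) \<and>
     (\<forall>L L' :: ('a ^ 4) set set. cameron_liebler L 7 \<longrightarrow> cameron_liebler L' 7 \<longrightarrow>
        (\<exists>f. collineation f \<and> L' = f ` L))"
proof -
  have classified: "\<exists>P \<pi> H. P \<in> pg_points \<and> \<pi> \<in> pg_planes \<and> \<not> P \<subseteq> \<pi> \<and> hyperoval_in H \<pi> \<and>
      L = hyperoval_line_class P \<pi> H" if "cameron_liebler L 7" for L :: "('a ^ 4) set set"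
  proof -
    interpret cl34 pg_points pg_lines pg_planes "(\<subseteq>)" L
      using that cameron_liebler_iff[OF assms] by blast
    obtain P \<pi> H where ov: "oval34 pg_points pg_lines pg_planes (\<subseteq>) P \<pi> H"
      and "L = oval34.cls pg_points pg_lines (\<subseteq>) P \<pi> H"
      by (rule classification)
    then have "L = hyperoval_line_class P \<pi> H"
      using cls_eq_hyperoval_line_class[OF assms ov] by simp
    moreover have "P \<in> pg_points \<and> \<pi> \<in> pg_planes \<and> \<not> P \<subseteq> \<pi> \<and> hyperoval_in H \<pi>"
      using ov unfolding oval34_pg_iff[OF assms] .
    ultimately show ?thesis by blast
  qed
  moreover have "\<exists>L :: ('a ^ 4) set set. cameron_liebler L 7"
  proof -
    obtain P \<pi> :: "('a ^ 4) set" and H where "oval34 pg_points pg_lines pg_planes (\<subseteq>) P \<pi> H"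
      using exists_hyperoval[OF assms] unfolding oval34_pg_iff[OF assms, symmetric] by blast
    from oval34.cl34_cls[OF this] show ?thesis
      unfolding cameron_liebler_iff[OF assms] by (rule exI)
  qed
  moreover have "\<exists>f. collineation f \<and> L' = f ` L"
    if cl: "cameron_liebler L 7" "cameron_liebler L' 7" for L L' :: "('a ^ 4) set set"
  proof -
    obtain P \<pi> H where P: "P \<in> pg_points" "\<pi> \<in> pg_planes" "\<not> P \<subseteq> \<pi>" "hyperoval_in H \<pi>"
      and L: "L = hyperoval_line_class P \<pi> H"
      using classified[OF cl(1)] by blast
    obtain P' \<pi>' H' where P': "P' \<in> pg_points" "\<pi>' \<in> pg_planes" "\<not> P' \<subseteq> \<pi>'" "hyperoval_in H' \<pi>'"
      and L': "L' = hyperoval_line_class P' \<pi>' H'"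
      using classified[OF cl(2)] by blast
    show ?thesis unfolding L L' by (rule frames_collineation[OF assms P P'])
  qed
  ultimately show ?thesis by blast
qed

end
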